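(* Let $A$ be a commutative Noetherian ring of (Krull) dimension $d$. Assume that for every finite extension $R$ of $A$, the free module $R^d$ is a cancellative $R$-module. Then every projective $A$-module of rank $d$ is cancellative.
   Context: All rings are commutative Noetherian and all modules are finitely generated. For a ring $A$, a projective $A$-module $P$ (of constant rank) is called cancellative if, for every projective $A$-module $Q$ and every $m\ge 0$, $P\oplus A^m\cong Q\oplus A^m$ implies $P\cong Q$. A finite extension $R$ of $A$ is a commutative ring $R\supseteq A$ that is finitely generated as an $A$-module. *)

theory Defs
  imports "HOL-Algebra.Algebra" "HOL-Library.Extended_Real"
begin

section \<open>Modules over a commutative ring\<close>

text \<open>
  The record type of modules extends the record type of rings; the fields \<open>mult\<close> and \<open>one\<close> of a
  module play no role and are mostly left unspecified below.
\<close>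

definition module_hom ::
    "('r, 'k) ring_scheme \<Rightarrow> ('r, 'm, 'x) module_scheme \<Rightarrow> ('r, 'n, 'y) module_scheme \<Rightarrow> ('m \<Rightarrow> 'n) set"
  where "module_hom R M N =
    {f \<in> carrier M \<rightarrow> carrier N.
      (\<forall>x\<in>carrier M. \<forall>y\<in>carrier M. f (x \<oplus>\<^bsub>M\<^esub> y) = f x \<oplus>\<^bsub>N\<^esub> f y) \<and>
      (\<forall>a\<in>carrier R. \<forall>x\<in>carrier M. f (a \<odot>\<^bsub>M\<^esub> x) = a \<odot>\<^bsub>N\<^esub> f x)}"

definition module_isomorphic ::
    "('r, 'k) ring_scheme \<Rightarrow> ('r, 'm, 'x) module_scheme \<Rightarrow> ('r, 'n, 'y) module_scheme \<Rightarrow> bool"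
  where "module_isomorphic R M N \<longleftrightarrow>
    (\<exists>f\<in>module_hom R M N. bij_betw f (carrier M) (carrier N))"

definition direct_sum ::
    "('r, 'm, 'x) module_scheme \<Rightarrow> ('r, 'n, 'y) module_scheme \<Rightarrow> ('r, 'm \<times> 'n) module"
  where "direct_sum M N =
    \<lparr>carrier = carrier M \<times> carrier N,
     monoid.mult = undefined, monoid.one = undefined,
     ring.zero = (\<zero>\<^bsub>M\<^esub>, \<zero>\<^bsub>N\<^esub>),
     ring.add = (\<lambda>(x, y) (x', y'). (x \<oplus>\<^bsub>M\<^esub> x', y \<oplus>\<^bsub>N\<^esub> y')),
     smult = (\<lambda>a (x, y). (a \<odot>\<^bsub>M\<^esub> x, a \<odot>\<^bsub>N\<^esub> y))\<rparr>"

definition free_module :: "('r, 'k) ring_scheme \<Rightarrow> nat \<Rightarrow> ('r, nat \<Rightarrow> 'r) module"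
  where "free_module R n =
    \<lparr>carrier = {..<n} \<rightarrow>\<^sub>E carrier R,
     monoid.mult = undefined, monoid.one = undefined,
     ring.zero = (\<lambda>i\<in>{..<n}. \<zero>\<^bsub>R\<^esub>),
     ring.add = (\<lambda>x y. \<lambda>i\<in>{..<n}. x i \<oplus>\<^bsub>R\<^esub> y i),
     smult = (\<lambda>a x. \<lambda>i\<in>{..<n}. a \<otimes>\<^bsub>R\<^esub> x i)\<rparr>"

definition finitely_generated :: "('r, 'k) ring_scheme \<Rightarrow> ('r, 'm, 'x) module_scheme \<Rightarrow> bool"
  where "finitely_generated R M \<longleftrightarrow>
    (\<exists>G\<subseteq>carrier M. finite G \<and>
      carrier M = {(\<Oplus>\<^bsub>M\<^esub>x\<in>G. c x \<odot>\<^bsub>M\<^esub> x) | c. c \<in> G \<rightarrow> carrier R})"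

text \<open>
  Finitely generated projective modules are the direct summands of the modules \<open>R\<^sup>n\<close>. The
  complement is isomorphic to a submodule of \<open>R\<^sup>n\<close>, so its carrier may be taken in the type of
  elements of \<open>R\<^sup>n\<close>.
\<close>

definition fg_projective :: "('r, 'k) ring_scheme \<Rightarrow> ('r, 'm, 'x) module_scheme \<Rightarrow> bool"
  where "fg_projective R P \<longleftrightarrow> module R P \<and>
    (\<exists>n. \<exists>Q :: ('r, nat \<Rightarrow> 'r) module. module R Q \<and>
      module_isomorphic R (direct_sum P Q) (free_module R n))"

text \<open>
  The type argument is the type in which the competing modules \<open>Q\<close> have their carriers. The type
  \<open>'r list set\<close> loses nothing: every finitely generated \<open>R\<close>-module is isomorphic to one carried by
  it, see \<open>finitely_generated_universe\<close> below.
\<close>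

definition cancellative ::
    "'q itself \<Rightarrow> ('r, 'k) ring_scheme \<Rightarrow> ('r, 'm, 'x) module_scheme \<Rightarrow> bool"
  where "cancellative T R P \<longleftrightarrow>
    (\<forall>(Q :: ('r, 'q) module) m.
      fg_projective R Q \<longrightarrow>
      module_isomorphic R (direct_sum P (free_module R m)) (direct_sum Q (free_module R m)) \<longrightarrow>
      module_isomorphic R P Q)"


section \<open>Krull dimension and finite extensions\<close>

text \<open>The supremum is taken in \<open>ereal\<close>, so that the zero ring has dimension \<open>-\<infinity>\<close>, not \<open>0\<close>.\<close>

definition krull_dim :: "('r, 'k) ring_scheme \<Rightarrow> ereal"
  where "krull_dim R =
    (SUP n \<in> {n. \<exists>p :: nat \<Rightarrow> 'r set.
        (\<forall>i\<le>n. primeideal (p i) R) \<and> (\<forall>i<n. p i \<subset> p (Suc i))}. ereal (real n))"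

definition module_via :: "('a \<Rightarrow> 'r) \<Rightarrow> ('r, 'k) ring_scheme \<Rightarrow> ('a, 'r) module"
  where "module_via \<phi> R =
    \<lparr>carrier = carrier R,
     monoid.mult = monoid.mult R, monoid.one = monoid.one R,
     ring.zero = ring.zero R, ring.add = ring.add R,
     smult = (\<lambda>a x. \<phi> a \<otimes>\<^bsub>R\<^esub> x)\<rparr>"

text \<open>The inclusion of \<open>A\<close> into \<open>R\<close> is an explicit injective ring homomorphism \<open>\<phi>\<close>.\<close>

definition finite_extension ::
    "('a, 'k) ring_scheme \<Rightarrow> ('r, 'l) ring_scheme \<Rightarrow> ('a \<Rightarrow> 'r) \<Rightarrow> bool"
  where "finite_extension A R \<phi> \<longleftrightarrow>
    cring R \<and> \<phi> \<in> ring_hom A R \<and> inj_on \<phi> (carrier A) \<and>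
    finitely_generated A (module_via \<phi> R)"


section \<open>Localization and rank\<close>

text \<open>
  The fraction \<open>m / s\<close> is the class of the pair \<open>(m, s)\<close>. The operations on classes are unions over
  representatives, all of whose members coincide; see \<open>localization_ring_simps\<close> and
  \<open>localization_module_simps\<close> below.
\<close>

definition fraction ::
    "'r set \<Rightarrow> ('r, 'm, 'x) module_scheme \<Rightarrow> 'm \<Rightarrow> 'r \<Rightarrow> ('m \<times> 'r) set"
  where "fraction S M m s =
    {(n, t). n \<in> carrier M \<and> t \<in> S \<and> (\<exists>u\<in>S. u \<odot>\<^bsub>M\<^esub> (t \<odot>\<^bsub>M\<^esub> m) = u \<odot>\<^bsub>M\<^esub> (s \<odot>\<^bsub>M\<^esub> n))}"

definition localization_ring ::
    "('r, 'k) ring_scheme \<Rightarrow> 'r set \<Rightarrow> ('r \<times> 'r) set ring"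
  where "localization_ring R S =
    (let fr = fraction S (module_via id R) in
     \<lparr>carrier = {fr a s | a s. a \<in> carrier R \<and> s \<in> S},
      monoid.mult = (\<lambda>U V. \<Union>(a, s)\<in>U. \<Union>(b, t)\<in>V. fr (a \<otimes>\<^bsub>R\<^esub> b) (s \<otimes>\<^bsub>R\<^esub> t)),
      monoid.one = fr \<one>\<^bsub>R\<^esub> \<one>\<^bsub>R\<^esub>,
      ring.zero = fr \<zero>\<^bsub>R\<^esub> \<one>\<^bsub>R\<^esub>,
      ring.add = (\<lambda>U V. \<Union>(a, s)\<in>U. \<Union>(b, t)\<in>V.
              fr (t \<otimes>\<^bsub>R\<^esub> a \<oplus>\<^bsub>R\<^esub> s \<otimes>\<^bsub>R\<^esub> b) (s \<otimes>\<^bsub>R\<^esub> t))\<rparr>)"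

definition localization_module ::
    "('r, 'k) ring_scheme \<Rightarrow> 'r set \<Rightarrow> ('r, 'm, 'x) module_scheme \<Rightarrow>
      (('r \<times> 'r) set, ('m \<times> 'r) set) module"
  where "localization_module R S M =
    (let fr = fraction S M in
     \<lparr>carrier = {fr x s | x s. x \<in> carrier M \<and> s \<in> S},
      monoid.mult = undefined, monoid.one = undefined,
      ring.zero = fr \<zero>\<^bsub>M\<^esub> \<one>\<^bsub>R\<^esub>,
      ring.add = (\<lambda>U V. \<Union>(x, s)\<in>U. \<Union>(y, t)\<in>V.
              fr (t \<odot>\<^bsub>M\<^esub> x \<oplus>\<^bsub>M\<^esub> s \<odot>\<^bsub>M\<^esub> y) (s \<otimes>\<^bsub>R\<^esub> t)),
      smult = (\<lambda>U V. \<Union>(a, s)\<in>U. \<Union>(y, t)\<in>V. fr (a \<odot>\<^bsub>M\<^esub> y) (s \<otimes>\<^bsub>R\<^esub> t))\<rparr>)"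

text \<open>Constant rank \<open>d\<close>: at every prime \<open>p\<close> the localization \<open>M\<^sub>p\<close> is free of rank \<open>d\<close> over \<open>R\<^sub>p\<close>.\<close>

definition has_rank :: "('r, 'k) ring_scheme \<Rightarrow> ('r, 'm, 'x) module_scheme \<Rightarrow> nat \<Rightarrow> bool"
  where "has_rank R M d \<longleftrightarrow>
    (\<forall>p. primeideal p R \<longrightarrow>
      (let S = carrier R - p; R\<^sub>p = localization_ring R S in
        module_isomorphic R\<^sub>p (localization_module R S M) (free_module R\<^sub>p d)))"


section \<open>Basic facts\<close>

lemma free_module_simps [simp]:
  "carrier (free_module R n) = ({..<n} \<rightarrow>\<^sub>E carrier R)"
  "\<zero>\<^bsub>free_module R n\<^esub> = (\<lambda>i\<in>{..<n}. \<zero>\<^bsub>R\<^esub>)"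
  "x \<oplus>\<^bsub>free_module R n\<^esub> y = (\<lambda>i\<in>{..<n}. x i \<oplus>\<^bsub>R\<^esub> y i)"
  "a \<odot>\<^bsub>free_module R n\<^esub> x = (\<lambda>i\<in>{..<n}. a \<otimes>\<^bsub>R\<^esub> x i)"
  by (simp_all add: free_module_def)

lemma direct_sum_simps [simp]:
  "carrier (direct_sum M N) = carrier M \<times> carrier N"
  "\<zero>\<^bsub>direct_sum M N\<^esub> = (\<zero>\<^bsub>M\<^esub>, \<zero>\<^bsub>N\<^esub>)"
  "(x, y) \<oplus>\<^bsub>direct_sum M N\<^esub> (x', y') = (x \<oplus>\<^bsub>M\<^esub> x', y \<oplus>\<^bsub>N\<^esub> y')"
  "a \<odot>\<^bsub>direct_sum M N\<^esub> (x, y) = (a \<odot>\<^bsub>M\<^esub> x, a \<odot>\<^bsub>N\<^esub> y)"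
  by (simp_all add: direct_sum_def)

lemma module_via_simps [simp]:
  "carrier (module_via \<phi> R) = carrier R"
  "\<zero>\<^bsub>module_via \<phi> R\<^esub> = \<zero>\<^bsub>R\<^esub>"
  "x \<oplus>\<^bsub>module_via \<phi> R\<^esub> y = x \<oplus>\<^bsub>R\<^esub> y"
  "a \<odot>\<^bsub>module_via \<phi> R\<^esub> x = \<phi> a \<otimes>\<^bsub>R\<^esub> x"
  by (simp_all add: module_via_def)

lemma module_free_module:
  assumes "cring R"
  shows "module R (free_module R n)"
proof -
  interpret R: cring R by fact
  show ?thesis
  proof (rule moduleI[OF assms])
    show "abelian_group (free_module R n)"
    proof (rule abelian_groupI, goal_cases)
      case (6 x)
      then show ?case
        by (intro bexI[of _ "\<lambda>i\<in>{..<n}. \<ominus>\<^bsub>R\<^esub> x i"])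
          (auto simp: PiE_iff fun_eq_iff R.l_neg)
    qed (auto simp: PiE_iff extensional_def fun_eq_iff R.a_ac)
  qed (auto simp: PiE_iff extensional_def fun_eq_iff R.l_distr R.r_distr R.m_assoc)
qed

lemma module_direct_sum:
  assumes "module R M" "module R N"
  shows "module R (direct_sum M N)"
proof -
  interpret M: module R M by fact
  interpret N: module R N by fact
  show ?thesis
  proof (rule moduleI[OF M.is_cring])
    show "abelian_group (direct_sum M N)"
    proof (rule abelian_groupI, goal_cases)
      case (6 x)
      then show ?case
        by (intro bexI[of _ "(\<ominus>\<^bsub>M\<^esub> fst x, \<ominus>\<^bsub>N\<^esub> snd x)"]) (auto simp: M.M.l_neg N.M.l_neg)
    qed (auto simp: M.M.a_ac N.M.a_ac)
  qed (auto simp: M.smult_l_distr N.smult_l_distr M.smult_r_distr N.smult_r_distr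
      M.smult_assoc1 N.smult_assoc1)
qed

lemma module_module_via:
  assumes "cring A" "cring R" "\<phi> \<in> ring_hom A R"
  shows "module A (module_via \<phi> R)"
proof -
  interpret A: cring A by fact
  interpret R: cring R by fact
  interpret h: ring_hom_ring A R \<phi>
    by (intro ring_hom_ringI2 assms A.ring_axioms R.ring_axioms)
  show ?thesis
  proof (rule moduleI[OF assms(1)])
    show "abelian_group (module_via \<phi> R)"
    proof (rule abelian_groupI, goal_cases)
      case (6 x)
      then show ?case
        by (intro bexI[of _ "\<ominus>\<^bsub>R\<^esub> x"]) (auto simp: R.l_neg)
    qed (auto simp: R.a_ac)
  qed (auto simp: R.l_distr R.r_distr R.m_assoc)
qed

lemma abelian_group_cong:
  assumes "abelian_group M" "carrier N = carrier M" "\<zero>\<^bsub>N\<^esub> = \<zero>\<^bsub>M\<^esub>"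
    and "\<And>x y. x \<oplus>\<^bsub>N\<^esub> y = x \<oplus>\<^bsub>M\<^esub> y"
  shows "abelian_group N"
proof -
  interpret M: abelian_group M by fact
  show ?thesis
  proof (rule abelian_groupI, goal_cases)
    case (6 x)
    then show ?case
      using assms by (intro bexI[of _ "\<ominus>\<^bsub>M\<^esub> x"]) (auto simp: M.l_neg)
  qed (use assms in \<open>auto simp: M.a_ac\<close>)
qed


lemma UN_pairs_constant:
  assumes "p \<in> U" "q \<in> V"
    and "\<And>x s y t. (x, s) \<in> U \<Longrightarrow> (y, t) \<in> V \<Longrightarrow> F x s y t = C"
  shows "(\<Union>(x, s)\<in>U. \<Union>(y, t)\<in>V. F x s y t) = C"
proof (rule UN_constant_eq[OF assms(1)], rule ballI)
  fix z assume z: "z \<in> U"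
  show "(case z of (x, s) \<Rightarrow> \<Union>(y, t)\<in>V. F x s y t) = C"
    using z assms(2,3) by (cases z) (auto intro!: UN_constant_eq)
qed

locale localization_data = module R M for R :: "('r, 'k) ring_scheme" and M :: "('r, 'm, 'x) module_scheme" +
  fixes S :: "'r set"
  assumes S_sub: "S \<subseteq> carrier R" and S_one: "\<one>\<^bsub>R\<^esub> \<in> S"
    and S_mult: "s \<in> S \<Longrightarrow> t \<in> S \<Longrightarrow> s \<otimes>\<^bsub>R\<^esub> t \<in> S"
begin

lemma S_carrier [simp]: "s \<in> S \<Longrightarrow> s \<in> carrier R"
  using S_sub by blast

lemma smult_comm:
  "a \<in> carrier R \<Longrightarrow> b \<in> carrier R \<Longrightarrow> x \<in> carrier M \<Longrightarrow>
    a \<odot>\<^bsub>M\<^esub> (b \<odot>\<^bsub>M\<^esub> x) = b \<odot>\<^bsub>M\<^esub> (a \<odot>\<^bsub>M\<^esub> x)"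
  by (metis smult_assoc1 R.m_comm)

lemma fraction_eqI:
  assumes "x \<in> carrier M" "y \<in> carrier M" "s \<in> S" "t \<in> S" "u \<in> S"
    and e: "u \<odot>\<^bsub>M\<^esub> (t \<odot>\<^bsub>M\<^esub> x) = u \<odot>\<^bsub>M\<^esub> (s \<odot>\<^bsub>M\<^esub> y)"
  shows "fraction S M x s = fraction S M y t"
proof -
  have sub: "fraction S M x s \<subseteq> fraction S M y t"
    if a: "x \<in> carrier M" "y \<in> carrier M" "s \<in> S" "t \<in> S" "u \<in> S"
      "u \<odot>\<^bsub>M\<^esub> (t \<odot>\<^bsub>M\<^esub> x) = u \<odot>\<^bsub>M\<^esub> (s \<odot>\<^bsub>M\<^esub> y)" for x y s t u
  proof (clarsimp simp: fraction_def)
    fix n r v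
    assume b: "n \<in> carrier M" "r \<in> S" "v \<in> S"
      and f: "v \<odot>\<^bsub>M\<^esub> (r \<odot>\<^bsub>M\<^esub> x) = v \<odot>\<^bsub>M\<^esub> (s \<odot>\<^bsub>M\<^esub> n)"
    let ?w = "u \<otimes>\<^bsub>R\<^esub> v \<otimes>\<^bsub>R\<^esub> s"
    have "?w \<odot>\<^bsub>M\<^esub> (r \<odot>\<^bsub>M\<^esub> y) = v \<odot>\<^bsub>M\<^esub> (r \<odot>\<^bsub>M\<^esub> (u \<odot>\<^bsub>M\<^esub> (s \<odot>\<^bsub>M\<^esub> y)))"
      using a(1-5) b by (simp add: smult_assoc1[symmetric] R.m_ac)
    also have "\<dots> = v \<odot>\<^bsub>M\<^esub> (r \<odot>\<^bsub>M\<^esub> (u \<odot>\<^bsub>M\<^esub> (t \<odot>\<^bsub>M\<^esub> x)))"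
      using a by simp
    also have "\<dots> = u \<odot>\<^bsub>M\<^esub> (t \<odot>\<^bsub>M\<^esub> (v \<odot>\<^bsub>M\<^esub> (r \<odot>\<^bsub>M\<^esub> x)))"
      using a(1-5) b by (simp add: smult_assoc1[symmetric] R.m_ac)
    also have "\<dots> = u \<odot>\<^bsub>M\<^esub> (t \<odot>\<^bsub>M\<^esub> (v \<odot>\<^bsub>M\<^esub> (s \<odot>\<^bsub>M\<^esub> n)))"
      using f by simp
    also have "\<dots> = ?w \<odot>\<^bsub>M\<^esub> (t \<odot>\<^bsub>M\<^esub> n)"
      using a(1-5) b by (simp add: smult_assoc1[symmetric] R.m_ac)
    finally show "\<exists>w\<in>S. w \<odot>\<^bsub>M\<^esub> (r \<odot>\<^bsub>M\<^esub> y) = w \<odot>\<^bsub>M\<^esub> (t \<odot>\<^bsub>M\<^esub> n)"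
      using a b by (intro bexI[of _ ?w]) (auto intro: S_mult)
  qed
  from sub[of x y s t u] sub[of y x t s u] assms show ?thesis by auto
qed

lemma fraction_self: "x \<in> carrier M \<Longrightarrow> s \<in> S \<Longrightarrow> (x, s) \<in> fraction S M x s"
  using S_one by (auto simp: fraction_def)

lemma fraction_eq_iff:
  assumes "x \<in> carrier M" "y \<in> carrier M" "s \<in> S" "t \<in> S"
  shows "fraction S M x s = fraction S M y t \<longleftrightarrow>
    (\<exists>u\<in>S. u \<odot>\<^bsub>M\<^esub> (t \<odot>\<^bsub>M\<^esub> x) = u \<odot>\<^bsub>M\<^esub> (s \<odot>\<^bsub>M\<^esub> y))"
proof
  assume "fraction S M x s = fraction S M y t"
  then have "(y, t) \<in> fraction S M x s" using fraction_self assms by auto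
  then show "\<exists>u\<in>S. u \<odot>\<^bsub>M\<^esub> (t \<odot>\<^bsub>M\<^esub> x) = u \<odot>\<^bsub>M\<^esub> (s \<odot>\<^bsub>M\<^esub> y)"
    by (auto simp: fraction_def)
qed (use assms fraction_eqI in blast)

lemma mem_fraction:
  assumes "x \<in> carrier M" "s \<in> S" "(y, t) \<in> fraction S M x s"
  obtains u where "y \<in> carrier M" "t \<in> S" "u \<in> S"
    "u \<odot>\<^bsub>M\<^esub> (t \<odot>\<^bsub>M\<^esub> x) = u \<odot>\<^bsub>M\<^esub> (s \<odot>\<^bsub>M\<^esub> y)"
  using assms by (auto simp: fraction_def)

lemma fraction_add:
  assumes x: "x \<in> carrier M" "s \<in> S" and y: "y \<in> carrier M" "t \<in> S"
  shows "(\<Union>(x', s')\<in>fraction S M x s. \<Union>(y', t')\<in>fraction S M y t.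
      fraction S M (t' \<odot>\<^bsub>M\<^esub> x' \<oplus>\<^bsub>M\<^esub> s' \<odot>\<^bsub>M\<^esub> y') (s' \<otimes>\<^bsub>R\<^esub> t')) =
    fraction S M (t \<odot>\<^bsub>M\<^esub> x \<oplus>\<^bsub>M\<^esub> s \<odot>\<^bsub>M\<^esub> y) (s \<otimes>\<^bsub>R\<^esub> t)" (is "?L = ?Rh")
proof -
  have *: "fraction S M (t' \<odot>\<^bsub>M\<^esub> x' \<oplus>\<^bsub>M\<^esub> s' \<odot>\<^bsub>M\<^esub> y') (s' \<otimes>\<^bsub>R\<^esub> t') = ?Rh"
    if h: "(x', s') \<in> fraction S M x s" "(y', t') \<in> fraction S M y t" for x' s' y' t'
  proof -
    obtain u where u: "x' \<in> carrier M" "s' \<in> S" "u \<in> S"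
      "u \<odot>\<^bsub>M\<^esub> (s' \<odot>\<^bsub>M\<^esub> x) = u \<odot>\<^bsub>M\<^esub> (s \<odot>\<^bsub>M\<^esub> x')"
      using mem_fraction[OF x h(1)] .
    obtain v where v: "y' \<in> carrier M" "t' \<in> S" "v \<in> S"
      "v \<odot>\<^bsub>M\<^esub> (t' \<odot>\<^bsub>M\<^esub> y) = v \<odot>\<^bsub>M\<^esub> (t \<odot>\<^bsub>M\<^esub> y')"
      using mem_fraction[OF y h(2)] .
    have 1: "(u \<otimes>\<^bsub>R\<^esub> v) \<odot>\<^bsub>M\<^esub> ((s \<otimes>\<^bsub>R\<^esub> t) \<odot>\<^bsub>M\<^esub> (t' \<odot>\<^bsub>M\<^esub> x')) =
        (u \<otimes>\<^bsub>R\<^esub> v) \<odot>\<^bsub>M\<^esub> ((s' \<otimes>\<^bsub>R\<^esub> t') \<odot>\<^bsub>M\<^esub> (t \<odot>\<^bsub>M\<^esub> x))" (is "?a = ?b")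
    proof -
      have "?a = v \<odot>\<^bsub>M\<^esub> (t \<odot>\<^bsub>M\<^esub> (t' \<odot>\<^bsub>M\<^esub> (u \<odot>\<^bsub>M\<^esub> (s \<odot>\<^bsub>M\<^esub> x'))))"
        using x y u(1-3) v(1-3) by (simp add: smult_assoc1[symmetric] R.m_ac)
      also have "\<dots> = v \<odot>\<^bsub>M\<^esub> (t \<odot>\<^bsub>M\<^esub> (t' \<odot>\<^bsub>M\<^esub> (u \<odot>\<^bsub>M\<^esub> (s' \<odot>\<^bsub>M\<^esub> x))))"
        using u by simp
      also have "\<dots> = ?b"
        using x y u(1-3) v(1-3) by (simp add: smult_assoc1[symmetric] R.m_ac)
      finally show ?thesis .
    qed
    have 2: "(u \<otimes>\<^bsub>R\<^esub> v) \<odot>\<^bsub>M\<^esub> ((s \<otimes>\<^bsub>R\<^esub> t) \<odot>\<^bsub>M\<^esub> (s' \<odot>\<^bsub>M\<^esub> y')) =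
        (u \<otimes>\<^bsub>R\<^esub> v) \<odot>\<^bsub>M\<^esub> ((s' \<otimes>\<^bsub>R\<^esub> t') \<odot>\<^bsub>M\<^esub> (s \<odot>\<^bsub>M\<^esub> y))" (is "?a = ?b")
    proof -
      have "?a = u \<odot>\<^bsub>M\<^esub> (s \<odot>\<^bsub>M\<^esub> (s' \<odot>\<^bsub>M\<^esub> (v \<odot>\<^bsub>M\<^esub> (t \<odot>\<^bsub>M\<^esub> y'))))"
        using x y u(1-3) v(1-3) by (simp add: smult_assoc1[symmetric] R.m_ac)
      also have "\<dots> = u \<odot>\<^bsub>M\<^esub> (s \<odot>\<^bsub>M\<^esub> (s' \<odot>\<^bsub>M\<^esub> (v \<odot>\<^bsub>M\<^esub> (t' \<odot>\<^bsub>M\<^esub> y))))"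
        using v by simp
      also have "\<dots> = ?b"
        using x y u(1-3) v(1-3) by (simp add: smult_assoc1[symmetric] R.m_ac)
      finally show ?thesis .
    qed
    show ?thesis
      by (rule fraction_eqI[where u = "u \<otimes>\<^bsub>R\<^esub> v"])
        (use x y u(1-3) v(1-3) 1 2 in \<open>simp_all add: smult_r_distr S_mult\<close>)
  qed
  show ?thesis
    by (rule UN_pairs_constant[OF fraction_self[OF x] fraction_self[OF y] *])
qed

lemma fraction_smult:
  assumes x: "a \<in> carrier R" "s \<in> S" and y: "y \<in> carrier M" "t \<in> S"
  shows "(\<Union>(a', s')\<in>fraction S (module_via id R) a s. \<Union>(y', t')\<in>fraction S M y t.
      fraction S M (a' \<odot>\<^bsub>M\<^esub> y') (s' \<otimes>\<^bsub>R\<^esub> t')) =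
    fraction S M (a \<odot>\<^bsub>M\<^esub> y) (s \<otimes>\<^bsub>R\<^esub> t)" (is "?L = ?Rh")
proof -
  have *: "fraction S M (a' \<odot>\<^bsub>M\<^esub> y') (s' \<otimes>\<^bsub>R\<^esub> t') = ?Rh"
    if h: "(a', s') \<in> fraction S (module_via id R) a s" "(y', t') \<in> fraction S M y t" for a' s' y' t'
  proof -
    obtain u where u: "a' \<in> carrier R" "s' \<in> S" "u \<in> S"
      "u \<otimes>\<^bsub>R\<^esub> (s' \<otimes>\<^bsub>R\<^esub> a) = u \<otimes>\<^bsub>R\<^esub> (s \<otimes>\<^bsub>R\<^esub> a')"
      using h(1) by (auto simp: fraction_def)
    obtain v where v: "y' \<in> carrier M" "t' \<in> S" "v \<in> S"
      "v \<odot>\<^bsub>M\<^esub> (t' \<odot>\<^bsub>M\<^esub> y) = v \<odot>\<^bsub>M\<^esub> (t \<odot>\<^bsub>M\<^esub> y')"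
      using mem_fraction[OF y h(2)] .
    have "(u \<otimes>\<^bsub>R\<^esub> v) \<odot>\<^bsub>M\<^esub> ((s \<otimes>\<^bsub>R\<^esub> t) \<odot>\<^bsub>M\<^esub> (a' \<odot>\<^bsub>M\<^esub> y')) =
        (u \<otimes>\<^bsub>R\<^esub> (s \<otimes>\<^bsub>R\<^esub> a')) \<odot>\<^bsub>M\<^esub> (v \<odot>\<^bsub>M\<^esub> (t \<odot>\<^bsub>M\<^esub> y'))"
      using x y u(1-3) v(1-3) by (simp add: smult_assoc1[symmetric] R.m_ac)
    also have "\<dots> = (u \<otimes>\<^bsub>R\<^esub> (s' \<otimes>\<^bsub>R\<^esub> a)) \<odot>\<^bsub>M\<^esub> (v \<odot>\<^bsub>M\<^esub> (t' \<odot>\<^bsub>M\<^esub> y))"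
      using u v by simp
    also have "\<dots> = (u \<otimes>\<^bsub>R\<^esub> v) \<odot>\<^bsub>M\<^esub> ((s' \<otimes>\<^bsub>R\<^esub> t') \<odot>\<^bsub>M\<^esub> (a \<odot>\<^bsub>M\<^esub> y))"
      using x y u(1-3) v(1-3) by (simp add: smult_assoc1[symmetric] R.m_ac)
    finally show ?thesis
      using x y u(1-3) v(1-3)
      by (intro fraction_eqI[where u = "u \<otimes>\<^bsub>R\<^esub> v"]) (simp_all add: S_mult)
  qed
  have self: "(a, s) \<in> fraction S (module_via id R) a s"
    using x S_one by (auto simp: fraction_def)
  show ?thesis
    by (rule UN_pairs_constant[OF self fraction_self[OF y] *])
qed

lemma localization_module_simps:
  "carrier (localization_module R S M) = {fraction S M x s | x s. x \<in> carrier M \<and> s \<in> S}"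
  "\<zero>\<^bsub>localization_module R S M\<^esub> = fraction S M \<zero>\<^bsub>M\<^esub> \<one>\<^bsub>R\<^esub>"
  "x \<in> carrier M \<Longrightarrow> s \<in> S \<Longrightarrow> y \<in> carrier M \<Longrightarrow> t \<in> S \<Longrightarrow>
    fraction S M x s \<oplus>\<^bsub>localization_module R S M\<^esub> fraction S M y t =
      fraction S M (t \<odot>\<^bsub>M\<^esub> x \<oplus>\<^bsub>M\<^esub> s \<odot>\<^bsub>M\<^esub> y) (s \<otimes>\<^bsub>R\<^esub> t)"
  "a \<in> carrier R \<Longrightarrow> s \<in> S \<Longrightarrow> y \<in> carrier M \<Longrightarrow> t \<in> S \<Longrightarrow>
    fraction S (module_via id R) a s \<odot>\<^bsub>localization_module R S M\<^esub> fraction S M y t =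
      fraction S M (a \<odot>\<^bsub>M\<^esub> y) (s \<otimes>\<^bsub>R\<^esub> t)"
  by (simp_all add: localization_module_def Let_def fraction_add fraction_smult)

lemma abelian_group_localization: "abelian_group (localization_module R S M)"
proof (rule abelian_groupI, goal_cases)
  case (1 x y)
  then show ?case by (auto simp: localization_module_simps) (blast intro: S_mult S_carrier smult_closed M.a_closed)
next
  case 2
  then show ?case using S_one by (auto simp: localization_module_simps)
next
  case (3 x y z)
  then show ?case
    by (auto simp: localization_module_simps S_mult smult_r_distr M.a_assoc smult_assoc1[symmetric] R.m_ac)
next
  case (4 x y)
  then show ?case
    by (auto simp: localization_module_simps R.m_comm M.a_comm)
next
  case (5 x)
  then show ?case using S_one
    by (auto simp: localization_module_simps)
next
  case (6 x)
  then obtain m s where x: "x = fraction S M m s" "m \<in> carrier M" "s \<in> S"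
    by (auto simp: localization_module_simps)
  have "fraction S M (\<ominus>\<^bsub>M\<^esub> m) s \<oplus>\<^bsub>localization_module R S M\<^esub> x = fraction S M \<zero>\<^bsub>M\<^esub> (s \<otimes>\<^bsub>R\<^esub> s)"
    using x by (simp add: localization_module_simps smult_r_distr[symmetric] M.l_neg)
  also have "\<dots> = fraction S M \<zero>\<^bsub>M\<^esub> \<one>\<^bsub>R\<^esub>"
    using x S_one by (intro fraction_eqI[where u = "\<one>\<^bsub>R\<^esub>"]) (auto intro: S_mult)
  finally show ?case using x
    by (intro bexI[of _ "fraction S M (\<ominus>\<^bsub>M\<^esub> m) s"]) (auto simp: localization_module_simps)
qed

end

lemma localization_data_ring:
  assumes "cring R" "S \<subseteq> carrier R" "\<one>\<^bsub>R\<^esub> \<in> S" "\<And>s t. s \<in> S \<Longrightarrow> t \<in> S \<Longrightarrow> s \<otimes>\<^bsub>R\<^esub> t \<in> S"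
  shows "localization_data R (module_via id R) S"
proof -
  have "id \<in> ring_hom R R" by (auto simp: ring_hom_def)
  then show ?thesis
    using assms module_module_via[of R R id]
    by (simp add: localization_data_def localization_data_axioms_def)
qed

context localization_data
begin

lemma ring_data: "localization_data R (module_via id R) S"
  using localization_data_ring[OF R.is_cring S_sub S_one S_mult] .

lemma localization_ring_simps:
  "carrier (localization_ring R S) = {fraction S (module_via id R) a s | a s. a \<in> carrier R \<and> s \<in> S}"
  "\<zero>\<^bsub>localization_ring R S\<^esub> = fraction S (module_via id R) \<zero>\<^bsub>R\<^esub> \<one>\<^bsub>R\<^esub>"
  "\<one>\<^bsub>localization_ring R S\<^esub> = fraction S (module_via id R) \<one>\<^bsub>R\<^esub> \<one>\<^bsub>R\<^esub>"
  "a \<in> carrier R \<Longrightarrow> s \<in> S \<Longrightarrow> b \<in> carrier R \<Longrightarrow> t \<in> S \<Longrightarrow>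
    fraction S (module_via id R) a s \<oplus>\<^bsub>localization_ring R S\<^esub> fraction S (module_via id R) b t =
      fraction S (module_via id R) (t \<otimes>\<^bsub>R\<^esub> a \<oplus>\<^bsub>R\<^esub> s \<otimes>\<^bsub>R\<^esub> b) (s \<otimes>\<^bsub>R\<^esub> t)"
  "a \<in> carrier R \<Longrightarrow> s \<in> S \<Longrightarrow> b \<in> carrier R \<Longrightarrow> t \<in> S \<Longrightarrow>
    fraction S (module_via id R) a s \<otimes>\<^bsub>localization_ring R S\<^esub> fraction S (module_via id R) b t =
      fraction S (module_via id R) (a \<otimes>\<^bsub>R\<^esub> b) (s \<otimes>\<^bsub>R\<^esub> t)"
proof -
  assume h: "a \<in> carrier R" "s \<in> S" "b \<in> carrier R" "t \<in> S"
  then have h': "a \<in> carrier (module_via id R)" "b \<in> carrier (module_via id R)" by simp_all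
  show "fraction S (module_via id R) a s \<oplus>\<^bsub>localization_ring R S\<^esub> fraction S (module_via id R) b t =
      fraction S (module_via id R) (t \<otimes>\<^bsub>R\<^esub> a \<oplus>\<^bsub>R\<^esub> s \<otimes>\<^bsub>R\<^esub> b) (s \<otimes>\<^bsub>R\<^esub> t)"
    using localization_data.fraction_add[OF ring_data h'(1) h(2) h'(2) h(4)]
    unfolding localization_ring_def Let_def module_via_simps id_apply ring.simps .
  show "fraction S (module_via id R) a s \<otimes>\<^bsub>localization_ring R S\<^esub> fraction S (module_via id R) b t =
      fraction S (module_via id R) (a \<otimes>\<^bsub>R\<^esub> b) (s \<otimes>\<^bsub>R\<^esub> t)"
    using localization_data.fraction_smult[OF ring_data h(1,2) h'(2) h(4)]
    unfolding localization_ring_def Let_def module_via_simps id_apply monoid.simps .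
qed (simp_all add: localization_ring_def Let_def)

lemma cring_localization_ring: "cring (localization_ring R S)"
proof -
  interpret L: localization_data R "module_via id R" S by (rule ring_data)
  have "abelian_group (localization_module R S (module_via id R))"
    by (rule L.abelian_group_localization)
  then have ab: "abelian_group (localization_ring R S)"
    by (rule abelian_group_cong)
      (simp_all add: localization_module_def localization_ring_def Let_def)
  have cm: "comm_monoid (localization_ring R S)"
  proof (rule comm_monoidI, goal_cases)
    case (1 x y)
    then show ?case by (auto simp: localization_ring_simps) (blast intro: S_mult R.m_closed)
  next
    case 2
    then show ?case using S_one by (auto simp: localization_ring_simps)
  next
    case (3 x y z)
    then show ?case by (auto simp: localization_ring_simps S_mult R.m_assoc)
  next
    case (4 x)
    then show ?case using S_one by (auto simp: localization_ring_simps)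
  next
    case (5 x y)
    then show ?case by (auto simp: localization_ring_simps R.m_comm)
  qed
  show ?thesis
  proof (rule cringI[OF ab cm])
    fix x y z
    assume xyz: "x \<in> carrier (localization_ring R S)" "y \<in> carrier (localization_ring R S)"
      "z \<in> carrier (localization_ring R S)"
    obtain a s where x: "x = fraction S (module_via id R) a s" "a \<in> carrier R" "s \<in> S"
      using xyz by (auto simp: localization_ring_simps)
    obtain b t where y: "y = fraction S (module_via id R) b t" "b \<in> carrier R" "t \<in> S"
      using xyz by (auto simp: localization_ring_simps)
    obtain c u where z: "z = fraction S (module_via id R) c u" "c \<in> carrier R" "u \<in> S"
      using xyz by (auto simp: localization_ring_simps)
    have "fraction S (module_via id R) ((t \<otimes>\<^bsub>R\<^esub> a \<oplus>\<^bsub>R\<^esub> s \<otimes>\<^bsub>R\<^esub> b) \<otimes>\<^bsub>R\<^esub> c) (s \<otimes>\<^bsub>R\<^esub> t \<otimes>\<^bsub>R\<^esub> u) =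
      fraction S (module_via id R) (t \<otimes>\<^bsub>R\<^esub> u \<otimes>\<^bsub>R\<^esub> (a \<otimes>\<^bsub>R\<^esub> c) \<oplus>\<^bsub>R\<^esub> s \<otimes>\<^bsub>R\<^esub> u \<otimes>\<^bsub>R\<^esub> (b \<otimes>\<^bsub>R\<^esub> c))
        (s \<otimes>\<^bsub>R\<^esub> u \<otimes>\<^bsub>R\<^esub> (t \<otimes>\<^bsub>R\<^esub> u))"
      using x y z S_one
      by (intro L.fraction_eqI[where u = "\<one>\<^bsub>R\<^esub>"])
        (auto intro!: S_mult simp: R.l_distr R.r_distr R.m_ac)
    then show "(x \<oplus>\<^bsub>localization_ring R S\<^esub> y) \<otimes>\<^bsub>localization_ring R S\<^esub> z =
        x \<otimes>\<^bsub>localization_ring R S\<^esub> z \<oplus>\<^bsub>localization_ring R S\<^esub> y \<otimes>\<^bsub>localization_ring R S\<^esub> z"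
      using x y z by (simp add: localization_ring_simps S_mult)
  qed
qed

lemma module_localization_module: "module (localization_ring R S) (localization_module R S M)"
proof (rule moduleI[OF cring_localization_ring abelian_group_localization], goal_cases)
  case (1 a x)
  then show ?case
    by (auto simp: localization_ring_simps localization_module_simps) (blast intro: S_mult smult_closed)
next
  case (2 U V W)
  obtain a s where x: "U = fraction S (module_via id R) a s" "a \<in> carrier R" "s \<in> S"
    using 2 by (auto simp: localization_ring_simps)
  obtain b t where y: "V = fraction S (module_via id R) b t" "b \<in> carrier R" "t \<in> S"
    using 2 by (auto simp: localization_ring_simps)
  obtain m u where z: "W = fraction S M m u" "m \<in> carrier M" "u \<in> S"
    using 2 by (auto simp: localization_module_simps)
  have "fraction S M ((t \<otimes>\<^bsub>R\<^esub> a \<oplus>\<^bsub>R\<^esub> s \<otimes>\<^bsub>R\<^esub> b) \<odot>\<^bsub>M\<^esub> m) (s \<otimes>\<^bsub>R\<^esub> t \<otimes>\<^bsub>R\<^esub> u) =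
    fraction S M ((t \<otimes>\<^bsub>R\<^esub> u) \<odot>\<^bsub>M\<^esub> (a \<odot>\<^bsub>M\<^esub> m) \<oplus>\<^bsub>M\<^esub> (s \<otimes>\<^bsub>R\<^esub> u) \<odot>\<^bsub>M\<^esub> (b \<odot>\<^bsub>M\<^esub> m))
      (s \<otimes>\<^bsub>R\<^esub> u \<otimes>\<^bsub>R\<^esub> (t \<otimes>\<^bsub>R\<^esub> u))"
    using x y z S_one
    by (intro fraction_eqI[where u = "\<one>\<^bsub>R\<^esub>"])
      (auto intro!: S_mult simp: smult_l_distr smult_r_distr smult_assoc1[symmetric] R.m_ac)
  then show ?case
    using x y z by (simp add: localization_ring_simps localization_module_simps S_mult)
next
  case (3 U V W)
  obtain a s where x: "U = fraction S (module_via id R) a s" "a \<in> carrier R" "s \<in> S"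
    using 3 by (auto simp: localization_ring_simps)
  obtain b t where y: "V = fraction S M b t" "b \<in> carrier M" "t \<in> S"
    using 3 by (auto simp: localization_module_simps)
  obtain m u where z: "W = fraction S M m u" "m \<in> carrier M" "u \<in> S"
    using 3 by (auto simp: localization_module_simps)
  have "fraction S M (a \<odot>\<^bsub>M\<^esub> (u \<odot>\<^bsub>M\<^esub> b \<oplus>\<^bsub>M\<^esub> t \<odot>\<^bsub>M\<^esub> m)) (s \<otimes>\<^bsub>R\<^esub> (t \<otimes>\<^bsub>R\<^esub> u)) =
    fraction S M ((s \<otimes>\<^bsub>R\<^esub> u) \<odot>\<^bsub>M\<^esub> (a \<odot>\<^bsub>M\<^esub> b) \<oplus>\<^bsub>M\<^esub> (s \<otimes>\<^bsub>R\<^esub> t) \<odot>\<^bsub>M\<^esub> (a \<odot>\<^bsub>M\<^esub> m))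
      (s \<otimes>\<^bsub>R\<^esub> t \<otimes>\<^bsub>R\<^esub> (s \<otimes>\<^bsub>R\<^esub> u))"
    using x y z S_one
    by (intro fraction_eqI[where u = "\<one>\<^bsub>R\<^esub>"])
      (auto intro!: S_mult simp: smult_l_distr smult_r_distr smult_assoc1[symmetric] R.m_ac)
  then show ?case
    using x y z by (simp add: localization_ring_simps localization_module_simps S_mult)
next
  case (4 a b x)
  then show ?case
    by (auto simp: localization_ring_simps localization_module_simps S_mult smult_assoc1 R.m_assoc)
next
  case (5 x)
  then show ?case using S_one
    by (auto simp: localization_ring_simps localization_module_simps)
qed

end

lemma localization_data_prime:
  assumes "module R M" "primeideal p R"
  shows "localization_data R M (carrier R - p)"
proof -
  interpret module R M by fact
  interpret p: primeideal p R by fact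
  have "\<one>\<^bsub>R\<^esub> \<notin> p" using p.I_notcarr p.one_imp_carrier by blast
  then show ?thesis
    using p.I_prime by unfold_locales auto
qed


section \<open>Adequacy of the carrier types\<close>

text \<open>
  A quantifier over all finitely generated \<open>R\<close>-modules, or over all finite extensions of \<open>A\<close>, may
  be restricted up to isomorphism to those carried by \<open>'r list set\<close>, or \<open>'a list set\<close>: an element
  is represented by the set of its coefficient lists with respect to a finite generating family.
\<close>

lemma module_transport:
  fixes g :: "'m \<Rightarrow> 'n"
  assumes "module R M" "inj_on g (carrier M)"
  shows "\<exists>N :: ('r, 'n) module. module R N \<and> g \<in> module_hom R M N \<and>
    bij_betw g (carrier M) (carrier N)"
proof -
  interpret module R M by fact
  define h where "h = inv_into (carrier M) g"
  have hg [simp]: "h (g x) = x" if "x \<in> carrier M" for x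
    using that assms by (simp add: h_def)
  define N :: "('r, 'n) module" where "N =
    \<lparr>carrier = g ` carrier M, monoid.mult = undefined, monoid.one = undefined, ring.zero = g \<zero>\<^bsub>M\<^esub>,
     ring.add = (\<lambda>x y. g (h x \<oplus>\<^bsub>M\<^esub> h y)), smult = (\<lambda>a x. g (a \<odot>\<^bsub>M\<^esub> h x))\<rparr>"
  have "module R N"
  proof (rule moduleI[OF R.is_cring])
    show "abelian_group N"
    proof (rule abelian_groupI, goal_cases)
      case (6 x)
      then obtain m where "m \<in> carrier M" "x = g m" by (auto simp: N_def)
      then show ?case
        by (intro bexI[of _ "g (\<ominus>\<^bsub>M\<^esub> m)"]) (auto simp: N_def M.l_neg)
    qed (auto simp: N_def M.a_ac)
  qed (auto simp: N_def smult_l_distr smult_r_distr smult_assoc1)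
  moreover have "g \<in> module_hom R M N"
    by (auto simp: module_hom_def N_def)
  moreover have "bij_betw g (carrier M) (carrier N)"
    using assms by (auto simp: bij_betw_def N_def)
  ultimately show ?thesis by blast
qed

lemma finitely_generated_inj:
  fixes M :: "('r, 'm, 'x) module_scheme"
  assumes "module R M" "finitely_generated R M"
  shows "\<exists>g :: 'm \<Rightarrow> 'r list set. inj_on g (carrier M)"
proof -
  interpret module R M by fact
  obtain G where G: "finite G" "G \<subseteq> carrier M"
    "carrier M = {(\<Oplus>\<^bsub>M\<^esub>x\<in>G. c x \<odot>\<^bsub>M\<^esub> x) | c. c \<in> G \<rightarrow> carrier R}"
    using assms(2) by (auto simp: finitely_generated_def)
  obtain xs where xs: "set xs = G"
    using G(1) finite_list by blast
  define g where
    "g m = {map c xs | c. c \<in> G \<rightarrow> carrier R \<and> m = (\<Oplus>\<^bsub>M\<^esub>x\<in>G. c x \<odot>\<^bsub>M\<^esub> x)}" for m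
  have "inj_on g (carrier M)"
  proof (rule inj_onI)
    fix m n assume mn: "m \<in> carrier M" "n \<in> carrier M" "g m = g n"
    obtain c where c: "c \<in> G \<rightarrow> carrier R" "m = (\<Oplus>\<^bsub>M\<^esub>x\<in>G. c x \<odot>\<^bsub>M\<^esub> x)"
      using mn G(3) by auto
    then have "map c xs \<in> g m" by (auto simp: g_def)
    then have "map c xs \<in> g n" using mn(3) by simp
    then obtain c' where c': "c' \<in> G \<rightarrow> carrier R" "map c xs = map c' xs"
      "n = (\<Oplus>\<^bsub>M\<^esub>x\<in>G. c' x \<odot>\<^bsub>M\<^esub> x)"
      by (auto simp: g_def)
    have "(\<Oplus>\<^bsub>M\<^esub>x\<in>G. c x \<odot>\<^bsub>M\<^esub> x) = (\<Oplus>\<^bsub>M\<^esub>x\<in>G. c' x \<odot>\<^bsub>M\<^esub> x)"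
      using c' xs G(2) by (intro M.finsum_cong') auto
    then show "m = n" using c(2) c'(3) by simp
  qed
  then show ?thesis by blast
qed

theorem finitely_generated_universe:
  fixes M :: "('r, 'm, 'x) module_scheme"
  assumes "module R M" "finitely_generated R M"
  shows "\<exists>N :: ('r, 'r list set) module. module R N \<and> module_isomorphic R M N"
  using finitely_generated_inj[OF assms] module_transport[OF assms(1)]
  unfolding module_isomorphic_def by blast

lemma module_hom_finsum:
  assumes "module R M" "module R N" "f \<in> module_hom R M N" "finite G" "h \<in> G \<rightarrow> carrier M"
  shows "f (\<Oplus>\<^bsub>M\<^esub>x\<in>G. h x) = (\<Oplus>\<^bsub>N\<^esub>x\<in>G. f (h x))"
proof -
  interpret M: module R M by fact
  interpret N: module R N by fact
  have f: "\<And>x. x \<in> carrier M \<Longrightarrow> f x \<in> carrier N"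
    "\<And>x y. x \<in> carrier M \<Longrightarrow> y \<in> carrier M \<Longrightarrow> f (x \<oplus>\<^bsub>M\<^esub> y) = f x \<oplus>\<^bsub>N\<^esub> f y"
    "\<And>a x. a \<in> carrier R \<Longrightarrow> x \<in> carrier M \<Longrightarrow> f (a \<odot>\<^bsub>M\<^esub> x) = a \<odot>\<^bsub>N\<^esub> f x"
    using assms(3) by (auto simp: module_hom_def)
  have z: "f \<zero>\<^bsub>M\<^esub> = \<zero>\<^bsub>N\<^esub>"
    by (metis M.M.zero_closed M.R.zero_closed M.smult_l_null N.smult_l_null f(1) f(3))
  show ?thesis
    using assms(4,5)
  proof (induction G)
    case empty
    then show ?case by (simp add: z)
  next
    case (insert x G)
    then have "h \<in> G \<rightarrow> carrier M" "h x \<in> carrier M" by auto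
    then show ?case using insert M.R.zero_closed
      by (subst M.M.finsum_insert N.M.finsum_insert; (auto simp: f Pi_iff)?)+
  qed
qed

lemma finitely_generated_image:
  assumes "module R M" "module R N" "f \<in> module_hom R M N" "f ` carrier M = carrier N"
    and "inj_on f (carrier M)" "finitely_generated R M"
  shows "finitely_generated R N"
proof -
  interpret M: module R M by fact
  interpret N: module R N by fact
  obtain G where G: "finite G" "G \<subseteq> carrier M"
    "carrier M = {(\<Oplus>\<^bsub>M\<^esub>x\<in>G. c x \<odot>\<^bsub>M\<^esub> x) | c. c \<in> G \<rightarrow> carrier R}"
    using assms(6) by (auto simp: finitely_generated_def)
  have inj: "inj_on f G" using assms(5) G(2) inj_on_subset by blast
  have f: "\<And>x. x \<in> carrier M \<Longrightarrow> f x \<in> carrier N"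
    "\<And>a x. a \<in> carrier R \<Longrightarrow> x \<in> carrier M \<Longrightarrow> f (a \<odot>\<^bsub>M\<^esub> x) = a \<odot>\<^bsub>N\<^esub> f x"
    using assms(3) by (auto simp: module_hom_def)
  have "y \<in> {(\<Oplus>\<^bsub>N\<^esub>x\<in>f ` G. c x \<odot>\<^bsub>N\<^esub> x) | c. c \<in> f ` G \<rightarrow> carrier R}"
    if y: "y \<in> carrier N" for y
  proof -
    obtain m where m: "m \<in> carrier M" "y = f m" using y assms(4) by blast
    obtain c where "c \<in> G \<rightarrow> carrier R" "m = (\<Oplus>\<^bsub>M\<^esub>x\<in>G. c x \<odot>\<^bsub>M\<^esub> x)"
      using m(1) G(3) by blast
    with m have c: "c \<in> G \<rightarrow> carrier R" "y = f (\<Oplus>\<^bsub>M\<^esub>x\<in>G. c x \<odot>\<^bsub>M\<^esub> x)"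
      by auto
    let ?c = "\<lambda>y. c (inv_into G f y)"
    have "y = (\<Oplus>\<^bsub>N\<^esub>x\<in>G. f (c x \<odot>\<^bsub>M\<^esub> x))"
      unfolding c(2) using c(1) G(1,2) by (intro module_hom_finsum[OF assms(1-3)]) auto
    also have "\<dots> = (\<Oplus>\<^bsub>N\<^esub>x\<in>G. ?c (f x) \<odot>\<^bsub>N\<^esub> f x)"
      using c(1) G(2) inj by (intro N.M.finsum_cong') (auto simp: f Pi_iff subset_iff)
    also have "\<dots> = (\<Oplus>\<^bsub>N\<^esub>z\<in>f ` G. ?c z \<odot>\<^bsub>N\<^esub> z)"
      using c(1) G(2) inj by (intro N.M.finsum_reindex[symmetric]) (auto simp: f Pi_iff subset_iff)
    finally show ?thesis
      using c(1) inj by (intro CollectI exI[of _ ?c]) auto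
  qed
  moreover have "(\<Oplus>\<^bsub>N\<^esub>x\<in>f ` G. c x \<odot>\<^bsub>N\<^esub> x) \<in> carrier N" if "c \<in> f ` G \<rightarrow> carrier R" for c
    using that G(2) by (intro N.M.finsum_closed) (auto simp: f Pi_iff subset_iff)
  ultimately have "carrier N = {(\<Oplus>\<^bsub>N\<^esub>x\<in>f ` G. c x \<odot>\<^bsub>N\<^esub> x) | c. c \<in> f ` G \<rightarrow> carrier R}"
    by blast
  moreover have "f ` G \<subseteq> carrier N" using assms(4) G(2) by blast
  ultimately show ?thesis
    unfolding finitely_generated_def using G(1) by blast
qed

theorem finite_extension_universe:
  fixes R :: "('r, 'l) ring_scheme" and \<phi> :: "'a \<Rightarrow> 'r"
  assumes "cring A" "finite_extension A R \<phi>"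
  shows "\<exists>(R' :: 'a list set ring) g. g \<in> ring_iso R R' \<and> finite_extension A R' (g \<circ> \<phi>)"
proof -
  have R: "cring R" "\<phi> \<in> ring_hom A R" "inj_on \<phi> (carrier A)" "finitely_generated A (module_via \<phi> R)"
    using assms(2) by (auto simp: finite_extension_def)
  interpret R: cring R by fact
  have mR: "module A (module_via \<phi> R)" by (rule module_module_via) fact+
  obtain g :: "'r \<Rightarrow> 'a list set" where g: "inj_on g (carrier R)"
    using finitely_generated_inj[OF mR R(4)] by auto
  define R' where "R' = ring.truncate (image_ring g R)"
  have iso0: "g \<in> ring_iso R (image_ring g R)"
    by (rule inj_imp_image_ring_iso[OF g])
  have iso: "g \<in> ring_iso R R'"
    using iso0 by (auto simp: R'_def ring.defs ring_iso_def ring_hom_def)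
  have cR': "cring R'"
    using R.ring_iso_imp_img_cring[OF iso] iso
    by (auto simp: R'_def image_ring_def ring.defs monoid.defs ring_iso_def ring_hom_def)
  have hom: "g \<circ> \<phi> \<in> ring_hom A R'"
    using R(2) iso by (auto simp: ring_iso_def ring_hom_def Pi_iff)
  have bij: "bij_betw g (carrier R) (carrier R')" using iso by (simp add: ring_iso_def)
  have mR': "module A (module_via (g \<circ> \<phi>) R')" by (rule module_module_via) fact+
  have "finitely_generated A (module_via (g \<circ> \<phi>) R')"
  proof (rule finitely_generated_image[OF mR mR' _ _ _ R(4)])
    show "g \<in> module_hom A (module_via \<phi> R) (module_via (g \<circ> \<phi>) R')"
      using iso R(2) by (auto simp: module_hom_def ring_iso_def ring_hom_def Pi_iff)
  qed (use bij in \<open>auto simp: bij_betw_def\<close>)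
  moreover have "inj_on (g \<circ> \<phi>) (carrier A)"
    using R(2,3) g by (intro comp_inj_on) (auto simp: ring_hom_def intro: inj_on_subset)
  ultimately show ?thesis
    using iso cR' hom unfolding finite_extension_def by blast
qed

end

theory Submission
  imports Defs
begin

text \<open>
  Bass cancellation peels off free summands until \<open>P \<oplus> A \<cong> Q \<oplus> A\<close>, so it suffices to move a
  unimodular vector \<open>(p, a)\<close> of \<open>P \<oplus> A\<close> to \<open>(0, 1)\<close>. Choose \<open>s\<close> outside all minimal primes and maps
  \<open>\<Phi> : A\<^sup>d \<rightarrow> P\<close>, \<open>\<Psi> : P \<rightarrow> A\<^sup>d\<close> with \<open>\<Phi>\<Psi> = s\<close> and \<open>\<Psi>\<Phi> = s\<close>. Since \<open>dim A/s < d\<close>, transvections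
  make \<open>(p, a)\<close> congruent to \<open>(0, 1)\<close> modulo \<open>s\<^sup>2\<close>, so it is the image under \<open>\<Phi> \<oplus> 1\<close> of a vector
  \<open>e + s \<rho>\<close> of \<open>A\<^sup>d\<^sup>+\<^sup>1\<close>. The vector \<open>e + \<rho> X\<close> is unimodular over the finite extension
  \<open>A[X]/(X\<^sup>2 - s X)\<close>, hence the image of \<open>e\<close> under an automorphism, because the free module of rank \<open>d\<close>
  is cancellative there. Comparing the specialisations \<open>X = 0\<close> and \<open>X = s\<close> gives an automorphism
  \<open>1 + s M\<close> of \<open>A\<^sup>d\<^sup>+\<^sup>1\<close> taking \<open>e + s \<rho>\<close> to \<open>e\<close>. It induces the automorphism
  \<open>1 + (\<Phi> \<oplus> 1) M (\<Psi> \<oplus> s)\<close> of \<open>P \<oplus> A\<close>, which takes \<open>(p, a)\<close> to \<open>(0, 1)\<close>.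
\<close>

section \<open>Primes in Noetherian rings\<close>

text \<open>In rank above the dimension, transvections alone move every unimodular vector to (0, 1).
  In rank d they achieve this only modulo an element whose quotient has smaller dimension, and the
  hypothesis on extensions serves to remove that congruence. As it speaks of free modules only, P
  has to be compared with A^d through \<Phi> and \<Psi>.

  The obstacle is that \<open>s\<close> may be a zero divisor although it avoids all minimal primes,
  because of embedded primes; so nothing may be divided by \<open>s\<close>. This dictates the form
  of the argument. The ring A[X]/(X^2 - s X) is free on 1 and X whatever \<open>s\<close> is, and a
  matrix over it is a pair U + W X with specialisations U and U + s W. The matrix M is read off from
  such coefficients, and each identity required of M is the X coefficient of an identity over the
  extension rather than a consequence of cancelling \<open>s\<close>. For the same reason P is
  compared with A^d by a pair of maps whose composites are \<open>s\<close>, not by an isomorphism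
  over a ring of fractions.\<close>

locale noetherian_cring = cring A + noetherian_ring A for A (structure)
begin

text \<open>Zorn's lemma on the ideals where \<open>Pr\<close> fails: in a Noetherian ring the union
  of a nonempty chain of ideals is a member of the chain, so a failing ideal would yield a maximal
  one, which \<open>step\<close> refutes.\<close>

lemma ideal_noetherian_induct [consumes 1, case_names step]:
  assumes "ideal I A"
    and step: "\<And>I. ideal I A \<Longrightarrow> (\<And>J. ideal J A \<Longrightarrow> I \<subset> J \<Longrightarrow> Pr J) \<Longrightarrow> Pr I"
  shows "Pr I"
proof (rule ccontr)
  assume n: "\<not> Pr I"
  let ?F = "{J. ideal J A \<and> \<not> Pr J}"
  have "\<exists>M\<in>?F. \<forall>F\<in>?F. M \<subseteq> F \<longrightarrow> F = M"
  proof (rule subset_Zorn)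
    fix C assume C: "subset.chain ?F C"
    show "\<exists>U\<in>?F. \<forall>F\<in>C. F \<subseteq> U"
    proof (cases "C = {}")
      case True
      then show ?thesis using n assms(1) by blast
    next
      case False
      have "subset.chain {I. ideal I A} C"
        using C by (auto simp: subset.chain_def)
      then have "\<Union>C \<in> C" using ideal_chain_is_trivial False by blast
      then show ?thesis using C by (intro bexI[of _ "\<Union>C"]) (auto simp: subset.chain_def)
    qed
  qed
  then obtain M where M: "ideal M A" "\<not> Pr M" "\<And>F. ideal F A \<Longrightarrow> \<not> Pr F \<Longrightarrow> M \<subseteq> F \<Longrightarrow> F = M"
    by auto
  have "Pr M"
    by (rule step[OF M(1)]) (use M(3) in blast)
  with M(2) show False by contradiction
qed

text \<open>The witness is J + (a). Its elements are exported in split form because the Noetherian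
  inductions below enlarge \<open>J\<close> by one element and have to read off what membership
  means.\<close>

lemma ideal_adjoin:
  assumes "ideal J A" "a \<in> carrier A"
  obtains J' where "ideal J' A" "J \<subseteq> J'" "a \<in> J'"
    "\<And>x. x \<in> J' \<Longrightarrow> \<exists>j\<in>J. \<exists>r\<in>carrier A. x = j \<oplus> r \<otimes> a"
proof
  interpret J: ideal J A by fact
  let ?K = "J <+>\<^bsub>A\<^esub> PIdl a"
  show "ideal ?K A" using assms cgenideal_ideal add_ideals by blast
  show "J \<subseteq> ?K"
  proof
    fix x assume "x \<in> J"
    moreover have "\<zero> \<in> PIdl a" using assms(2) by (auto simp: cgenideal_def intro!: exI[of _ \<zero>])
    moreover have "x = x \<oplus> \<zero>" using J.Icarr[OF \<open>x \<in> J\<close>] by simp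
    ultimately show "x \<in> ?K" unfolding set_add_def' by blast
  qed
  show "a \<in> ?K"
  proof -
    have "a = \<zero> \<oplus> a" "\<zero> \<in> J" "a \<in> PIdl a"
      using assms(2) cgenideal_self J.zero_closed by simp_all
    then show ?thesis unfolding set_add_def' by blast
  qed
  show "\<exists>j\<in>J. \<exists>r\<in>carrier A. x = j \<oplus> r \<otimes> a" if "x \<in> ?K" for x
    using that unfolding set_add_def' cgenideal_def by auto
qed

section \<open>Primes over a given ideal\<close>

lemma primeideal_one_notin: "primeideal Q A \<Longrightarrow> \<one> \<notin> Q"
  using ideal.one_imp_carrier primeideal.I_notcarr primeideal.axioms(1) by blast

lemma primeideal_mult:
  "primeideal Q A \<Longrightarrow> a \<in> carrier A \<Longrightarrow> b \<in> carrier A \<Longrightarrow> a \<otimes> b \<in> Q \<longleftrightarrow> a \<in> Q \<or> b \<in> Q"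
  using primeideal.I_prime[of Q A a b] ideal.I_l_closed[of Q A b a] ideal.I_r_closed[of Q A a b]
    primeideal.axioms(1)[of Q A] by auto

lemma primeideal_pow:
  assumes "primeideal Q A" "a \<in> carrier A" "a [^] (n::nat) \<in> Q"
  shows "a \<in> Q"
  using assms(3)
proof (induction n)
  case 0
  then show ?case using primeideal_one_notin[OF assms(1)] by simp
next
  case (Suc n)
  then show ?case using primeideal_mult[OF assms(1) nat_pow_closed[OF assms(2)] assms(2)] assms(2) by auto
qed

lemma primeideal_add_cancel:
  assumes "primeideal Q A" "a \<in> Q" "b \<in> carrier A"
  shows "a \<oplus> b \<in> Q \<longleftrightarrow> b \<in> Q" "b \<oplus> a \<in> Q \<longleftrightarrow> b \<in> Q"
proof -
  interpret Q: primeideal Q A by fact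
  have a: "a \<in> carrier A" using assms(2) Q.a_subset by blast
  show 1: "a \<oplus> b \<in> Q \<longleftrightarrow> b \<in> Q"
  proof
    assume "a \<oplus> b \<in> Q"
    then have "\<ominus> a \<oplus> (a \<oplus> b) \<in> Q" by (rule Q.a_closed[OF Q.a_inv_closed[OF assms(2)]])
    moreover have "\<ominus> a \<oplus> (a \<oplus> b) = b" using a assms(3) by (simp add: a_assoc[symmetric] l_neg)
    ultimately show "b \<in> Q" by simp
  qed (use assms Q.a_closed in blast)
  then show "b \<oplus> a \<in> Q \<longleftrightarrow> b \<in> Q" using a assms(3) by (simp add: a_comm)
qed

lemma not_prime_ideal_split:
  assumes "ideal J A" "\<not> primeideal J A" "J \<noteq> carrier A"
  obtains a b where "a \<in> carrier A" "b \<in> carrier A" "a \<otimes> b \<in> J" "a \<notin> J" "b \<notin> J"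
  using primeidealI[OF assms(1) is_cring assms(3)[symmetric]] assms(2) that by blast

text \<open>If \<open>a \<otimes> b\<close> is in \<open>J\<close> and neither factor is, each prime
  over \<open>J\<close> contains a factor, so the families obtained for J + (a) and J + (b) together
  serve for \<open>J\<close>. Members need not be minimal here; \<open>finite_minimal_primes\<close>
  prunes them.\<close>

lemma finite_primes_cover:
  assumes "ideal J A"
  shows "\<exists>F. finite F \<and> (\<forall>Q\<in>F. primeideal Q A \<and> J \<subseteq> Q) \<and>
    (\<forall>Q. primeideal Q A \<longrightarrow> J \<subseteq> Q \<longrightarrow> (\<exists>Q'\<in>F. Q' \<subseteq> Q))"
  using assms
proof (induction rule: ideal_noetherian_induct)
  case (step J)
  interpret J: ideal J A by fact
  consider "primeideal J A" | "J = carrier A" | "\<not> primeideal J A" "J \<noteq> carrier A" by blast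
  then show ?case
  proof cases
    case 1
    then show ?thesis by (intro exI[of _ "{J}"]) auto
  next
    case 2
    then have "\<not> J \<subseteq> Q" if "primeideal Q A" for Q
      using primeideal_one_notin[OF that] by auto
    then show ?thesis by (intro exI[of _ "{}"]) auto
  next
    case 3
    obtain a b where ab: "a \<in> carrier A" "b \<in> carrier A" "a \<otimes> b \<in> J" "a \<notin> J" "b \<notin> J"
      using not_prime_ideal_split[OF step(1) 3] .
    have *: "\<exists>F. finite F \<and> (\<forall>Q\<in>F. primeideal Q A \<and> J \<subseteq> Q) \<and>
      (\<forall>Q. primeideal Q A \<longrightarrow> J \<subseteq> Q \<longrightarrow> c \<in> Q \<longrightarrow> (\<exists>Q'\<in>F. Q' \<subseteq> Q))"
      if c: "c \<in> carrier A" "c \<notin> J" for c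
    proof -
      obtain J' where J': "ideal J' A" "J \<subseteq> J'" "c \<in> J'"
        "\<And>x. x \<in> J' \<Longrightarrow> \<exists>j\<in>J. \<exists>r\<in>carrier A. x = j \<oplus> r \<otimes> c"
        using ideal_adjoin[OF step(1) c(1)] by blast
      have sub: "J' \<subseteq> Q" if Q: "primeideal Q A" "J \<subseteq> Q" "c \<in> Q" for Q
      proof
        interpret Q: primeideal Q A by fact
        fix x assume "x \<in> J'"
        then obtain j r where "j \<in> J" "r \<in> carrier A" "x = j \<oplus> r \<otimes> c" using J'(4) by blast
        then show "x \<in> Q" using Q by (auto intro!: Q.a_closed Q.I_l_closed)
      qed
      have "J \<subset> J'" using J' c by blast
      then obtain F where F: "finite F" "\<forall>Q\<in>F. primeideal Q A \<and> J' \<subseteq> Q"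
        "\<forall>Q. primeideal Q A \<longrightarrow> J' \<subseteq> Q \<longrightarrow> (\<exists>Q'\<in>F. Q' \<subseteq> Q)"
        using step(2)[OF J'(1)] by auto
      have "\<exists>Q'\<in>F. Q' \<subseteq> Q" if "primeideal Q A" "J \<subseteq> Q" "c \<in> Q" for Q
        using F(3) sub[OF that] that(1) by simp
      moreover have "\<forall>Q\<in>F. primeideal Q A \<and> J \<subseteq> Q" using F(2) J'(2) by auto
      ultimately show ?thesis using F(1) by auto
    qed
    obtain F where F: "finite F" "\<forall>Q\<in>F. primeideal Q A \<and> J \<subseteq> Q"
      "\<forall>Q. primeideal Q A \<longrightarrow> J \<subseteq> Q \<longrightarrow> a \<in> Q \<longrightarrow> (\<exists>Q'\<in>F. Q' \<subseteq> Q)" using *[OF ab(1,4)] by blast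
    obtain Y where Y: "finite Y" "\<forall>Q\<in>Y. primeideal Q A \<and> J \<subseteq> Q"
      "\<forall>Q. primeideal Q A \<longrightarrow> J \<subseteq> Q \<longrightarrow> b \<in> Q \<longrightarrow> (\<exists>Q'\<in>Y. Q' \<subseteq> Q)" using *[OF ab(2,5)] by blast
    have ab_mem: "a \<in> Q \<or> b \<in> Q" if "primeideal Q A" "J \<subseteq> Q" for Q
      using that primeideal_mult[OF _ ab(1,2)] ab(3) by blast
    have "\<exists>Q'\<in>F \<union> Y. Q' \<subseteq> Q" if "primeideal Q A" "J \<subseteq> Q" for Q
      using ab_mem[OF that] F(3)[rule_format, OF that] Y(3)[rule_format, OF that] by auto
    moreover have "finite (F \<union> Y)" "\<forall>Q\<in>F \<union> Y. primeideal Q A \<and> J \<subseteq> Q"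
      using F(1,2) Y(1,2) by auto
    ultimately show ?thesis by auto
  qed
qed

text \<open>In a finite family every member lies above a minimal one, so discarding the others keeps
  the covering property and leaves an antichain, as \<open>coset_avoidance\<close> demands. With
  \<open>S\<close> empty these are the minimal primes of the ring.\<close>

lemma finite_minimal_primes:
  assumes "S \<subseteq> carrier A"
  obtains F where "finite F" "\<And>Q. Q \<in> F \<Longrightarrow> primeideal Q A" "\<And>Q. Q \<in> F \<Longrightarrow> S \<subseteq> Q"
    "\<And>Q. primeideal Q A \<Longrightarrow> S \<subseteq> Q \<Longrightarrow> \<exists>Q'\<in>F. Q' \<subseteq> Q"
    "\<And>Q Q'. Q \<in> F \<Longrightarrow> Q' \<in> F \<Longrightarrow> Q \<subseteq> Q' \<Longrightarrow> Q = Q'"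
proof -
  obtain Y where Y: "finite Y" "\<And>Q. Q \<in> Y \<Longrightarrow> primeideal Q A" "\<And>Q. Q \<in> Y \<Longrightarrow> Idl S \<subseteq> Q"
    "\<And>Q. primeideal Q A \<Longrightarrow> Idl S \<subseteq> Q \<Longrightarrow> \<exists>Q'\<in>Y. Q' \<subseteq> Q"
    using finite_primes_cover[OF genideal_ideal[OF assms]] by blast
  let ?F = "{Q\<in>Y. \<forall>Q'\<in>Y. Q' \<subseteq> Q \<longrightarrow> Q' = Q}"
  show thesis
  proof (rule that[of ?F])
    fix Q assume Q: "primeideal Q A" "S \<subseteq> Q"
    then have "Idl S \<subseteq> Q" by (simp add: genideal_minimal primeideal.axioms(1))
    then obtain Q' where "Q' \<in> Y" "Q' \<subseteq> Q" using Y Q by blast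
    then obtain M where "M \<in> Y" "M \<subseteq> Q'" "\<forall>B\<in>Y. B \<subseteq> M \<longrightarrow> M = B"
      using finite_has_minimal2[OF Y(1)] by blast
    then show "\<exists>Q'\<in>?F. Q' \<subseteq> Q" using \<open>Q' \<subseteq> Q\<close> by blast
  next
    show "S \<subseteq> Q" if "Q \<in> ?F" for Q
      using that Y(3) genideal_self[OF assms] by blast
  qed (use Y(1,2) in auto)
qed

text \<open>When \<open>a \<otimes> b\<close> is in \<open>J\<close>, multiplying an expression of 1
  in J + (a) by one in J + (b) lands in \<open>J\<close>. The lemma turns conditions at all primes
  into an equation for 1.\<close>

lemma proper_ideal_in_prime:
  assumes "ideal J A" "\<And>Q. primeideal Q A \<Longrightarrow> \<not> J \<subseteq> Q"
  shows "\<one> \<in> J"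
  using assms
proof (induction rule: ideal_noetherian_induct)
  case (step J)
  show ?case
  proof (rule ccontr)
    assume n: "\<one> \<notin> J"
    then have "\<not> primeideal J A" "J \<noteq> carrier A" using step by auto
    then obtain a b where ab: "a \<in> carrier A" "b \<in> carrier A" "a \<otimes> b \<in> J" "a \<notin> J" "b \<notin> J"
      using not_prime_ideal_split[OF step(1)] by blast
    interpret J: ideal J A by fact
    have *: "\<exists>j\<in>J. \<exists>r\<in>carrier A. \<one> = j \<oplus> r \<otimes> c" if c: "c \<in> carrier A" "c \<notin> J" for c
    proof -
      obtain J' where J': "ideal J' A" "J \<subseteq> J'" "c \<in> J'"
        "\<And>x. x \<in> J' \<Longrightarrow> \<exists>j\<in>J. \<exists>r\<in>carrier A. x = j \<oplus> r \<otimes> c"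
        using ideal_adjoin[OF step(1) c(1)] by blast
      have "J \<subset> J'" using J' c by blast
      then have "\<one> \<in> J'" using step(2)[OF J'(1)] step(3) by blast
      then show ?thesis using J'(4) by blast
    qed
    obtain j r where 1: "j \<in> J" "r \<in> carrier A" "\<one> = j \<oplus> r \<otimes> a" using *[OF ab(1,4)] by blast
    obtain k t where 2: "k \<in> J" "t \<in> carrier A" "\<one> = k \<oplus> t \<otimes> b" using *[OF ab(2,5)] by blast
    have jk: "j \<in> carrier A" "k \<in> carrier A" using 1 2 J.a_subset by blast+
    have "\<one> \<otimes> \<one> = (j \<oplus> r \<otimes> a) \<otimes> (k \<oplus> t \<otimes> b)" by (rule arg_cong2[OF 1(3) 2(3)])
    also have "\<dots> = j \<otimes> (k \<oplus> t \<otimes> b) \<oplus> ((r \<otimes> a) \<otimes> k \<oplus> (r \<otimes> t) \<otimes> (a \<otimes> b))"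
      using 1(2) 2(2) jk ab by (simp add: l_distr r_distr m_ac a_ac)
    also have "\<dots> \<in> J"
      using 1(1,2) 2(1,2) jk ab(1-3) by (simp add: J.a_closed J.I_r_closed J.I_l_closed)
    finally show False using n by simp
  qed
qed

text \<open>The argument of \<open>proper_ideal_in_prime\<close> with powers of \<open>x\<close> in
  place of 1; the exponents of the two expressions add up.\<close>

lemma nilpotent_if_in_all_primes:
  assumes "ideal J A" "x \<in> carrier A" "\<And>Q. primeideal Q A \<Longrightarrow> J \<subseteq> Q \<Longrightarrow> x \<in> Q"
  shows "\<exists>n::nat. x [^] n \<in> J"
  using assms
proof (induction rule: ideal_noetherian_induct)
  case (step J)
  interpret J: ideal J A by fact
  consider "primeideal J A" | "J = carrier A" | "\<not> primeideal J A" "J \<noteq> carrier A" by blast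
  then show ?case
  proof cases
    case 1
    then show ?thesis using step(3,4) by (intro exI[of _ 1]) auto
  next
    case 2
    then show ?thesis using step(3) by auto
  next
    case 3
    obtain a b where ab: "a \<in> carrier A" "b \<in> carrier A" "a \<otimes> b \<in> J" "a \<notin> J" "b \<notin> J"
      using not_prime_ideal_split[OF step(1) 3] .
    have *: "\<exists>n::nat. \<exists>j\<in>J. \<exists>r\<in>carrier A. x [^] n = j \<oplus> r \<otimes> c" if c: "c \<in> carrier A" "c \<notin> J" for c
    proof -
      obtain J' where J': "ideal J' A" "J \<subseteq> J'" "c \<in> J'"
        "\<And>x. x \<in> J' \<Longrightarrow> \<exists>j\<in>J. \<exists>r\<in>carrier A. x = j \<oplus> r \<otimes> c"
        using ideal_adjoin[OF step(1) c(1)] by blast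
      have "J \<subset> J'" using J' c by blast
      then obtain n :: nat where "x [^] n \<in> J'" using step(2)[OF J'(1)] step(3,4) J'(2) by blast
      then show ?thesis using J'(4) by blast
    qed
    obtain n j r where 1: "j \<in> J" "r \<in> carrier A" "x [^] (n::nat) = j \<oplus> r \<otimes> a" using *[OF ab(1,4)] by blast
    obtain m k t where 2: "k \<in> J" "t \<in> carrier A" "x [^] (m::nat) = k \<oplus> t \<otimes> b" using *[OF ab(2,5)] by blast
    have jk: "j \<in> carrier A" "k \<in> carrier A" using 1 2 J.a_subset by blast+
    have "x [^] (n + m) = (j \<oplus> r \<otimes> a) \<otimes> (k \<oplus> t \<otimes> b)"
      using step(3) by (simp add: nat_pow_mult[symmetric] 1(3) 2(3))
    also have "\<dots> = j \<otimes> (k \<oplus> t \<otimes> b) \<oplus> ((r \<otimes> a) \<otimes> k \<oplus> (r \<otimes> t) \<otimes> (a \<otimes> b))"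
      using 1(2) 2(2) jk ab by (simp add: l_distr r_distr m_ac a_ac)
    also have "\<dots> \<in> J"
      using 1(1,2) 2(1,2) jk ab(1-3) by (simp add: J.a_closed J.I_r_closed J.I_l_closed)
    finally show ?thesis by blast
  qed
qed

text \<open>Choose in each \<open>Q'\<close> an element outside \<open>Q\<close> and multiply;
  primality of \<open>Q\<close> keeps the product outside.\<close>

lemma incomparable_prime_separation:
  assumes "finite F" "primeideal Q A" "\<And>Q'. Q' \<in> F \<Longrightarrow> ideal Q' A \<and> \<not> Q' \<subseteq> Q"
  shows "\<exists>e\<in>carrier A. e \<notin> Q \<and> (\<forall>Q'\<in>F. e \<in> Q')"
  using assms(1,3)
proof (induction F)
  case empty
  then show ?case using primeideal_one_notin[OF assms(2)] by blast
next
  case (insert Q' F)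
  then obtain e where e: "e \<in> carrier A" "e \<notin> Q" "\<forall>Q'\<in>F. e \<in> Q'" by blast
  obtain f where f: "f \<in> Q'" "f \<notin> Q" using insert.prems by blast
  have I: "ideal I A" if "I \<in> insert Q' F" for I using insert.prems that by blast
  have fA: "f \<in> carrier A" using ideal.Icarr[OF I[of Q']] f(1) by simp
  show ?case
  proof (intro bexI[of _ "e \<otimes> f"] conjI ballI)
    show "e \<otimes> f \<notin> Q" using primeideal_mult[OF assms(2) e(1) fA] e(2) f(2) by simp
    show "e \<otimes> f \<in> I" if "I \<in> insert Q' F" for I
      using that ideal.I_l_closed[OF I[OF that] _ e(1), of f] ideal.I_r_closed[OF I[OF that] _ fA, of e] e(3) f(1)
      by blast
  qed (use e fA in auto)
qed

text \<open>One prime is repaired at a time: if the present \<open>y\<close> fails at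
  \<open>Q\<close>, add an \<open>e\<close> outside \<open>Q\<close> that lies in all primes treated
  before. This changes \<open>b \<oplus> c \<otimes> y\<close> by an element outside
  \<open>Q\<close>, but by an element of each earlier prime. The antichain condition provides
  \<open>e\<close>.\<close>

lemma coset_avoidance:
  assumes "finite F" "\<And>Q. Q \<in> F \<Longrightarrow> primeideal Q A"
    and "\<And>Q Q'. Q \<in> F \<Longrightarrow> Q' \<in> F \<Longrightarrow> Q \<subseteq> Q' \<Longrightarrow> Q = Q'"
    and "b \<in> carrier A" "c \<in> carrier A"
  shows "\<exists>y\<in>carrier A. \<forall>Q\<in>F. c \<notin> Q \<longrightarrow> b \<oplus> c \<otimes> y \<notin> Q"
  using assms(1-3)
proof (induction F)
  case empty
  then show ?case by blast
next
  case (insert Q F)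
  then obtain y where y: "y \<in> carrier A" "\<forall>Q\<in>F. c \<notin> Q \<longrightarrow> b \<oplus> c \<otimes> y \<notin> Q" by auto
  have Q: "primeideal Q A" using insert.prems by blast
  show ?case
  proof (cases "c \<in> Q \<or> b \<oplus> c \<otimes> y \<notin> Q")
    case True
    then show ?thesis using y by auto
  next
    case False
    then have cy: "b \<oplus> c \<otimes> y \<in> Q" "c \<notin> Q" by auto
    have "ideal Q' A \<and> \<not> Q' \<subseteq> Q" if "Q' \<in> F" for Q'
      using insert.prems(1)[of Q'] insert.prems(2)[of Q' Q] insert.hyps that
        primeideal.axioms(1) by blast
    then obtain e where e: "e \<in> carrier A" "e \<notin> Q" "\<forall>Q'\<in>F. e \<in> Q'"
      using incomparable_prime_separation[OF insert.hyps(1) Q] by blast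
    have eq: "b \<oplus> c \<otimes> (y \<oplus> e) = (b \<oplus> c \<otimes> y) \<oplus> c \<otimes> e"
      using y e assms by (simp add: r_distr a_assoc)
    show ?thesis
    proof (intro bexI[of _ "y \<oplus> e"] ballI impI)
      fix Q' assume Q': "Q' \<in> insert Q F" "c \<notin> Q'"
      show "b \<oplus> c \<otimes> (y \<oplus> e) \<notin> Q'"
      proof (cases "Q' = Q")
        case True
        have "c \<otimes> e \<notin> Q" using primeideal_mult[OF Q assms(5) e(1)] e(2) cy(2) by blast
        then show ?thesis
          using primeideal_add_cancel(1)[OF Q, of "b \<oplus> c \<otimes> y" "c \<otimes> e"] cy e(1) assms(5)
          unfolding eq True by simp
      next
        case False
        then have "Q' \<in> F" using Q' by blast
        then have P: "primeideal Q' A" "e \<in> Q'" using insert.prems e by auto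
        then have "c \<otimes> e \<in> Q'" using primeideal_mult[OF P(1) assms(5) e(1)] by blast
        then show ?thesis
          using primeideal_add_cancel(2)[OF P(1), of "c \<otimes> e" "b \<oplus> c \<otimes> y"] y \<open>Q' \<in> F\<close> Q'(2) assms(4,5)
          unfolding eq by simp
      qed
    qed (use y e in auto)
  qed
qed

text \<open>The length \<open>n\<close> counts strict inclusions, as in \<open>krull_dim\<close>, so
  a bound on it bounds the dimension of the quotient by the ideal generated by \<open>S\<close>;
  empty \<open>S\<close> concerns the whole ring.\<close>

definition prime_chain :: "'a set \<Rightarrow> (nat \<Rightarrow> 'a set) \<Rightarrow> nat \<Rightarrow> bool"
  where "prime_chain S p n \<longleftrightarrow>
    (\<forall>i\<le>n. primeideal (p i) A \<and> S \<subseteq> p i) \<and> (\<forall>i<n. p i \<subset> p (Suc i))"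

text \<open>
  Coordinatewise avoidance of the minimal primes over the previous coordinates: each new coordinate
  \<open>b\<^sub>i + c y\<^sub>i\<close> lengthens by one the chain of primes below a prime that contains them all but not \<open>c\<close>.
\<close>

lemma stable_range_chain:
  assumes "S \<subseteq> carrier A" "c \<in> carrier A" "\<And>i. i < n \<Longrightarrow> b i \<in> carrier A"
  shows "\<exists>y. (\<forall>i<n. y i \<in> carrier A) \<and>
    (\<forall>Q. primeideal Q A \<longrightarrow> S \<subseteq> Q \<longrightarrow> c \<notin> Q \<longrightarrow> (\<forall>i<n. b i \<oplus> c \<otimes> y i \<in> Q) \<longrightarrow>
      (\<exists>p. prime_chain S p n \<and> p n = Q))"
  using assms(3)
proof (induction n)
  case 0
  have "prime_chain S (\<lambda>_. Q) 0" if "primeideal Q A" "S \<subseteq> Q" for Q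
    using that by (simp add: prime_chain_def)
  then show ?case by (intro exI[of _ b]) auto
next
  case (Suc n)
  then obtain y where y: "\<And>i. i < n \<Longrightarrow> y i \<in> carrier A"
    "\<And>Q. primeideal Q A \<Longrightarrow> S \<subseteq> Q \<Longrightarrow> c \<notin> Q \<Longrightarrow> \<forall>i<n. b i \<oplus> c \<otimes> y i \<in> Q \<Longrightarrow>
      (\<exists>p. prime_chain S p n \<and> p n = Q)"
    by auto
  let ?S = "S \<union> (\<lambda>i. b i \<oplus> c \<otimes> y i) ` {..<n}"
  have "?S \<subseteq> carrier A" using y Suc.prems assms by auto
  then obtain F where F: "finite F" "\<And>Q. Q \<in> F \<Longrightarrow> primeideal Q A" "\<And>Q. Q \<in> F \<Longrightarrow> ?S \<subseteq> Q"
    "\<And>Q. primeideal Q A \<Longrightarrow> ?S \<subseteq> Q \<Longrightarrow> \<exists>Q'\<in>F. Q' \<subseteq> Q"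
    "\<And>Q Q'. Q \<in> F \<Longrightarrow> Q' \<in> F \<Longrightarrow> Q \<subseteq> Q' \<Longrightarrow> Q = Q'"
    by (rule finite_minimal_primes) blast
  have bn: "b n \<in> carrier A" using Suc.prems by simp
  obtain z where z: "z \<in> carrier A" "\<And>Q. Q \<in> F \<Longrightarrow> c \<notin> Q \<Longrightarrow> b n \<oplus> c \<otimes> z \<notin> Q"
    using coset_avoidance[OF F(1,2,5) bn assms(2)] by blast
  show ?case
  proof (intro exI[of _ "y(n := z)"] conjI allI impI)
    show "(y(n := z)) i \<in> carrier A" if "i < Suc n" for i using that y z by (auto simp: less_Suc_eq)
  next
    fix Q assume Q: "primeideal Q A" "S \<subseteq> Q" "c \<notin> Q"
      and h: "\<forall>i<Suc n. b i \<oplus> c \<otimes> (y(n := z)) i \<in> Q"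
    have h': "b i \<oplus> c \<otimes> y i \<in> Q" if "i < n" for i using h[rule_format, of i] that by simp
    then have "?S \<subseteq> Q" using Q by auto
    then obtain Q' where Q': "Q' \<in> F" "Q' \<subseteq> Q" using F(4) Q by blast
    then have c: "c \<notin> Q'" using Q by blast
    have "Q' \<noteq> Q" using z(2)[OF Q'(1) c] h by auto
    obtain p where p: "prime_chain S p n" "p n = Q'"
      using y(2)[of Q'] F(2,3)[OF Q'(1)] c by blast
    have "prime_chain S (p(Suc n := Q)) (Suc n)"
      using p Q Q' \<open>Q' \<noteq> Q\<close> unfolding prime_chain_def by (auto simp: less_Suc_eq le_Suc_eq)
    then show "\<exists>p. prime_chain S p (Suc n) \<and> p (Suc n) = Q"
      by (intro exI[of _ "p(Suc n := Q)"]) simp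
  qed
qed

end

section \<open>Module homomorphisms and free modules\<close>

abbreviation regular_module :: "('r, 'k) ring_scheme \<Rightarrow> ('r, 'r) module"
  where "regular_module R \<equiv> module_via id R"

lemma module_regular: "cring R \<Longrightarrow> module R (regular_module R)"
  by (rule module_module_via) (auto simp: ring_hom_def)

lemma module_homI:
  assumes "\<And>x. x \<in> carrier M \<Longrightarrow> f x \<in> carrier N"
    and "\<And>x y. x \<in> carrier M \<Longrightarrow> y \<in> carrier M \<Longrightarrow> f (x \<oplus>\<^bsub>M\<^esub> y) = f x \<oplus>\<^bsub>N\<^esub> f y"
    and "\<And>a x. a \<in> carrier R \<Longrightarrow> x \<in> carrier M \<Longrightarrow> f (a \<odot>\<^bsub>M\<^esub> x) = a \<odot>\<^bsub>N\<^esub> f x"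
  shows "f \<in> module_hom R M N"
  using assms by (auto simp: module_hom_def)

lemma module_homD:
  assumes "f \<in> module_hom R M N"
  shows module_hom_closed: "x \<in> carrier M \<Longrightarrow> f x \<in> carrier N"
    and module_hom_add: "x \<in> carrier M \<Longrightarrow> y \<in> carrier M \<Longrightarrow> f (x \<oplus>\<^bsub>M\<^esub> y) = f x \<oplus>\<^bsub>N\<^esub> f y"
    and module_hom_smult: "a \<in> carrier R \<Longrightarrow> x \<in> carrier M \<Longrightarrow> f (a \<odot>\<^bsub>M\<^esub> x) = a \<odot>\<^bsub>N\<^esub> f x"
  using assms by (auto simp: module_hom_def)

lemma module_hom_zero:
  assumes "f \<in> module_hom R M N" "module R M" "module R N"
  shows "f \<zero>\<^bsub>M\<^esub> = \<zero>\<^bsub>N\<^esub>"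
proof -
  interpret M: module R M by fact
  interpret N: module R N by fact
  show ?thesis
    using module_hom_smult[OF assms(1) M.R.zero_closed M.M.zero_closed]
      module_hom_closed[OF assms(1) M.M.zero_closed] by simp
qed

lemma module_hom_comp:
  assumes "f \<in> module_hom R M N" "g \<in> module_hom R N K"
  shows "(\<lambda>x. g (f x)) \<in> module_hom R M K"
  by (rule module_homI) (simp_all add: module_homD[OF assms(1)] module_homD[OF assms(2)])

lemma module_hom_plus:
  assumes "f \<in> module_hom R M N" "g \<in> module_hom R M N" "module R N"
  shows "(\<lambda>x. f x \<oplus>\<^bsub>N\<^esub> g x) \<in> module_hom R M N"
proof -
  interpret N: module R N by fact
  show ?thesis
    using assms(1,2) by (auto simp: module_hom_def N.M.a_ac N.smult_r_distr Pi_iff)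
qed

lemma module_hom_scale:
  assumes "f \<in> module_hom R M N" "module R N" "a \<in> carrier R"
  shows "(\<lambda>x. a \<odot>\<^bsub>N\<^esub> f x) \<in> module_hom R M N"
proof -
  interpret N: module R N by fact
  show ?thesis
    using assms(1,3)
    by (auto simp: module_hom_def N.smult_r_distr N.smult_assoc1[symmetric] N.R.m_comm Pi_iff)
qed

definition module_iso ::
    "('r, 'k) ring_scheme \<Rightarrow> ('r, 'm, 'x) module_scheme \<Rightarrow> ('r, 'n, 'y) module_scheme \<Rightarrow> ('m \<Rightarrow> 'n) set"
  where "module_iso R M N = {f \<in> module_hom R M N. bij_betw f (carrier M) (carrier N)}"

lemma module_isomorphic_altdef: "module_isomorphic R M N \<longleftrightarrow> (\<exists>f. f \<in> module_iso R M N)"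
  by (auto simp: module_isomorphic_def module_iso_def)

lemma module_isoI:
  assumes "f \<in> module_hom R M N" "g \<in> module_hom R N M"
    and "\<And>x. x \<in> carrier M \<Longrightarrow> g (f x) = x" "\<And>y. y \<in> carrier N \<Longrightarrow> f (g y) = y"
  shows "f \<in> module_iso R M N"
proof -
  have "bij_betw f (carrier M) (carrier N)"
    using assms(3,4) module_hom_closed[OF assms(1)] module_hom_closed[OF assms(2)]
    by (intro bij_betwI[where g = g]) auto
  then show ?thesis using assms(1) by (simp add: module_iso_def)
qed

lemma module_isoE:
  assumes "f \<in> module_iso R M N" "module R M"
  obtains g where "f \<in> module_hom R M N" "g \<in> module_hom R N M"
    "\<And>x. x \<in> carrier M \<Longrightarrow> g (f x) = x" "\<And>y. y \<in> carrier N \<Longrightarrow> f (g y) = y"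
proof
  interpret M: module R M by fact
  let ?g = "inv_into (carrier M) f"
  show f: "f \<in> module_hom R M N" using assms by (simp add: module_iso_def)
  have b: "bij_betw f (carrier M) (carrier N)" using assms by (simp add: module_iso_def)
  show gf: "?g (f x) = x" if "x \<in> carrier M" for x
    using b that by (simp add: bij_betw_inv_into_left)
  show fg: "f (?g y) = y" if "y \<in> carrier N" for y
    using b that by (simp add: bij_betw_inv_into_right)
  have gc: "?g y \<in> carrier M" if "y \<in> carrier N" for y
    using b that by (metis bij_betw_def inv_into_into)
  show "?g \<in> module_hom R N M"
  proof (rule module_homI)
    fix x y assume xy: "x \<in> carrier N" "y \<in> carrier N"
    have "?g (x \<oplus>\<^bsub>N\<^esub> y) = ?g (f (?g x \<oplus>\<^bsub>M\<^esub> ?g y))"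
      using xy gc fg by (simp add: module_hom_add[OF f])
    also have "\<dots> = ?g x \<oplus>\<^bsub>M\<^esub> ?g y" using xy gc by (intro gf) simp
    finally show "?g (x \<oplus>\<^bsub>N\<^esub> y) = ?g x \<oplus>\<^bsub>M\<^esub> ?g y" .
  next
    fix a y assume ay: "a \<in> carrier R" "y \<in> carrier N"
    have "?g (a \<odot>\<^bsub>N\<^esub> y) = ?g (f (a \<odot>\<^bsub>M\<^esub> ?g y))"
      using ay gc fg by (simp add: module_hom_smult[OF f])
    also have "\<dots> = a \<odot>\<^bsub>M\<^esub> ?g y" using ay gc by (intro gf) simp
    finally show "?g (a \<odot>\<^bsub>N\<^esub> y) = a \<odot>\<^bsub>M\<^esub> ?g y" .
  qed (use gc in auto)
qed

lemma module_iso_sym: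
  assumes "f \<in> module_iso R M N" "module R M"
  shows "\<exists>g. g \<in> module_iso R N M"
  by (rule module_isoE[OF assms]) (blast intro: module_isoI)

lemma module_iso_comp:
  assumes "f \<in> module_iso R M N" "g \<in> module_iso R N K"
  shows "(\<lambda>x. g (f x)) \<in> module_iso R M K"
  using assms module_hom_comp[of f R M N g K] bij_betw_trans[of f "carrier M" "carrier N" g "carrier K"]
  by (auto simp: module_iso_def comp_def)

lemma module_isomorphic_sym:
  "module_isomorphic R M N \<Longrightarrow> module R M \<Longrightarrow> module_isomorphic R N M"
  unfolding module_isomorphic_altdef using module_iso_sym by blast

lemma module_isomorphic_trans:
  "module_isomorphic R M N \<Longrightarrow> module_isomorphic R N K \<Longrightarrow> module_isomorphic R M K"
  unfolding module_isomorphic_altdef using module_iso_comp by blast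

section \<open>Isomorphisms between sums with free modules\<close>

lemma direct_sum_isomorphic_left:
  assumes "module_isomorphic R M N"
  shows "module_isomorphic R (direct_sum M K) (direct_sum N K)"
proof -
  obtain f where f: "f \<in> module_hom R M N" "bij_betw f (carrier M) (carrier N)"
    using assms by (auto simp: module_isomorphic_def)
  have "map_prod f id \<in> module_hom R (direct_sum M K) (direct_sum N K)"
    using f(1) by (auto simp: module_hom_def)
  moreover have "bij_betw (map_prod f id) (carrier (direct_sum M K)) (carrier (direct_sum N K))"
    using f(2) by (auto simp: bij_betw_def map_prod_surj_on intro!: map_prod_inj_on)
  ultimately show ?thesis by (auto simp: module_isomorphic_def)
qed

lemma direct_sum_zero_isomorphic:
  assumes "module R M"
  shows "module_isomorphic R (direct_sum M (free_module R 0)) M"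
proof -
  interpret M: module R M by fact
  have "fst \<in> module_hom R (direct_sum M (free_module R 0)) M"
    by (auto simp: module_hom_def)
  moreover have "bij_betw fst (carrier (direct_sum M (free_module R 0))) (carrier M)"
    by (auto simp: bij_betw_def inj_on_def image_iff)
  ultimately show ?thesis by (auto simp: module_isomorphic_def)
qed

lemma free_module_coord: "y \<in> carrier (free_module R n) \<Longrightarrow> i < n \<Longrightarrow> y i \<in> carrier R"
  unfolding free_module_simps(1) by (erule PiE_mem) simp

lemma restrict_free_module:
  "(\<And>i. i < n \<Longrightarrow> f i \<in> carrier R) \<Longrightarrow> restrict f {..<n} \<in> carrier (free_module R n)"
  by (simp add: PiE_iff)

lemma free_module_eqI:
  assumes "x \<in> carrier (free_module R n)" "y \<in> carrier (free_module R n)"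
    and "\<And>i. i < n \<Longrightarrow> x i = y i"
  shows "x = y"
  using assms(1,2) unfolding free_module_simps(1) by (rule PiE_ext) (simp add: assms(3))

lemma restrict_free_module_add:
  "k \<le> n \<Longrightarrow> restrict (x \<oplus>\<^bsub>free_module R n\<^esub> y) {..<k} =
    restrict x {..<k} \<oplus>\<^bsub>free_module R k\<^esub> restrict y {..<k}"
  by (rule ext) simp

lemma restrict_free_module_smult:
  "k \<le> n \<Longrightarrow> restrict (a \<odot>\<^bsub>free_module R n\<^esub> x) {..<k} = a \<odot>\<^bsub>free_module R k\<^esub> restrict x {..<k}"
  by (rule ext) simp

lemma restrict_free_module_carrier:
  "x \<in> carrier (free_module R n) \<Longrightarrow> k \<le> n \<Longrightarrow> restrict x {..<k} \<in> carrier (free_module R k)"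
  using free_module_coord by (intro restrict_free_module) fastforce

text \<open>Splits off the last coordinate, which turns cancellation of \<open>Suc m\<close>
  coordinates into repeated cancellation of one.\<close>

lemma direct_sum_free_assoc:
  assumes "module R M"
  shows "module_isomorphic R (direct_sum M (free_module R (Suc m)))
    (direct_sum (direct_sum M (free_module R m)) (free_module R 1))"
    (is "module_isomorphic R ?A ?B")
proof -
  interpret M: module R M by fact
  let ?f = "\<lambda>(x, z). ((x, restrict z {..<m}), \<lambda>i\<in>{..<1::nat}. z m)"
  let ?g = "\<lambda>((x, z), w). (x, \<lambda>i\<in>{..<Suc m}. if i < m then z i else w (0::nat))"
  have "?f \<in> module_iso R ?A ?B"
  proof (rule module_isoI[where g = ?g])
    show "?f \<in> module_hom R ?A ?B"
    proof (rule module_homI)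
      fix u assume "u \<in> carrier ?A"
      then obtain x z where u: "u = (x, z)" "x \<in> carrier M" "z \<in> carrier (free_module R (Suc m))"
        unfolding direct_sum_simps(1) by blast
      have "restrict z {..<m} \<in> carrier (free_module R m)"
        using u(3) by (rule restrict_free_module_carrier) simp
      moreover have "(\<lambda>i\<in>{..<1::nat}. z m) \<in> carrier (free_module R 1)"
        using free_module_coord[OF u(3), of m] by (intro restrict_free_module) simp
      ultimately show "?f u \<in> carrier ?B" using u(1,2) by simp
    next
      fix u v assume "u \<in> carrier ?A" "v \<in> carrier ?A"
      show "?f (u \<oplus>\<^bsub>?A\<^esub> v) = ?f u \<oplus>\<^bsub>?B\<^esub> ?f v"
        by (cases u; cases v) (simp add: fun_eq_iff)
    next
      fix a u assume "u \<in> carrier ?A"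
      show "?f (a \<odot>\<^bsub>?A\<^esub> u) = a \<odot>\<^bsub>?B\<^esub> ?f u"
        by (cases u) (simp add: fun_eq_iff)
    qed
    show "?g \<in> module_hom R ?B ?A"
    proof (rule module_homI)
      fix u assume "u \<in> carrier ?B"
      then obtain x z w where u: "u = ((x, z), w)" "x \<in> carrier M"
        "z \<in> carrier (free_module R m)" "w \<in> carrier (free_module R 1)"
        unfolding direct_sum_simps(1) by blast
      have "(\<lambda>i\<in>{..<Suc m}. if i < m then z i else w 0) \<in> carrier (free_module R (Suc m))"
        using free_module_coord[OF u(3)] free_module_coord[OF u(4), of 0]
        by (intro restrict_free_module) simp
      then show "?g u \<in> carrier ?A" using u(1,2) by simp
    next
      fix u v assume "u \<in> carrier ?B" "v \<in> carrier ?B"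
      show "?g (u \<oplus>\<^bsub>?B\<^esub> v) = ?g u \<oplus>\<^bsub>?A\<^esub> ?g v"
        by (cases u; cases v; cases "fst u"; cases "fst v") (simp add: fun_eq_iff)
    next
      fix a u assume "u \<in> carrier ?B"
      show "?g (a \<odot>\<^bsub>?B\<^esub> u) = a \<odot>\<^bsub>?A\<^esub> ?g u"
        by (cases u; cases "fst u") (simp add: fun_eq_iff)
    qed
  next
    fix u assume "u \<in> carrier ?A"
    then obtain x z where u: "u = (x, z)" "z \<in> carrier (free_module R (Suc m))"
      unfolding direct_sum_simps(1) by blast
    have "(\<lambda>i\<in>{..<Suc m}. if i < m then restrict z {..<m} i else (\<lambda>i\<in>{..<1::nat}. z m) 0) = z"
      using u(2) by (auto simp: fun_eq_iff PiE_iff extensional_def less_Suc_eq)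
    then show "?g (?f u) = u" unfolding u(1) prod.case by (simp only:)
  next
    fix u assume "u \<in> carrier ?B"
    then obtain x z w where u: "u = ((x, z), w)" "z \<in> carrier (free_module R m)"
      "w \<in> carrier (free_module R 1)"
      unfolding direct_sum_simps(1) by blast
    then show "?f (?g u) = u"
      by (auto simp: fun_eq_iff PiE_iff extensional_def)
  qed
  then show ?thesis by (auto simp: module_isomorphic_altdef)
qed

lemma free_module_split:
  "module_isomorphic R (direct_sum (free_module R n) (free_module R m)) (free_module R (n + m))"
proof -
  let ?f = "\<lambda>(x, z). \<lambda>i\<in>{..<n + m}. if i < n then x i else z (i - n)"
  let ?g = "\<lambda>y. (\<lambda>i\<in>{..<n}. y i, \<lambda>i\<in>{..<m}. y (n + i))"
  have "?f \<in> module_iso R (direct_sum (free_module R n) (free_module R m)) (free_module R (n + m))"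
  proof (rule module_isoI[where g = ?g])
    show "?f \<in> module_hom R (direct_sum (free_module R n) (free_module R m)) (free_module R (n + m))"
      by (auto simp: module_hom_def PiE_iff fun_eq_iff)
    show "?g \<in> module_hom R (free_module R (n + m)) (direct_sum (free_module R n) (free_module R m))"
      by (auto simp: module_hom_def PiE_iff fun_eq_iff)
  qed (auto simp: PiE_iff fun_eq_iff extensional_def)
  then show ?thesis by (auto simp: module_isomorphic_altdef)
qed

section \<open>Basis expansions in free modules\<close>

definition unit_vec :: "('r, 'k) ring_scheme \<Rightarrow> nat \<Rightarrow> nat \<Rightarrow> nat \<Rightarrow> 'r"
  where "unit_vec R n i = (\<lambda>j\<in>{..<n}. if j = i then \<one>\<^bsub>R\<^esub> else \<zero>\<^bsub>R\<^esub>)"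

lemma (in cring) unit_vec_carrier [simp]: "unit_vec R n i \<in> {..<n} \<rightarrow>\<^sub>E carrier R"
  by (auto simp: unit_vec_def)

lemma coordinate_hom:
  "i < n \<Longrightarrow> (\<lambda>y. y i) \<in> module_hom R (free_module R n) (regular_module R)"
  by (rule module_homI) auto

lemma finsum_regular: "finsum (regular_module R) f I = finsum R f I"
  by (simp add: finsum_def finprod_def module_via_def)

lemma free_module_finsum_coordinate:
  assumes "cring R" "finite I" "h \<in> I \<rightarrow> carrier (free_module R n)" "i < n"
  shows "(\<Oplus>\<^bsub>free_module R n\<^esub>k\<in>I. h k) i = (\<Oplus>\<^bsub>R\<^esub>k\<in>I. h k i)"
  using module_hom_finsum[OF module_free_module module_regular coordinate_hom assms(2,3)] assms
  by (simp add: finsum_regular)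

lemma free_module_expansion:
  assumes "cring R" "y \<in> carrier (free_module R n)"
  shows "y = (\<Oplus>\<^bsub>free_module R n\<^esub>i\<in>{..<n}. y i \<odot>\<^bsub>free_module R n\<^esub> unit_vec R n i)" (is "_ = ?r")
proof
  fix j
  interpret R: cring R by fact
  interpret F: module R "free_module R n" by (rule module_free_module) fact
  have yc: "y i \<in> carrier R" if "i < n" for i using assms(2) that by auto
  have h: "(\<lambda>i. y i \<odot>\<^bsub>free_module R n\<^esub> unit_vec R n i) \<in> {..<n} \<rightarrow> carrier (free_module R n)"
    using yc by (auto simp: unit_vec_def)
  have r: "?r \<in> carrier (free_module R n)" using h by (rule F.M.finsum_closed)
  show "y j = ?r j"
  proof (cases "j < n")
    case False
    then show ?thesis using assms(2) r by (simp add: PiE_iff extensional_def)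
  next
    case True
    have "?r j = (\<Oplus>\<^bsub>R\<^esub>i\<in>{..<n}. (y i \<odot>\<^bsub>free_module R n\<^esub> unit_vec R n i) j)"
      using h True by (intro free_module_finsum_coordinate assms) auto
    also have "\<dots> = (\<Oplus>\<^bsub>R\<^esub>i\<in>{..<n}. if j = i then y i else \<zero>\<^bsub>R\<^esub>)"
      using yc True by (intro R.finsum_cong') (auto simp: unit_vec_def)
    also have "\<dots> = y j"
      using R.finsum_singleton[of j "{..<n}" y] yc True by (simp add: Pi_iff)
    finally show ?thesis by simp
  qed
qed

lemma free_module_hom_expansion:
  assumes "cring R" "module R N" "f \<in> module_hom R (free_module R n) N" "y \<in> carrier (free_module R n)"
  shows "f y = (\<Oplus>\<^bsub>N\<^esub>i\<in>{..<n}. y i \<odot>\<^bsub>N\<^esub> f (unit_vec R n i))"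
proof -
  interpret R: cring R by fact
  interpret N: module R N by fact
  have yc: "y i \<in> carrier R" if "i < n" for i using assms(4) that by auto
  have uc: "unit_vec R n i \<in> carrier (free_module R n)" for i by simp
  have h: "(\<lambda>i. y i \<odot>\<^bsub>free_module R n\<^esub> unit_vec R n i) \<in> {..<n} \<rightarrow> carrier (free_module R n)"
    using yc by (auto simp: unit_vec_def)
  have "f y = f (\<Oplus>\<^bsub>free_module R n\<^esub>i\<in>{..<n}. y i \<odot>\<^bsub>free_module R n\<^esub> unit_vec R n i)"
    using free_module_expansion[OF assms(1,4)] by simp
  also have "\<dots> = (\<Oplus>\<^bsub>N\<^esub>i\<in>{..<n}. f (y i \<odot>\<^bsub>free_module R n\<^esub> unit_vec R n i))"
    by (rule module_hom_finsum[OF module_free_module[OF assms(1)] assms(2,3) _ h]) simp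
  also have "\<dots> = (\<Oplus>\<^bsub>N\<^esub>i\<in>{..<n}. y i \<odot>\<^bsub>N\<^esub> f (unit_vec R n i))"
    using yc uc module_hom_smult[OF assms(3)] module_hom_closed[OF assms(3)]
    by (intro N.M.finsum_cong') auto
  finally show ?thesis .
qed

text \<open>
  A trivialization makes \<open>P\<close> free of rank \<open>n\<close> after inverting \<open>s\<close>, but involves no fractions and
  needs no hypothesis on zero divisors.
\<close>

definition trivialization ::
    "('r, 'k) ring_scheme \<Rightarrow> ('r, 'm, 'x) module_scheme \<Rightarrow> nat \<Rightarrow> 'r \<Rightarrow>
      ((nat \<Rightarrow> 'r) \<Rightarrow> 'm) \<Rightarrow> ('m \<Rightarrow> nat \<Rightarrow> 'r) \<Rightarrow> bool"
  where "trivialization R P n s \<Phi> \<Psi> \<longleftrightarrow> s \<in> carrier R \<and>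
    \<Phi> \<in> module_hom R (free_module R n) P \<and> \<Psi> \<in> module_hom R P (free_module R n) \<and>
    (\<forall>x\<in>carrier P. \<Phi> (\<Psi> x) = s \<odot>\<^bsub>P\<^esub> x) \<and>
    (\<forall>y\<in>carrier (free_module R n). \<Psi> (\<Phi> y) = s \<odot>\<^bsub>free_module R n\<^esub> y)"

text \<open>Stands in for freeness of the localizations: the denominator only has to avoid the
  prime, so all maps stay over the ring itself.\<close>

definition locally_free :: "('r, 'k) ring_scheme \<Rightarrow> ('r, 'm, 'x) module_scheme \<Rightarrow> nat \<Rightarrow> bool"
  where "locally_free R P n \<longleftrightarrow>
    (\<forall>Q. primeideal Q R \<longrightarrow> (\<exists>s \<Phi> \<Psi>. s \<notin> Q \<and> trivialization R P n s \<Phi> \<Psi>))"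

text \<open>Both composites must be multiplication by the same \<open>s\<close>, so the free summand
  carries the identity in one direction and multiplication by \<open>s\<close> in the other. This is
  where the block \<Psi> \<oplus> s comes from.\<close>

lemma trivialization_direct_sum:
  assumes "module R P" "trivialization R P n s \<Phi> \<Psi>"
  shows "trivialization R (direct_sum P (free_module R m)) (n + m) s
    (\<lambda>y. (\<Phi> (\<lambda>i\<in>{..<n}. y i), \<lambda>i\<in>{..<m}. y (n + i)))
    (\<lambda>(x, z). \<lambda>i\<in>{..<n + m}. if i < n then \<Psi> x i else s \<otimes>\<^bsub>R\<^esub> z (i - n))"
proof -
  interpret P: module R P by fact
  have s: "s \<in> carrier R" and \<Phi>: "\<Phi> \<in> module_hom R (free_module R n) P"
    and \<Psi>: "\<Psi> \<in> module_hom R P (free_module R n)"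
    and 1: "\<And>x. x \<in> carrier P \<Longrightarrow> \<Phi> (\<Psi> x) = s \<odot>\<^bsub>P\<^esub> x"
    and 2: "\<And>y. y \<in> carrier (free_module R n) \<Longrightarrow> \<Psi> (\<Phi> y) = s \<odot>\<^bsub>free_module R n\<^esub> y"
    using assms(2) by (auto simp: trivialization_def)
  have a: "(\<lambda>i\<in>{..<n}. y i) \<in> carrier (free_module R n)" if "y \<in> carrier (free_module R (n + m))" for y
    using free_module_coord[OF that] by (intro restrict_free_module) simp
  have b: "\<Psi> x \<in> {..<n} \<rightarrow>\<^sub>E carrier R" if "x \<in> carrier P" for x
    using module_hom_closed[OF \<Psi> that] by simp
  have b': "\<Psi> x i \<in> carrier R" if "x \<in> carrier P" "i < n" for x i
    using PiE_mem[OF b[OF that(1)]] that(2) by simp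
  have idx: "\<not> i < n \<Longrightarrow> i < n + m \<Longrightarrow> i - n < m" for i by linarith
  let ?D = "direct_sum P (free_module R m)"
  show ?thesis
    unfolding trivialization_def
  proof (intro conjI ballI)
    show "(\<lambda>y. (\<Phi> (\<lambda>i\<in>{..<n}. y i), \<lambda>i\<in>{..<m}. y (n + i))) \<in> module_hom R (free_module R (n + m)) ?D"
    proof (rule module_homI)
      fix y assume y: "y \<in> carrier (free_module R (n + m))"
      have "(\<lambda>i\<in>{..<m}. y (n + i)) \<in> carrier (free_module R m)"
        using free_module_coord[OF y] by (intro restrict_free_module) simp
      then show "(\<Phi> (\<lambda>i\<in>{..<n}. y i), \<lambda>i\<in>{..<m}. y (n + i)) \<in> carrier ?D"
        using module_hom_closed[OF \<Phi> a[OF y]] by simp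
    next
      fix x y assume xy: "x \<in> carrier (free_module R (n + m))" "y \<in> carrier (free_module R (n + m))"
      show "(\<Phi> (\<lambda>i\<in>{..<n}. (x \<oplus>\<^bsub>free_module R (n + m)\<^esub> y) i), \<lambda>i\<in>{..<m}. (x \<oplus>\<^bsub>free_module R (n + m)\<^esub> y) (n + i)) =
        (\<Phi> (\<lambda>i\<in>{..<n}. x i), \<lambda>i\<in>{..<m}. x (n + i)) \<oplus>\<^bsub>?D\<^esub>
        (\<Phi> (\<lambda>i\<in>{..<n}. y i), \<lambda>i\<in>{..<m}. y (n + i))"
        unfolding restrict_free_module_add[OF le_add1] module_hom_add[OF \<Phi> a[OF xy(1)] a[OF xy(2)]]
        by (simp add: fun_eq_iff)
    next
      fix r y assume ry: "r \<in> carrier R" "y \<in> carrier (free_module R (n + m))"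
      show "(\<Phi> (\<lambda>i\<in>{..<n}. (r \<odot>\<^bsub>free_module R (n + m)\<^esub> y) i), \<lambda>i\<in>{..<m}. (r \<odot>\<^bsub>free_module R (n + m)\<^esub> y) (n + i)) =
        r \<odot>\<^bsub>?D\<^esub> (\<Phi> (\<lambda>i\<in>{..<n}. y i), \<lambda>i\<in>{..<m}. y (n + i))"
        unfolding restrict_free_module_smult[OF le_add1] module_hom_smult[OF \<Phi> ry(1) a[OF ry(2)]]
        by (simp add: fun_eq_iff)
    qed
    show "(\<lambda>(x, z). \<lambda>i\<in>{..<n + m}. if i < n then \<Psi> x i else s \<otimes>\<^bsub>R\<^esub> z (i - n))
      \<in> module_hom R ?D (free_module R (n + m))" (is "?\<psi> \<in> _")
    proof (rule module_homI)
      fix u assume "u \<in> carrier ?D"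
      then obtain x z where u: "u = (x, z)" "x \<in> carrier P" "z \<in> carrier (free_module R m)"
        unfolding direct_sum_simps(1) by blast
      have "(\<lambda>i\<in>{..<n + m}. if i < n then \<Psi> x i else s \<otimes>\<^bsub>R\<^esub> z (i - n)) \<in> carrier (free_module R (n + m))"
        using b'[OF u(2)] s free_module_coord[OF u(3)] by (intro restrict_free_module) simp
      then show "?\<psi> u \<in> carrier (free_module R (n + m))" by (simp only: u(1) prod.case)
    next
      fix u v assume "u \<in> carrier ?D" "v \<in> carrier ?D"
      then obtain x z x' z' where u: "u = (x, z)" "x \<in> carrier P" "z \<in> carrier (free_module R m)"
        and v: "v = (x', z')" "x' \<in> carrier P" "z' \<in> carrier (free_module R m)"
        unfolding direct_sum_simps(1) by blast
      show "?\<psi> (u \<oplus>\<^bsub>?D\<^esub> v) = ?\<psi> u \<oplus>\<^bsub>free_module R (n + m)\<^esub> ?\<psi> v"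
        using s free_module_coord[OF u(3)] free_module_coord[OF v(3)]
        by (simp add: u(1) v(1) module_hom_add[OF \<Psi> u(2) v(2)] fun_eq_iff idx P.R.r_distr)
    next
      fix c u assume c: "c \<in> carrier R" and "u \<in> carrier ?D"
      then obtain x z where u: "u = (x, z)" "x \<in> carrier P" "z \<in> carrier (free_module R m)"
        unfolding direct_sum_simps(1) by blast
      show "?\<psi> (c \<odot>\<^bsub>?D\<^esub> u) = c \<odot>\<^bsub>free_module R (n + m)\<^esub> ?\<psi> u"
        using s free_module_coord[OF u(3)] c
        by (simp add: u(1) module_hom_smult[OF \<Psi> c u(2)] fun_eq_iff idx P.R.m_lcomm)
    qed
    show "(\<Phi> (\<lambda>i\<in>{..<n}. ?\<psi> x i), \<lambda>i\<in>{..<m}. ?\<psi> x (n + i)) = s \<odot>\<^bsub>?D\<^esub> x" if x: "x \<in> carrier ?D" for x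
    proof -
      obtain p z where pz: "x = (p, z)" "p \<in> carrier P" "z \<in> carrier (free_module R m)"
        using x unfolding direct_sum_simps(1) by blast
      have r: "restrict (?\<psi> x) {..<n} = \<Psi> p"
        using b[OF pz(2)] by (auto simp: pz(1) fun_eq_iff PiE_iff extensional_def)
      show ?thesis unfolding r 1[OF pz(2)] by (simp add: pz(1) fun_eq_iff)
    qed
    show "?\<psi> (\<Phi> (\<lambda>i\<in>{..<n}. y i), \<lambda>i\<in>{..<m}. y (n + i)) = s \<odot>\<^bsub>free_module R (n + m)\<^esub> y"
      if y: "y \<in> carrier (free_module R (n + m))" for y
      using 2[OF a[OF y]] y by (auto simp: fun_eq_iff idx PiE_iff extensional_def)
  qed (rule s)
qed

lemma locally_free_direct_sum:
  assumes "module R P" "locally_free R P n"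
  shows "locally_free R (direct_sum P (free_module R m)) (n + m)"
  using trivialization_direct_sum[OF assms(1)] assms(2) unfolding locally_free_def by blast

section \<open>Basic elements and transvections\<close>

text \<open>
  For projective \<open>P\<close> this says that \<open>x\<close> does not vanish in the fibre of \<open>P\<close> at \<open>Q\<close>.
\<close>

definition basic_at :: "('r, 'k) ring_scheme \<Rightarrow> ('r, 'm, 'x) module_scheme \<Rightarrow> 'r set \<Rightarrow> 'm \<Rightarrow> bool"
  where "basic_at R P Q x \<longleftrightarrow> (\<exists>f\<in>module_hom R P (regular_module R). f x \<notin> Q)"

definition unimodular :: "('r, 'k) ring_scheme \<Rightarrow> ('r, 'm, 'x) module_scheme \<Rightarrow> 'm \<Rightarrow> bool"
  where "unimodular R M u \<longleftrightarrow> u \<in> carrier M \<and> (\<exists>F\<in>module_hom R M (regular_module R). F u = \<one>\<^bsub>R\<^esub>)"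

text \<open>
  Noetherian induction on \<open>J\<close>: pick any prime \<open>Q\<close> over \<open>J\<close> and a trivialization with \<open>s \<notin> Q\<close>. The
  induction hypothesis for \<open>J + (s)\<close> handles the primes containing \<open>s\<close>; a further translation by a
  multiple of \<open>s\<close> does not disturb them, and away from \<open>s\<close> the claim is the stable range estimate for
  the coordinates of \<open>\<Psi> p\<close>.
\<close>

lemma (in noetherian_cring) exists_basic_translate:
  assumes P: "module A P" "locally_free A P n" and a: "a \<in> carrier A" and p: "p \<in> carrier P"
    and "ideal J A" "\<And>c k. prime_chain J c k \<Longrightarrow> k < n"
    and "\<And>Q. primeideal Q A \<Longrightarrow> J \<subseteq> Q \<Longrightarrow> a \<notin> Q \<or> basic_at A P Q p"
  shows "\<exists>q\<in>carrier P. \<forall>Q. primeideal Q A \<longrightarrow> J \<subseteq> Q \<longrightarrow> basic_at A P Q (p \<oplus>\<^bsub>P\<^esub> a \<odot>\<^bsub>P\<^esub> q)"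
  using assms(5-7)
proof (induction J rule: ideal_noetherian_induct)
  case (step J)
  interpret P: module A P by fact
  interpret J: ideal J A by fact
  show ?case
  proof (cases "\<exists>Q. primeideal Q A \<and> J \<subseteq> Q")
    case False
    then show ?thesis using P.zero_closed by blast
  next
    case True
    then obtain Q0 where Q0: "primeideal Q0 A" "J \<subseteq> Q0" by blast
    obtain s \<Phi> \<Psi> where s: "s \<notin> Q0" and t: "trivialization A P n s \<Phi> \<Psi>"
      using P(2) Q0(1) by (auto simp: locally_free_def)
    have sA: "s \<in> carrier A" and \<Phi>: "\<Phi> \<in> module_hom A (free_module A n) P"
      and \<Psi>: "\<Psi> \<in> module_hom A P (free_module A n)"
      and \<Psi>\<Phi>: "\<And>y. y \<in> carrier (free_module A n) \<Longrightarrow> \<Psi> (\<Phi> y) = s \<odot>\<^bsub>free_module A n\<^esub> y"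
      using t by (simp_all add: trivialization_def)
    obtain J' where J': "ideal J' A" "J \<subseteq> J'" "s \<in> J'"
      "\<And>x. x \<in> J' \<Longrightarrow> \<exists>j\<in>J. \<exists>r\<in>carrier A. x = j \<oplus> r \<otimes> s"
      using ideal_adjoin[OF step(1) sA] by blast
    have "J \<subset> J'" using J'(2,3) s Q0(2) by auto
    moreover have "k < n" if "prime_chain J' c k" for c k
      using step(3)[of c k] that J'(2) unfolding prime_chain_def by (meson subset_trans)
    moreover have "a \<notin> Q \<or> basic_at A P Q p" if "primeideal Q A" "J' \<subseteq> Q" for Q
      using step(4)[OF that(1)] that(2) J'(2) by auto
    ultimately obtain q0 where q0: "q0 \<in> carrier P"
      "\<And>Q. primeideal Q A \<Longrightarrow> J' \<subseteq> Q \<Longrightarrow> basic_at A P Q (p \<oplus>\<^bsub>P\<^esub> a \<odot>\<^bsub>P\<^esub> q0)"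
      using step(2)[OF J'(1)] by meson
    define p1 where "p1 = p \<oplus>\<^bsub>P\<^esub> a \<odot>\<^bsub>P\<^esub> q0"
    have p1: "p1 \<in> carrier P" using p a q0(1) by (simp add: p1_def)
    have \<Psi>p1: "\<Psi> p1 i \<in> carrier A" if "i < n" for i
      using module_hom_closed[OF \<Psi> p1] that by (rule free_module_coord)
    \<comment> \<open>The translation enters with the factor \<open>a\<close>; taking only multiples
      of \<open>s\<close> contributes one \<open>s\<close>, and \<open>\<Psi> (\<Phi> v)\<close> = s
      v the other. So the \<open>i\<close>-th coordinate of \<Psi> changes by
      \<open>c \<otimes> y i\<close>.\<close>
    define c where "c = a \<otimes> (s \<otimes> s)"
    have c: "c \<in> carrier A" using a sA by (simp add: c_def)
    obtain y where y: "\<And>i. i < n \<Longrightarrow> y i \<in> carrier A"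
      "\<And>Q. primeideal Q A \<Longrightarrow> J \<subseteq> Q \<Longrightarrow> c \<notin> Q \<Longrightarrow> \<forall>i<n. \<Psi> p1 i \<oplus> c \<otimes> y i \<in> Q \<Longrightarrow>
        \<exists>ch. prime_chain J ch n \<and> ch n = Q"
      using stable_range_chain[OF J.a_subset c, of n "\<Psi> p1"] \<Psi>p1 by blast
    define v where "v = restrict y {..<n}"
    have v: "v \<in> carrier (free_module A n)" unfolding v_def using y(1) by (rule restrict_free_module)
    have \<Phi>v: "\<Phi> v \<in> carrier P" using module_hom_closed[OF \<Phi> v] .
    define q where "q = q0 \<oplus>\<^bsub>P\<^esub> s \<odot>\<^bsub>P\<^esub> \<Phi> v"
    have q: "q \<in> carrier P" using q0(1) sA \<Phi>v by (simp add: q_def)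
    let ?p2 = "p \<oplus>\<^bsub>P\<^esub> a \<odot>\<^bsub>P\<^esub> q"
    have p2: "?p2 = p1 \<oplus>\<^bsub>P\<^esub> (a \<otimes> s) \<odot>\<^bsub>P\<^esub> \<Phi> v"
      using p a q0(1) sA \<Phi>v by (simp add: p1_def q_def P.smult_r_distr P.smult_assoc1 P.M.a_assoc)
    have "basic_at A P Q ?p2" if Q: "primeideal Q A" "J \<subseteq> Q" for Q
    proof -
      interpret Q: primeideal Q A by fact
      consider "s \<in> Q" | "a \<in> Q" | "s \<notin> Q" "a \<notin> Q" by blast
      then show ?thesis
      proof cases
        case 1
        have "J' \<subseteq> Q"
        proof
          fix x assume "x \<in> J'"
          then obtain j r where "j \<in> J" "r \<in> carrier A" "x = j \<oplus> r \<otimes> s" using J'(4) by blast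
          then show "x \<in> Q" using Q(2) 1 by (auto intro!: Q.a_closed Q.I_l_closed)
        qed
        then obtain f where f: "f \<in> module_hom A P (regular_module A)" "f p1 \<notin> Q"
          using q0(2)[OF Q(1)] by (auto simp: basic_at_def p1_def)
        have "f ?p2 = f p1 \<oplus> a \<otimes> s \<otimes> f (\<Phi> v)"
          using p1 a sA \<Phi>v by (simp add: p2 module_homD[OF f(1)])
        moreover have "a \<otimes> s \<otimes> f (\<Phi> v) \<in> Q"
          using a 1 module_hom_closed[OF f(1) \<Phi>v] by (intro Q.I_r_closed Q.I_l_closed) auto
        ultimately have "f ?p2 \<notin> Q"
          using primeideal_add_cancel(2)[OF Q(1), of "a \<otimes> s \<otimes> f (\<Phi> v)" "f p1"]
            module_hom_closed[OF f(1) p1] f(2) by simp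
        then show ?thesis using f(1) by (auto simp: basic_at_def)
      next
        case 2
        \<comment> \<open>The translation is invisible modulo a prime containing \<open>a\<close>,
          so \<open>p\<close> itself has to be basic there, as the last assumption
          guarantees.\<close>
        then obtain f where f: "f \<in> module_hom A P (regular_module A)" "f p \<notin> Q"
          using step(4)[OF Q] by (auto simp: basic_at_def)
        have "f ?p2 = f p \<oplus> a \<otimes> f q"
          using p a q by (simp add: module_homD[OF f(1)])
        moreover have "a \<otimes> f q \<in> Q"
          using 2 module_hom_closed[OF f(1) q] by (intro Q.I_r_closed) auto
        ultimately have "f ?p2 \<notin> Q"
          using primeideal_add_cancel(2)[OF Q(1), of "a \<otimes> f q" "f p"]
            module_hom_closed[OF f(1) p] f(2) by simp
        then show ?thesis using f(1) by (auto simp: basic_at_def)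
      next
        case 3
        have "c \<notin> Q" using 3 a sA primeideal_mult[OF Q(1)] by (simp add: c_def)
        \<comment> \<open>Were all \<open>n\<close> coordinates in \<open>Q\<close>, a chain of
          length \<open>n\<close> of primes over \<open>J\<close> would end at \<open>Q\<close>,
          against the bound on chain lengths.\<close>
        then obtain i where i: "i < n" "\<Psi> p1 i \<oplus> c \<otimes> y i \<notin> Q"
          using y(2)[OF Q] step(3) by blast
        let ?f = "\<lambda>x. \<Psi> x i"
        have f: "?f \<in> module_hom A P (regular_module A)"
          by (rule module_hom_comp[OF \<Psi> coordinate_hom[OF i(1)]])
        have "\<Psi> (\<Phi> v) i = s \<otimes> y i" using \<Psi>\<Phi>[OF v] i(1) by (simp add: v_def)
        then have "?f ?p2 = \<Psi> p1 i \<oplus> a \<otimes> s \<otimes> (s \<otimes> y i)"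
          using p1 a sA \<Phi>v by (simp add: p2 module_homD[OF f])
        also have "\<dots> = \<Psi> p1 i \<oplus> c \<otimes> y i"
          using a sA y(1)[OF i(1)] by (simp add: c_def m_assoc)
        finally have "?f ?p2 \<notin> Q" using i(2) by simp
        then show ?thesis unfolding basic_at_def by (rule bexI[where x = ?f]) (rule f)
      qed
    qed
    then show ?thesis using q by blast
  qed
qed

section \<open>Transvections of P plus a free summand of rank one\<close>

definition scalar :: "'r \<Rightarrow> nat \<Rightarrow> 'r"
  where "scalar a = (\<lambda>i\<in>{..<1}. a)"

lemma scalar_simps [simp]:
  "scalar a 0 = a"
  "scalar a \<in> carrier (free_module R 1) \<longleftrightarrow> a \<in> carrier R"
  "scalar a \<oplus>\<^bsub>free_module R 1\<^esub> scalar b = scalar (a \<oplus>\<^bsub>R\<^esub> b)"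
  "c \<odot>\<^bsub>free_module R 1\<^esub> scalar a = scalar (c \<otimes>\<^bsub>R\<^esub> a)"
  by (auto simp: scalar_def fun_eq_iff PiE_iff)

lemma scalar_cases:
  assumes "z \<in> carrier (free_module R 1)"
  obtains a where "a \<in> carrier R" "z = scalar a"
proof
  show "z 0 \<in> carrier R" using assms by (rule free_module_coord) simp
  show "z = scalar (z 0)"
    using assms by (auto simp: scalar_def fun_eq_iff PiE_iff extensional_def)
qed

lemma direct_sum_scalar_cases:
  assumes "u \<in> carrier (direct_sum P (free_module R 1))"
  obtains p a where "p \<in> carrier P" "a \<in> carrier R" "u = (p, scalar a)"
  using assms unfolding direct_sum_simps(1) by (metis mem_Sigma_iff prod.collapse scalar_cases)

text \<open>The inverse is the same shear with the negated functional.\<close>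

lemma transvection_functional:
  assumes "module R P" "f \<in> module_hom R P (regular_module R)"
  shows "(\<lambda>(p, z). (p, scalar (z 0 \<oplus>\<^bsub>R\<^esub> f p))) \<in>
    module_iso R (direct_sum P (free_module R 1)) (direct_sum P (free_module R 1))"
proof -
  interpret P: module R P by fact
  let ?N = "direct_sum P (free_module R 1)"
  let ?T = "\<lambda>g (p, z :: nat \<Rightarrow> 'a). (p, scalar (z 0 \<oplus>\<^bsub>R\<^esub> g p))"
  have hom: "?T g \<in> module_hom R ?N ?N"
    if g: "g \<in> module_hom R P (regular_module R)" for g
  proof (rule module_homI)
    note [simp] = module_hom_closed[OF g, simplified] module_hom_add[OF g, simplified]
      module_hom_smult[OF g, simplified]
    fix u assume "u \<in> carrier ?N"
    then obtain p a where u: "p \<in> carrier P" "a \<in> carrier R" "u = (p, scalar a)"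
      by (rule direct_sum_scalar_cases)
    show "?T g u \<in> carrier ?N"
      using u by (simp del: One_nat_def free_module_simps)
    show "?T g (c \<odot>\<^bsub>?N\<^esub> u) = c \<odot>\<^bsub>?N\<^esub> ?T g u" if "c \<in> carrier R" for c
      using u that by (simp del: One_nat_def free_module_simps add: P.R.r_distr)
    fix v assume "v \<in> carrier ?N"
    then obtain q b where v: "q \<in> carrier P" "b \<in> carrier R" "v = (q, scalar b)"
      by (rule direct_sum_scalar_cases)
    show "?T g (u \<oplus>\<^bsub>?N\<^esub> v) = ?T g u \<oplus>\<^bsub>?N\<^esub> ?T g v"
      using u v by (simp del: One_nat_def free_module_simps add: P.R.a_ac)
  qed
  have mf: "(\<lambda>x. \<ominus>\<^bsub>R\<^esub> f x) \<in> module_hom R P (regular_module R)"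
    using assms(2) by (auto simp: module_hom_def P.R.minus_add P.R.r_minus Pi_iff)
  note [simp] = module_hom_closed[OF assms(2), simplified]
  show ?thesis
  proof (rule module_isoI[OF hom[OF assms(2)] hom[OF mf]])
    fix u assume "u \<in> carrier ?N"
    then obtain p a where u: "p \<in> carrier P" "a \<in> carrier R" "u = (p, scalar a)"
      by (rule direct_sum_scalar_cases)
    then show "?T (\<lambda>x. \<ominus>\<^bsub>R\<^esub> f x) (?T f u) = u"
      "?T f (?T (\<lambda>x. \<ominus>\<^bsub>R\<^esub> f x) u) = u"
      by (simp_all add: P.R.a_assoc P.R.r_neg P.R.l_neg)
  qed
qed

lemma transvection_vector:
  assumes "module R P" "q \<in> carrier P"
  shows "(\<lambda>(p, z). (p \<oplus>\<^bsub>P\<^esub> z 0 \<odot>\<^bsub>P\<^esub> q, z)) \<in>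
    module_iso R (direct_sum P (free_module R 1)) (direct_sum P (free_module R 1))"
proof -
  interpret P: module R P by fact
  let ?N = "direct_sum P (free_module R 1)"
  let ?T = "\<lambda>r (p, z :: nat \<Rightarrow> 'a). (p \<oplus>\<^bsub>P\<^esub> z 0 \<odot>\<^bsub>P\<^esub> r, z)"
  have hom: "?T r \<in> module_hom R ?N ?N" if r: "r \<in> carrier P" for r
  proof (rule module_homI)
    fix u assume "u \<in> carrier ?N"
    then obtain p a where u: "p \<in> carrier P" "a \<in> carrier R" "u = (p, scalar a)"
      by (rule direct_sum_scalar_cases)
    show "?T r u \<in> carrier ?N"
      using u r by (simp del: One_nat_def free_module_simps)
    show "?T r (c \<odot>\<^bsub>?N\<^esub> u) = c \<odot>\<^bsub>?N\<^esub> ?T r u" if "c \<in> carrier R" for c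
      using u r that by (simp del: One_nat_def free_module_simps add: P.smult_r_distr P.smult_assoc1)
    fix v assume "v \<in> carrier ?N"
    then obtain q b where v: "q \<in> carrier P" "b \<in> carrier R" "v = (q, scalar b)"
      by (rule direct_sum_scalar_cases)
    show "?T r (u \<oplus>\<^bsub>?N\<^esub> v) = ?T r u \<oplus>\<^bsub>?N\<^esub> ?T r v"
      using u v r by (simp del: One_nat_def free_module_simps add: P.smult_l_distr P.M.a_ac)
  qed
  show ?thesis
  proof (rule module_isoI[OF hom[OF assms(2)] hom[OF P.M.a_inv_closed[OF assms(2)]]])
    fix u assume "u \<in> carrier ?N"
    then obtain p a where u: "p \<in> carrier P" "a \<in> carrier R" "u = (p, scalar a)"
      by (rule direct_sum_scalar_cases)
    then show "?T (\<ominus>\<^bsub>P\<^esub> q) (?T q u) = u"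
      "?T q (?T (\<ominus>\<^bsub>P\<^esub> q) u) = u"
      using assms(2) by (simp_all add: P.M.a_assoc P.smult_r_minus P.M.r_neg P.M.l_neg)
  qed
qed

text \<open>The values of functionals at \<open>x\<close>, together with \<open>t\<close>, generate
  an ideal that no prime contains: at primes over \<open>t\<close> the vector is basic, and the
  other primes miss \<open>t\<close>. The conclusion is unimodularity of \<open>x\<close> modulo
  \<open>t\<close>.\<close>

lemma (in noetherian_cring) unimodular_order_ideal:
  assumes "module A P" "x \<in> carrier P" "t \<in> carrier A"
    and "\<And>Q. primeideal Q A \<Longrightarrow> t \<in> Q \<Longrightarrow> basic_at A P Q x"
  shows "\<exists>f\<in>module_hom A P (regular_module A). \<exists>r\<in>carrier A. f x \<oplus> t \<otimes> r = \<one>"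
proof -
  interpret P: module A P by fact
  have mA: "module A (regular_module A)" by (rule module_regular) (rule is_cring)
  let ?I = "{f x \<oplus> t \<otimes> r | f r. f \<in> module_hom A P (regular_module A) \<and> r \<in> carrier A}"
  have fc: "f x \<in> carrier A" if "f \<in> module_hom A P (regular_module A)" for f
    using module_hom_closed[OF that assms(2)] by simp
  have I_mem: "f x \<oplus> t \<otimes> r \<in> ?I" if "f \<in> module_hom A P (regular_module A)" "r \<in> carrier A" for f r
    using that by auto
  have zero_hom: "(\<lambda>_. \<zero>) \<in> module_hom A P (regular_module A)"
    by (rule module_homI) auto
  have add_cl: "y \<oplus> z \<in> ?I" if yz: "y \<in> ?I" "z \<in> ?I" for y z
  proof -
    obtain f r g r' where y: "y = f x \<oplus> t \<otimes> r" "f \<in> module_hom A P (regular_module A)" "r \<in> carrier A"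
      and z: "z = g x \<oplus> t \<otimes> r'" "g \<in> module_hom A P (regular_module A)" "r' \<in> carrier A"
      using yz by auto
    have "y \<oplus> z = (f x \<oplus> g x) \<oplus> t \<otimes> (r \<oplus> r')"
      using y z fc assms(3) by (simp add: r_distr a_ac)
    then show ?thesis
      using y z module_hom_plus[OF y(2) z(2) mA] by (intro CollectI exI[of _ "\<lambda>x. f x \<oplus> g x"] exI[of _ "r \<oplus> r'"]) simp
  qed
  have mult_cl: "c \<otimes> y \<in> ?I" if cy: "c \<in> carrier A" "y \<in> ?I" for c y
  proof -
    obtain f r where y: "y = f x \<oplus> t \<otimes> r" "f \<in> module_hom A P (regular_module A)" "r \<in> carrier A"
      using cy by auto
    have "c \<otimes> y = c \<otimes> f x \<oplus> t \<otimes> (c \<otimes> r)"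
      using y fc assms(3) cy(1) by (simp add: r_distr m_lcomm)
    then show ?thesis
      using y cy module_hom_scale[OF y(2) mA cy(1)]
      by (intro CollectI exI[of _ "\<lambda>x. c \<otimes> f x"] exI[of _ "c \<otimes> r"]) simp
  qed
  have I_sub: "?I \<subseteq> carrier A" using fc assms(3) by auto
  have "ideal ?I A"
  proof (rule idealI[OF ring_axioms])
    show "subgroup ?I (add_monoid A)"
    proof (rule add.subgroupI)
      show "?I \<noteq> {}" using zero_hom by blast
      show "\<ominus> y \<in> ?I" if "y \<in> ?I" for y
      proof -
        have "y \<in> carrier A" using that I_sub by (rule subsetD[rotated])
        then have "\<ominus> y = (\<ominus> \<one>) \<otimes> y" by (simp add: l_minus)
        then show ?thesis using mult_cl[of "\<ominus> \<one>" y] that by simp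
      qed
    qed (use I_sub add_cl in auto)
    show "y \<otimes> c \<in> ?I" if "y \<in> ?I" "c \<in> carrier A" for y c
    proof -
      have "y \<otimes> c = c \<otimes> y" using that I_sub by (auto intro: m_comm)
      then show ?thesis using mult_cl[OF that(2,1)] by simp
    qed
  qed (use mult_cl in blast)
  moreover have "\<not> ?I \<subseteq> Q" if Q: "primeideal Q A" for Q
  proof
    assume sub: "?I \<subseteq> Q"
    have "t \<in> Q" using subsetD[OF sub I_mem[OF zero_hom one_closed]] assms(3) by simp
    then obtain f where f: "f \<in> module_hom A P (regular_module A)" "f x \<notin> Q"
      using assms(4)[OF Q] by (auto simp: basic_at_def)
    show False using subsetD[OF sub I_mem[OF f(1) zero_closed]] f(2) fc[OF f(1)] assms(3) by simp
  qed
  ultimately have "\<one> \<in> ?I" by (rule proper_ideal_in_prime)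
  then obtain f r where "f x \<oplus> t \<otimes> r = \<one>" "f \<in> module_hom A P (regular_module A)" "r \<in> carrier A"
    by auto
  then show ?thesis by (intro bexI[of _ f] bexI[of _ r])
qed

text \<open>Three transvections suffice: \<open>\<tau>1\<close> makes the component in P basic at
  every prime over \<open>t\<close>, hence unimodular modulo \<open>t\<close>;
  \<open>\<tau>2\<close> then uses a functional to make the last coordinate 1 modulo
  \<open>t\<close>; \<open>\<tau>3\<close> uses this coordinate to clear the component in P modulo
  \<open>t\<close>.\<close>

lemma (in noetherian_cring) unimodular_reduction:
  assumes P: "module A P" "locally_free A P n" and t: "t \<in> carrier A"
    and chain: "\<And>c k. prime_chain {t} c k \<Longrightarrow> k < n"
    and u: "unimodular A (direct_sum P (free_module A 1)) u"
  shows "\<exists>\<sigma>\<in>module_iso A (direct_sum P (free_module A 1)) (direct_sum P (free_module A 1)).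
    \<exists>p\<in>carrier P. \<exists>b\<in>carrier A. \<sigma> u = (t \<odot>\<^bsub>P\<^esub> p, scalar (\<one> \<oplus> t \<otimes> b))"
proof -
  interpret P: module A P by fact
  let ?N = "direct_sum P (free_module A 1)"
  interpret N: module A ?N
    by (rule module_direct_sum[OF P(1) module_free_module[OF is_cring]])
  obtain F where F: "F \<in> module_hom A ?N (regular_module A)" "F u = \<one>" and uc: "u \<in> carrier ?N"
    using u by (auto simp: unimodular_def)
  obtain p a where p: "p \<in> carrier P" and a: "a \<in> carrier A" and ueq: "u = (p, scalar a)"
    using uc by (rule direct_sum_scalar_cases)
  have J: "ideal (PIdl t) A" "t \<in> PIdl t"
    using t by (simp_all add: cgenideal_ideal cgenideal_self)
  have J_sub: "PIdl t \<subseteq> Q" if "primeideal Q A" "t \<in> Q" for Q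
    using that by (simp add: cgenideal_minimal primeideal.axioms(1))
  have "k < n" if "prime_chain (PIdl t) c k" for c k
    using chain[of c k] that J(2) by (auto simp: prime_chain_def)
  \<comment> \<open>Were \<open>a\<close> and every functional value at \<open>p\<close> in
    \<open>Q\<close>, the value \<open>F u\<close> = 1 would lie in \<open>Q\<close> as
    well.\<close>
  moreover have "a \<notin> Q \<or> basic_at A P Q p" if Q: "primeideal Q A" for Q
  proof (rule ccontr)
    interpret Q: primeideal Q A by fact
    let ?f = "\<lambda>x. F (x, scalar \<zero>)"
    have inj: "(\<lambda>x. (x, scalar \<zero>)) \<in> module_hom A P ?N"
      by (rule module_homI) (simp_all del: One_nat_def free_module_simps)
    have f: "?f \<in> module_hom A P (regular_module A)"
      by (rule module_hom_comp[OF inj F(1)])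
    assume "\<not> (a \<notin> Q \<or> basic_at A P Q p)"
    then have *: "a \<in> Q" "?f p \<in> Q" using f by (auto simp: basic_at_def)
    have e: "(\<zero>\<^bsub>P\<^esub>, scalar \<one>) \<in> carrier ?N" "(p, scalar \<zero>) \<in> carrier ?N"
      using p by (simp_all del: One_nat_def free_module_simps)
    have "u = (p, scalar \<zero>) \<oplus>\<^bsub>?N\<^esub> a \<odot>\<^bsub>?N\<^esub> (\<zero>\<^bsub>P\<^esub>, scalar \<one>)"
      using p a by (simp del: One_nat_def free_module_simps add: ueq)
    then have "F u = ?f p \<oplus> a \<otimes> F (\<zero>\<^bsub>P\<^esub>, scalar \<one>)"
      using module_hom_add[OF F(1) e(2) N.smult_closed[OF a e(1)]] module_hom_smult[OF F(1) a e(1)]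
      by simp
    also have "\<dots> \<in> Q"
      using * module_hom_closed[OF F(1) e(1)] by (intro Q.a_closed Q.I_r_closed) auto
    finally show False using F(2) primeideal_one_notin[OF Q] by simp
  qed
  ultimately obtain q where q: "q \<in> carrier P"
    "\<And>Q. primeideal Q A \<Longrightarrow> PIdl t \<subseteq> Q \<Longrightarrow> basic_at A P Q (p \<oplus>\<^bsub>P\<^esub> a \<odot>\<^bsub>P\<^esub> q)"
    using exists_basic_translate[OF P a p J(1)] by meson
  define p1 where "p1 = p \<oplus>\<^bsub>P\<^esub> a \<odot>\<^bsub>P\<^esub> q"
  have p1: "p1 \<in> carrier P" using p a q(1) by (simp add: p1_def)
  have "basic_at A P Q p1" if "primeideal Q A" "t \<in> Q" for Q
    using q(2)[OF that(1) J_sub[OF that]] by (simp add: p1_def)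
  then obtain f r where f: "f \<in> module_hom A P (regular_module A)" and r: "r \<in> carrier A"
    and fr: "f p1 \<oplus> t \<otimes> r = \<one>"
    using unimodular_order_ideal[OF P(1) p1 t] by blast
  have fc: "f p1 \<in> carrier A" using module_hom_closed[OF f p1] by simp
  \<comment> \<open>The factor 1 - a is the defect of the last coordinate: \<open>f p1\<close> is 1
    modulo \<open>t\<close>, so adding \<open>g p1\<close> to \<open>a\<close> gives 1 modulo
    \<open>t\<close>.\<close>
  define g where "g = (\<lambda>x. (\<one> \<ominus> a) \<otimes> f x)"
  have g: "g \<in> module_hom A P (regular_module A)"
    using module_hom_scale[OF f module_regular[OF is_cring], of "\<one> \<ominus> a"] a by (simp add: g_def)
  define b where "b = \<ominus> ((\<one> \<ominus> a) \<otimes> r)"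
  have b: "b \<in> carrier A" using a r by (simp add: b_def)
  have "f p1 = \<one> \<ominus> t \<otimes> r"
    using fr fc t r by (metis a_minus_def add.inv_solve_right m_closed one_closed)
  then have a1: "a \<oplus> g p1 = \<one> \<oplus> t \<otimes> b"
    using a t r by (simp add: g_def b_def) algebra
  define \<tau>1 where "\<tau>1 = (\<lambda>(p, z :: nat \<Rightarrow> 'a). (p \<oplus>\<^bsub>P\<^esub> z 0 \<odot>\<^bsub>P\<^esub> q, z))"
  define \<tau>2 where "\<tau>2 = (\<lambda>(p, z :: nat \<Rightarrow> 'a). (p, scalar (z 0 \<oplus> g p)))"
  define \<tau>3 where "\<tau>3 = (\<lambda>(p, z :: nat \<Rightarrow> 'a). (p \<oplus>\<^bsub>P\<^esub> z 0 \<odot>\<^bsub>P\<^esub> (\<ominus>\<^bsub>P\<^esub> p1), z))"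
  have iso: "(\<lambda>x. \<tau>3 (\<tau>2 (\<tau>1 x))) \<in> module_iso A ?N ?N"
    unfolding \<tau>1_def \<tau>2_def \<tau>3_def
    by (rule module_iso_comp[OF module_iso_comp[OF transvection_vector[OF P(1) q(1)]
      transvection_functional[OF P(1) g]] transvection_vector[OF P(1) P.M.a_inv_closed[OF p1]]])
  have "\<tau>3 (\<tau>2 (\<tau>1 u)) = (p1 \<oplus>\<^bsub>P\<^esub> (\<one> \<oplus> t \<otimes> b) \<odot>\<^bsub>P\<^esub> (\<ominus>\<^bsub>P\<^esub> p1), scalar (\<one> \<oplus> t \<otimes> b))"
    by (simp add: ueq \<tau>1_def \<tau>2_def \<tau>3_def p1_def[symmetric] a1)
  also have "p1 \<oplus>\<^bsub>P\<^esub> (\<one> \<oplus> t \<otimes> b) \<odot>\<^bsub>P\<^esub> (\<ominus>\<^bsub>P\<^esub> p1) = t \<odot>\<^bsub>P\<^esub> (b \<odot>\<^bsub>P\<^esub> (\<ominus>\<^bsub>P\<^esub> p1))"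
    using p1 t b by (simp add: P.smult_l_distr P.smult_assoc1 P.M.r_neg1 P.M.a_assoc[symmetric] P.M.r_neg)
  finally have "\<tau>3 (\<tau>2 (\<tau>1 u)) = (t \<odot>\<^bsub>P\<^esub> (b \<odot>\<^bsub>P\<^esub> (\<ominus>\<^bsub>P\<^esub> p1)), scalar (\<one> \<oplus> t \<otimes> b))" .
  moreover have "b \<odot>\<^bsub>P\<^esub> (\<ominus>\<^bsub>P\<^esub> p1) \<in> carrier P" using b p1 by simp
  ultimately show ?thesis
    using iso b
    by (intro bexI[of _ "\<lambda>x. \<tau>3 (\<tau>2 (\<tau>1 x))"] bexI[of _ "b \<odot>\<^bsub>P\<^esub> (\<ominus>\<^bsub>P\<^esub> p1)"] bexI[of _ b])
qed

section \<open>Local freeness from the rank\<close>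

lemma free_module_hom_eqI:
  assumes "cring R" "module R N" "f \<in> module_hom R (free_module R n) N" "g \<in> module_hom R (free_module R n) N"
    and "\<And>i. i < n \<Longrightarrow> f (unit_vec R n i) = g (unit_vec R n i)"
    and "y \<in> carrier (free_module R n)"
  shows "f y = g y"
proof -
  interpret N: module R N by fact
  have "f y = (\<Oplus>\<^bsub>N\<^esub>i\<in>{..<n}. y i \<odot>\<^bsub>N\<^esub> f (unit_vec R n i))"
    by (rule free_module_hom_expansion[OF assms(1,2,3,6)])
  also have "\<dots> = (\<Oplus>\<^bsub>N\<^esub>i\<in>{..<n}. y i \<odot>\<^bsub>N\<^esub> g (unit_vec R n i))"
    using assms(5) free_module_coord[OF assms(6)] module_hom_closed[OF assms(4)]
      cring.unit_vec_carrier[OF assms(1)]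
    by (intro N.M.finsum_cong') auto
  also have "\<dots> = g y"
    by (rule free_module_hom_expansion[OF assms(1,2,4,6), symmetric])
  finally show ?thesis .
qed

lemma free_module_hom_exists:
  assumes "cring R" "module R N" "\<And>i. i < n \<Longrightarrow> w i \<in> carrier N"
  shows "\<exists>f\<in>module_hom R (free_module R n) N. \<forall>i<n. f (unit_vec R n i) = w i"
proof -
  interpret N: module R N by fact
  let ?f = "\<lambda>y. \<Oplus>\<^bsub>N\<^esub>i\<in>{..<n}. y i \<odot>\<^bsub>N\<^esub> w i"
  have c: "(\<lambda>i. y i \<odot>\<^bsub>N\<^esub> w i) \<in> {..<n} \<rightarrow> carrier N" if "y \<in> carrier (free_module R n)" for y
    using free_module_coord[OF that] assms(3) by auto
  have hom: "?f \<in> module_hom R (free_module R n) N"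
  proof (rule module_homI)
    fix x assume x: "x \<in> carrier (free_module R n)"
    show "?f x \<in> carrier N" using c[OF x] by (rule N.M.finsum_closed)
    fix y assume y: "y \<in> carrier (free_module R n)"
    have "?f (x \<oplus>\<^bsub>free_module R n\<^esub> y) = (\<Oplus>\<^bsub>N\<^esub>i\<in>{..<n}. x i \<odot>\<^bsub>N\<^esub> w i \<oplus>\<^bsub>N\<^esub> y i \<odot>\<^bsub>N\<^esub> w i)"
      using free_module_coord[OF x] free_module_coord[OF y] assms(3)
      by (intro N.M.finsum_cong') (auto simp: N.smult_l_distr)
    also have "\<dots> = ?f x \<oplus>\<^bsub>N\<^esub> ?f y"
      using c[OF x] c[OF y] by (rule N.M.finsum_addf)
    finally show "?f (x \<oplus>\<^bsub>free_module R n\<^esub> y) = ?f x \<oplus>\<^bsub>N\<^esub> ?f y" .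
  next
    fix a x assume a: "a \<in> carrier R" and x: "x \<in> carrier (free_module R n)"
    have "a \<odot>\<^bsub>N\<^esub> ?f x = (\<Oplus>\<^bsub>N\<^esub>i\<in>{..<n}. a \<odot>\<^bsub>N\<^esub> (x i \<odot>\<^bsub>N\<^esub> w i))"
      using c[OF x] a by (intro N.finsum_smult_ldistr) auto
    also have "\<dots> = ?f (a \<odot>\<^bsub>free_module R n\<^esub> x)"
      using free_module_coord[OF x] a assms(3)
      by (intro N.M.finsum_cong') (auto simp: N.smult_assoc1)
    finally show "?f (a \<odot>\<^bsub>free_module R n\<^esub> x) = a \<odot>\<^bsub>N\<^esub> ?f x" by simp
  qed
  have "?f (unit_vec R n k) = w k" if k: "k < n" for k
  proof -
    have "?f (unit_vec R n k) = (\<Oplus>\<^bsub>N\<^esub>i\<in>{..<n}. if k = i then w i else \<zero>\<^bsub>N\<^esub>)"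
      using assms(3) by (intro N.M.finsum_cong') (auto simp: unit_vec_def)
    also have "\<dots> = w k"
      using N.M.finsum_singleton[of k "{..<n}" w] k assms(3) by (simp add: Pi_iff)
    finally show ?thesis .
  qed
  then show ?thesis by (intro bexI[OF _ hom] allI impI)
qed

lemma fg_projective_retract:
  assumes "cring R" "fg_projective R P"
  obtains n \<alpha> \<beta> where "\<alpha> \<in> module_hom R P (free_module R n)" "\<beta> \<in> module_hom R (free_module R n) P"
    "\<And>x. x \<in> carrier P \<Longrightarrow> \<beta> (\<alpha> x) = x"
proof -
  obtain n and Q :: "('a, nat \<Rightarrow> 'a) module" where P: "module R P" and Q: "module R Q"
    and iso: "module_isomorphic R (direct_sum P Q) (free_module R n)"
    using assms(2) by (auto simp: fg_projective_def)
  interpret P: module R P by fact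
  interpret Q: module R Q by fact
  have D: "module R (direct_sum P Q)" using P Q by (rule module_direct_sum)
  obtain h where "h \<in> module_iso R (direct_sum P Q) (free_module R n)"
    using iso by (auto simp: module_isomorphic_altdef)
  then obtain g where h: "h \<in> module_hom R (direct_sum P Q) (free_module R n)"
    and g: "g \<in> module_hom R (free_module R n) (direct_sum P Q)"
    and gh: "\<And>x. x \<in> carrier (direct_sum P Q) \<Longrightarrow> g (h x) = x"
    and "\<And>y. y \<in> carrier (free_module R n) \<Longrightarrow> h (g y) = y"
    using D by (rule module_isoE) blast
  have inj: "(\<lambda>x. (x, \<zero>\<^bsub>Q\<^esub>)) \<in> module_hom R P (direct_sum P Q)"
    by (rule module_homI) simp_all
  have proj: "fst \<in> module_hom R (direct_sum P Q) P"
    by (rule module_homI) auto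
  show thesis
    using that[OF module_hom_comp[OF inj h] module_hom_comp[OF g proj]] gh by simp
qed

section \<open>Clearing denominators in a localization\<close>

context localization_data
begin

definition to_loc_ring :: "'r \<Rightarrow> ('r \<times> 'r) set"
  where "to_loc_ring a = fraction S (module_via id R) a \<one>\<^bsub>R\<^esub>"

definition to_loc_module :: "'m \<Rightarrow> ('m \<times> 'r) set"
  where "to_loc_module x = fraction S M x \<one>\<^bsub>R\<^esub>"

lemma to_loc_ring_hom: "to_loc_ring \<in> ring_hom R (localization_ring R S)"
  using S_one by (auto simp: ring_hom_def to_loc_ring_def localization_ring_simps) blast

lemma to_loc_ring_closed: "a \<in> carrier R \<Longrightarrow> to_loc_ring a \<in> carrier (localization_ring R S)"
  using ring_hom_closed[OF to_loc_ring_hom] .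

lemma to_loc_module_closed: "x \<in> carrier M \<Longrightarrow> to_loc_module x \<in> carrier (localization_module R S M)"
  using S_one by (auto simp: to_loc_module_def localization_module_simps)

lemma to_loc_module_add:
  "x \<in> carrier M \<Longrightarrow> y \<in> carrier M \<Longrightarrow> to_loc_module (x \<oplus>\<^bsub>M\<^esub> y) =
    to_loc_module x \<oplus>\<^bsub>localization_module R S M\<^esub> to_loc_module y"
  using S_one by (simp add: to_loc_module_def localization_module_simps)

lemma to_loc_module_smult:
  "a \<in> carrier R \<Longrightarrow> x \<in> carrier M \<Longrightarrow> to_loc_module (a \<odot>\<^bsub>M\<^esub> x) =
    to_loc_ring a \<odot>\<^bsub>localization_module R S M\<^esub> to_loc_module x"
  using S_one by (simp add: to_loc_module_def to_loc_ring_def localization_module_simps)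

lemma to_loc_module_eqD:
  "x \<in> carrier M \<Longrightarrow> y \<in> carrier M \<Longrightarrow> to_loc_module x = to_loc_module y \<Longrightarrow>
    \<exists>u\<in>S. u \<odot>\<^bsub>M\<^esub> x = u \<odot>\<^bsub>M\<^esub> y"
  using fraction_eq_iff[of x y "\<one>\<^bsub>R\<^esub>" "\<one>\<^bsub>R\<^esub>"] S_one by (simp add: to_loc_module_def)

lemma to_loc_ring_eqD:
  assumes "a \<in> carrier R" "b \<in> carrier R" "to_loc_ring a = to_loc_ring b"
  shows "\<exists>u\<in>S. u \<otimes>\<^bsub>R\<^esub> a = u \<otimes>\<^bsub>R\<^esub> b"
  using localization_data.fraction_eq_iff[OF ring_data, of a b "\<one>\<^bsub>R\<^esub>" "\<one>\<^bsub>R\<^esub>"] S_one assms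
  by (simp add: to_loc_ring_def)

lemma common_denominator:
  assumes "finite I" "\<And>i. i \<in> I \<Longrightarrow> U i \<in> carrier (localization_module R S M)"
  shows "\<exists>t\<in>S. \<forall>i\<in>I. \<exists>x\<in>carrier M. to_loc_ring t \<odot>\<^bsub>localization_module R S M\<^esub> U i = to_loc_module x"
  using assms
proof (induction I)
  case empty
  then show ?case using S_one by blast
next
  case (insert j I)
  interpret L: module "localization_ring R S" "localization_module R S M"
    by (rule module_localization_module)
  obtain t where t: "t \<in> S"
    "\<forall>i\<in>I. \<exists>x\<in>carrier M. to_loc_ring t \<odot>\<^bsub>localization_module R S M\<^esub> U i = to_loc_module x"
    using insert by auto
  obtain m s where U: "U j = fraction S M m s" and m: "m \<in> carrier M" and s: "s \<in> S"
    using insert.prems[of j] by (auto simp: localization_module_simps)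
  have "to_loc_ring s \<odot>\<^bsub>localization_module R S M\<^esub> U j = fraction S M (s \<odot>\<^bsub>M\<^esub> m) (\<one>\<^bsub>R\<^esub> \<otimes>\<^bsub>R\<^esub> s)"
    using m s S_one by (simp add: U to_loc_ring_def localization_module_simps(4))
  also have "\<dots> = to_loc_module m"
    unfolding to_loc_module_def using m s S_one by (intro fraction_eqI[where u = "\<one>\<^bsub>R\<^esub>"]) auto
  finally have sU: "to_loc_ring s \<odot>\<^bsub>localization_module R S M\<^esub> U j = to_loc_module m" .
  have st: "to_loc_ring (s \<otimes>\<^bsub>R\<^esub> t) = to_loc_ring s \<otimes>\<^bsub>localization_ring R S\<^esub> to_loc_ring t"
    "to_loc_ring (s \<otimes>\<^bsub>R\<^esub> t) = to_loc_ring t \<otimes>\<^bsub>localization_ring R S\<^esub> to_loc_ring s"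
    using s t(1) ring_hom_mult[OF to_loc_ring_hom, of s t] ring_hom_mult[OF to_loc_ring_hom, of t s]
      R.m_comm[of s t] by auto
  show ?case
  proof (intro bexI[of _ "s \<otimes>\<^bsub>R\<^esub> t"] ballI)
    fix i assume i: "i \<in> insert j I"
    note Ui = insert.prems[OF i]
    show "\<exists>x\<in>carrier M. to_loc_ring (s \<otimes>\<^bsub>R\<^esub> t) \<odot>\<^bsub>localization_module R S M\<^esub> U i = to_loc_module x"
    proof (cases "i = j")
      case True
      have "to_loc_ring (s \<otimes>\<^bsub>R\<^esub> t) \<odot>\<^bsub>localization_module R S M\<^esub> U i = to_loc_module (t \<odot>\<^bsub>M\<^esub> m)"
        using s t(1) m Ui sU True
        by (simp add: st(2) L.smult_assoc1 to_loc_ring_closed to_loc_module_smult)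
      then show ?thesis using m t(1) by (intro bexI[of _ "t \<odot>\<^bsub>M\<^esub> m"]) auto
    next
      case False
      then obtain x where x: "x \<in> carrier M"
        "to_loc_ring t \<odot>\<^bsub>localization_module R S M\<^esub> U i = to_loc_module x"
        using t(2) i by blast
      have "to_loc_ring (s \<otimes>\<^bsub>R\<^esub> t) \<odot>\<^bsub>localization_module R S M\<^esub> U i = to_loc_module (s \<odot>\<^bsub>M\<^esub> x)"
        using s t(1) x Ui by (simp add: st(1) L.smult_assoc1 to_loc_ring_closed to_loc_module_smult)
      then show ?thesis using x(1) s by (intro bexI[of _ "s \<odot>\<^bsub>M\<^esub> x"]) auto
    qed
  qed (use s t(1) S_mult in auto)
qed

text \<open>\<open>S\<close> is closed under products, so the product of the finitely many witnesses
  serves all indices as soon as each property survives multiplication by \<open>S\<close>.\<close>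

lemma common_multiplier:
  assumes "finite I" "\<And>i. i \<in> I \<Longrightarrow> \<exists>u\<in>S. Pr i u"
    and "\<And>i u v. i \<in> I \<Longrightarrow> u \<in> S \<Longrightarrow> v \<in> S \<Longrightarrow> Pr i u \<Longrightarrow> Pr i (v \<otimes>\<^bsub>R\<^esub> u)"
  shows "\<exists>u\<in>S. \<forall>i\<in>I. Pr i u"
  using assms
proof (induction I)
  case empty
  then show ?case using S_one by blast
next
  case (insert j I)
  obtain u where u: "u \<in> S" "\<forall>i\<in>I. Pr i u" using insert.IH insert.prems by blast
  obtain v where v: "v \<in> S" "Pr j v" using insert.prems(1)[of j] by blast
  have "Pr i (v \<otimes>\<^bsub>R\<^esub> u)" if "i \<in> insert j I" for i
  proof (cases "i = j")
    case True
    then show ?thesis using insert.prems(2)[of j v u] u(1) v R.m_comm[of u v] by simp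
  next
    case False
    then show ?thesis using insert.prems(2)[of i u v] u v(1) that by blast
  qed
  then show ?case using u(1) v(1) S_mult by blast
qed

lemma to_loc_module_regular: "localization_data.to_loc_module R (module_via id R) S = to_loc_ring"
  by (simp add: fun_eq_iff to_loc_ring_def localization_data.to_loc_module_def[OF ring_data])

text \<open>Equality up to a factor from \<open>S\<close> can be tested on the basis, and finiteness
  of the basis makes a single factor enough for all vectors.\<close>

lemma eventually_equal_homs:
  assumes N: "module R N" and f: "f \<in> module_hom R (free_module R n) N" and g: "g \<in> module_hom R (free_module R n) N"
    and eq: "\<And>i. i < n \<Longrightarrow> \<exists>u\<in>S. u \<odot>\<^bsub>N\<^esub> f (unit_vec R n i) = u \<odot>\<^bsub>N\<^esub> g (unit_vec R n i)"
  shows "\<exists>u\<in>S. \<forall>y\<in>carrier (free_module R n). u \<odot>\<^bsub>N\<^esub> f y = u \<odot>\<^bsub>N\<^esub> g y"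
proof -
  interpret N: module R N by fact
  have e: "unit_vec R n i \<in> carrier (free_module R n)" for i using R.unit_vec_carrier by simp
  have "\<exists>u\<in>S. \<forall>i\<in>{..<n}. u \<odot>\<^bsub>N\<^esub> f (unit_vec R n i) = u \<odot>\<^bsub>N\<^esub> g (unit_vec R n i)"
    by (rule common_multiplier)
      (use eq in \<open>simp_all add: N.smult_assoc1 module_hom_closed[OF f e] module_hom_closed[OF g e]\<close>)
  then obtain u where u: "u \<in> S" "\<And>i. i < n \<Longrightarrow> u \<odot>\<^bsub>N\<^esub> f (unit_vec R n i) = u \<odot>\<^bsub>N\<^esub> g (unit_vec R n i)"
    by auto
  have "u \<odot>\<^bsub>N\<^esub> f y = u \<odot>\<^bsub>N\<^esub> g y" if "y \<in> carrier (free_module R n)" for y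
    by (rule free_module_hom_eqI[OF R.is_cring N module_hom_scale[OF f N S_carrier[OF u(1)]]
      module_hom_scale[OF g N S_carrier[OF u(1)]] u(2) that])
  then show ?thesis using u(1) by blast
qed

lemma carrier_localization_regular:
  "carrier (localization_module R S (module_via id R)) = carrier (localization_ring R S)"
  by (simp add: localization_ring_simps localization_data.localization_module_simps[OF ring_data])

lemma localization_regular_smult:
  assumes "U \<in> carrier (localization_ring R S)" "V \<in> carrier (localization_ring R S)"
  shows "U \<odot>\<^bsub>localization_module R S (module_via id R)\<^esub> V = U \<otimes>\<^bsub>localization_ring R S\<^esub> V"
proof -
  interpret L: localization_data R "module_via id R" S by (rule ring_data)
  show ?thesis
    using assms by (auto simp: localization_ring_simps L.localization_module_simps)
qed

text \<open>The inverse isomorphisms \<theta> and \<eta> of the localized modules are determined by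
  finitely many values, so clearing denominators produces maps \<Psi> and \<Phi> over
  \<open>R\<close>. Their composites agree with multiplication by \<open>r\<close> only after
  localization; a further factor \<open>u\<close> from \<open>S\<close> makes the agreement exact.
  The retraction \<beta> supplies the finite generation of M on which this rests.\<close>

lemma trivialization_from_localization:
  assumes \<alpha>: "\<alpha> \<in> module_hom R M (free_module R n)" and \<beta>: "\<beta> \<in> module_hom R (free_module R n) M"
    and \<beta>\<alpha>: "\<And>x. x \<in> carrier M \<Longrightarrow> \<beta> (\<alpha> x) = x"
    and iso: "module_isomorphic (localization_ring R S) (localization_module R S M)
      (free_module (localization_ring R S) d)"
  shows "\<exists>s \<Phi> \<Psi>. s \<in> S \<and> trivialization R M d s \<Phi> \<Psi>"
proof -
  let ?L = "localization_ring R S" and ?N = "localization_module R S M"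
  let ?F = "free_module ?L d" and ?V = "module_via to_loc_ring ?L"
  let ?A = "free_module R n" and ?B = "free_module R d"
  let ?e = "unit_vec R n" and ?f = "unit_vec R d" and ?g = "unit_vec ?L d"
  interpret N: module ?L ?N by (rule module_localization_module)
  interpret rl: localization_data R "module_via id R" S by (rule ring_data)
  have cr: "cring R" and mM: "module R M" by (rule R.is_cring) (rule module_axioms)
  have V: "module R ?V" by (rule module_module_via[OF cr cring_localization_ring to_loc_ring_hom])
  have fR: "module R (free_module R k)" for k by (rule module_free_module) (rule cr)
  obtain \<theta> where "\<theta> \<in> module_iso ?L ?N ?F" using iso by (auto simp: module_isomorphic_altdef)
  then obtain \<eta> where \<theta>: "\<theta> \<in> module_hom ?L ?N ?F" and \<eta>: "\<eta> \<in> module_hom ?L ?F ?N"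
    and \<eta>\<theta>: "\<And>x. x \<in> carrier ?N \<Longrightarrow> \<eta> (\<theta> x) = x" and \<theta>\<eta>: "\<And>y. y \<in> carrier ?F \<Longrightarrow> \<theta> (\<eta> y) = y"
    by (rule module_isoE[OF _ N.module_axioms]) blast
  have uR: "unit_vec R k i \<in> carrier (free_module R k)" for k i
    using R.unit_vec_carrier by simp
  have uL: "?g i \<in> carrier ?F" for i
    using cring.unit_vec_carrier[OF cring_localization_ring] by simp
  \<comment> \<open>Coordinates of \<theta> on the image of M, regarded as \<open>R\<close>-linear
    maps into the localized ring; jointly they separate elements of M up to a factor from
    \<open>S\<close>.\<close>
  define \<kappa> where "\<kappa> j x = \<theta> (to_loc_module x) j" for j x
  have \<kappa>: "\<kappa> j \<in> module_hom R M ?V" if j: "j < d" for j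
  proof (rule module_homI)
    fix x assume x: "x \<in> carrier M"
    have tx: "to_loc_module x \<in> carrier ?N" using x by (rule to_loc_module_closed)
    show "\<kappa> j x \<in> carrier ?V"
      using free_module_coord[OF module_hom_closed[OF \<theta> tx] j] by (simp add: \<kappa>_def)
    show "\<kappa> j (x \<oplus>\<^bsub>M\<^esub> y) = \<kappa> j x \<oplus>\<^bsub>?V\<^esub> \<kappa> j y" if y: "y \<in> carrier M" for y
      using module_hom_add[OF \<theta> tx to_loc_module_closed[OF y]] j
      by (simp add: \<kappa>_def to_loc_module_add[OF x y])
    show "\<kappa> j (a \<odot>\<^bsub>M\<^esub> x) = a \<odot>\<^bsub>?V\<^esub> \<kappa> j x" if a: "a \<in> carrier R" for a
      using module_hom_smult[OF \<theta> to_loc_ring_closed[OF a] tx] j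
      by (simp add: \<kappa>_def to_loc_module_smult[OF a x])
  qed
  have \<kappa>_inj: "\<exists>u\<in>S. u \<odot>\<^bsub>M\<^esub> x = u \<odot>\<^bsub>M\<^esub> y"
    if xy: "x \<in> carrier M" "y \<in> carrier M" "\<And>j. j < d \<Longrightarrow> \<kappa> j x = \<kappa> j y" for x y
  proof -
    have c: "to_loc_module x \<in> carrier ?N" "to_loc_module y \<in> carrier ?N"
      using xy by (simp_all add: to_loc_module_closed)
    have "\<theta> (to_loc_module x) = \<theta> (to_loc_module y)"
      using xy(3) module_hom_closed[OF \<theta> c(1)] module_hom_closed[OF \<theta> c(2)]
      by (intro free_module_eqI[of _ ?L d]) (simp_all add: \<kappa>_def)
    then have "to_loc_module x = to_loc_module y"
      by (rule trans[OF \<eta>\<theta>[OF c(1), symmetric] trans[OF arg_cong[of _ _ \<eta>] \<eta>\<theta>[OF c(2)]]])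
    then show ?thesis by (rule to_loc_module_eqD[OF xy(1,2)])
  qed
  let ?U = "\<lambda>i. \<kappa> (snd i) (\<beta> (?e (fst i)))"
  have U: "?U i \<in> carrier (localization_module R S (module_via id R))" if "i \<in> {..<n} \<times> {..<d}" for i
    using module_hom_closed[OF \<kappa> module_hom_closed[OF \<beta> uR], of "snd i" "fst i"] that
    by (simp add: carrier_localization_regular mem_Times_iff)
  have "\<exists>t\<in>S. \<forall>i\<in>{..<n} \<times> {..<d}. \<exists>a\<in>carrier R.
      to_loc_ring t \<odot>\<^bsub>localization_module R S (module_via id R)\<^esub> ?U i = to_loc_ring a"
    by (rule rl.common_denominator[of "{..<n} \<times> {..<d}" ?U, unfolded to_loc_module_regular module_via_simps(1),
      OF finite_cartesian_product[OF finite_lessThan finite_lessThan] U])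
  then obtain t where t: "t \<in> S" and t2: "\<forall>i\<in>{..<n} \<times> {..<d}. \<exists>a\<in>carrier R.
      to_loc_ring t \<odot>\<^bsub>localization_module R S (module_via id R)\<^esub> ?U i = to_loc_ring a"
    by (rule bexE)
  have "\<exists>a\<in>carrier R. to_loc_ring t \<otimes>\<^bsub>?L\<^esub> \<kappa> j (\<beta> (?e i)) = to_loc_ring a"
    if ij: "i < n" "j < d" for i j
  proof -
    have "\<kappa> j (\<beta> (?e i)) \<in> carrier ?L"
      using module_hom_closed[OF \<kappa>[OF ij(2)] module_hom_closed[OF \<beta> uR]] by simp
    then show ?thesis
      using bspec[OF t2, of "(i, j)"] ij
        localization_regular_smult[OF to_loc_ring_closed[OF S_carrier[OF t]]] by simp
  qed
  then obtain b where b: "\<And>i j. i < n \<Longrightarrow> j < d \<Longrightarrow> b i j \<in> carrier R"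
    "\<And>i j. i < n \<Longrightarrow> j < d \<Longrightarrow> to_loc_ring t \<otimes>\<^bsub>?L\<^esub> \<kappa> j (\<beta> (?e i)) = to_loc_ring (b i j)"
    by metis
  have "restrict (b i) {..<d} \<in> carrier ?B" if "i < n" for i
    using b(1)[OF that] by (rule restrict_free_module)
  then obtain B where B: "B \<in> module_hom R ?A ?B"
    "\<And>i. i < n \<Longrightarrow> B (?e i) = restrict (b i) {..<d}"
    using free_module_hom_exists[OF cr fR, of n "\<lambda>i. restrict (b i) {..<d}"] by blast
  \<comment> \<open>The cleared entries \<open>b i j\<close> need not respect the relations between
    the generators of M, so the matrix is applied to \<open>\<alpha> x\<close>, a lift of
    \<open>x\<close> to the free module that depends linearly on \<open>x\<close>.\<close>
  define \<Psi> where "\<Psi> x = B (\<alpha> x)" for x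
  have \<Psi>: "\<Psi> \<in> module_hom R M ?B"
    unfolding \<Psi>_def by (rule module_hom_comp[OF \<alpha> B(1)])
  have loc_hom: "to_loc_ring \<in> module_hom R (regular_module R) ?V"
    using ring_hom_memE[OF to_loc_ring_hom] by (intro module_homI) auto
  have \<Psi>\<kappa>: "to_loc_ring (\<Psi> x j) = to_loc_ring t \<otimes>\<^bsub>?L\<^esub> \<kappa> j x" if x: "x \<in> carrier M" and j: "j < d" for x j
  proof -
    have l: "(\<lambda>y. to_loc_ring (B y j)) \<in> module_hom R ?A ?V"
      by (rule module_hom_comp[OF module_hom_comp[OF B(1) coordinate_hom[OF j]] loc_hom])
    have r: "(\<lambda>y. t \<odot>\<^bsub>?V\<^esub> \<kappa> j (\<beta> y)) \<in> module_hom R ?A ?V"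
      by (rule module_hom_scale[OF module_hom_comp[OF \<beta> \<kappa>[OF j]] V S_carrier[OF t]])
    have "to_loc_ring (B (\<alpha> x) j) = t \<odot>\<^bsub>?V\<^esub> \<kappa> j (\<beta> (\<alpha> x))"
      using b(2) j B(2) by (intro free_module_hom_eqI[OF cr V l r _ module_hom_closed[OF \<alpha> x]]) simp
    then show ?thesis by (simp add: \<Psi>_def \<beta>\<alpha>[OF x])
  qed
  have "\<exists>s\<in>S. \<forall>j\<in>{..<d}. \<exists>x\<in>carrier M. to_loc_ring s \<odot>\<^bsub>?N\<^esub> \<eta> (?g j) = to_loc_module x"
    using module_hom_closed[OF \<eta> uL] by (intro common_denominator) auto
  then obtain s where s: "s \<in> S" and
    "\<forall>j\<in>{..<d}. \<exists>x\<in>carrier M. to_loc_ring s \<odot>\<^bsub>?N\<^esub> \<eta> (?g j) = to_loc_module x"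
    by blast
  then obtain w where w: "\<And>i. i < d \<Longrightarrow> w i \<in> carrier M"
    "\<And>i. i < d \<Longrightarrow> to_loc_ring s \<odot>\<^bsub>?N\<^esub> \<eta> (?g i) = to_loc_module (w i)"
    by (metis lessThan_iff)
  obtain \<Phi> where \<Phi>: "\<Phi> \<in> module_hom R ?B M"
    "\<And>i. i < d \<Longrightarrow> \<Phi> (?f i) = w i"
    using free_module_hom_exists[OF cr mM, of d w] w(1) by blast
  have \<kappa>\<Phi>: "\<kappa> j (\<Phi> y) = to_loc_ring (s \<otimes>\<^bsub>R\<^esub> y j)" if y: "y \<in> carrier ?B" and j: "j < d" for y j
  proof -
    have l: "(\<lambda>y. \<kappa> j (\<Phi> y)) \<in> module_hom R ?B ?V"
      by (rule module_hom_comp[OF \<Phi>(1) \<kappa>[OF j]])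
    have r: "(\<lambda>y. to_loc_ring (s \<odot>\<^bsub>regular_module R\<^esub> y j)) \<in> module_hom R ?B ?V"
      by (rule module_hom_comp[OF module_hom_scale[OF coordinate_hom[OF j] module_regular[OF cr]
        S_carrier[OF s]] loc_hom])
    have "\<kappa> j (\<Phi> (?f i)) = to_loc_ring (s \<odot>\<^bsub>regular_module R\<^esub> ?f i j)" if i: "i < d" for i
    proof -
      have "\<kappa> j (\<Phi> (?f i)) = \<theta> (to_loc_ring s \<odot>\<^bsub>?N\<^esub> \<eta> (?g i)) j"
        using \<Phi>(2)[OF i] w(2)[OF i] by (simp add: \<kappa>_def)
      also have "\<dots> = to_loc_ring s \<otimes>\<^bsub>?L\<^esub> ?g i j"
        using module_hom_smult[OF \<theta> to_loc_ring_closed[OF S_carrier[OF s]] module_hom_closed[OF \<eta> uL]]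
          \<theta>\<eta>[OF uL] j by simp
      also have "?g i j = to_loc_ring (?f i j)"
        using j by (simp add: unit_vec_def to_loc_ring_def localization_ring_simps)
      also have "to_loc_ring s \<otimes>\<^bsub>?L\<^esub> to_loc_ring (?f i j) = to_loc_ring (s \<otimes>\<^bsub>R\<^esub> ?f i j)"
        using ring_hom_mult[OF to_loc_ring_hom S_carrier[OF s] free_module_coord[OF uR j]] by simp
      finally show ?thesis by simp
    qed
    then have "\<kappa> j (\<Phi> y) = to_loc_ring (s \<odot>\<^bsub>regular_module R\<^esub> y j)"
      by (rule free_module_hom_eqI[OF cr V l r _ y])
    then show ?thesis by simp
  qed
  define r where "r = t \<otimes>\<^bsub>R\<^esub> s"
  have r: "r \<in> S" "r \<in> carrier R" using s t S_mult by (simp_all add: r_def)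
  have sR: "s \<in> carrier R" "t \<in> carrier R" using s t by simp_all
  have 1: "\<exists>u\<in>S. u \<odot>\<^bsub>M\<^esub> \<Phi> (\<Psi> x) = u \<odot>\<^bsub>M\<^esub> (r \<odot>\<^bsub>M\<^esub> x)" if x: "x \<in> carrier M" for x
  proof (rule \<kappa>_inj)
    have \<Psi>x: "\<Psi> x \<in> carrier ?B" using module_hom_closed[OF \<Psi> x] .
    show "\<Phi> (\<Psi> x) \<in> carrier M" using module_hom_closed[OF \<Phi>(1) \<Psi>x] .
    show "r \<odot>\<^bsub>M\<^esub> x \<in> carrier M" using r(2) x by simp
    fix j assume j: "j < d"
    have \<kappa>c: "\<kappa> j x \<in> carrier ?L" using module_hom_closed[OF \<kappa>[OF j] x] by simp
    have "\<kappa> j (\<Phi> (\<Psi> x)) = to_loc_ring s \<otimes>\<^bsub>?L\<^esub> (to_loc_ring t \<otimes>\<^bsub>?L\<^esub> \<kappa> j x)"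
      using \<kappa>\<Phi>[OF \<Psi>x j] \<Psi>\<kappa>[OF x j] ring_hom_mult[OF to_loc_ring_hom sR(1) free_module_coord[OF \<Psi>x j]]
      by simp
    also have "\<dots> = to_loc_ring r \<otimes>\<^bsub>?L\<^esub> \<kappa> j x"
      using \<kappa>c sR to_loc_ring_closed ring_hom_mult[OF to_loc_ring_hom sR(2,1)]
      by (simp add: r_def N.R.m_assoc N.R.m_lcomm)
    also have "\<dots> = \<kappa> j (r \<odot>\<^bsub>M\<^esub> x)"
      using module_hom_smult[OF \<kappa>[OF j] r(2) x] by simp
    finally show "\<kappa> j (\<Phi> (\<Psi> x)) = \<kappa> j (r \<odot>\<^bsub>M\<^esub> x)" .
  qed
  have 2: "\<exists>u\<in>S. u \<otimes>\<^bsub>R\<^esub> \<Psi> (\<Phi> y) j = u \<otimes>\<^bsub>R\<^esub> (r \<otimes>\<^bsub>R\<^esub> y j)"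
    if y: "y \<in> carrier ?B" and j: "j < d" for y j
  proof (rule to_loc_ring_eqD)
    have yj: "y j \<in> carrier R" using free_module_coord[OF y j] .
    show "\<Psi> (\<Phi> y) j \<in> carrier R"
      by (rule free_module_coord[OF module_hom_closed[OF \<Psi> module_hom_closed[OF \<Phi>(1) y]] j])
    show "r \<otimes>\<^bsub>R\<^esub> y j \<in> carrier R" using r(2) yj by simp
    have "to_loc_ring (\<Psi> (\<Phi> y) j) = to_loc_ring t \<otimes>\<^bsub>?L\<^esub> to_loc_ring (s \<otimes>\<^bsub>R\<^esub> y j)"
      using \<Psi>\<kappa>[OF module_hom_closed[OF \<Phi>(1) y] j] \<kappa>\<Phi>[OF y j] by simp
    also have "\<dots> = to_loc_ring (r \<otimes>\<^bsub>R\<^esub> y j)"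
      using ring_hom_mult[OF to_loc_ring_hom sR(2), of "s \<otimes>\<^bsub>R\<^esub> y j"] sR yj by (simp add: r_def R.m_assoc)
    finally show "to_loc_ring (\<Psi> (\<Phi> y) j) = to_loc_ring (r \<otimes>\<^bsub>R\<^esub> y j)" .
  qed
  \<comment> \<open>Fact \<open>1\<close> gives a factor for each \<open>x\<close> separately;
    testing on the images under \<beta> of the basis makes it uniform.\<close>
  have "\<exists>u\<in>S. \<forall>y\<in>carrier ?A. u \<odot>\<^bsub>M\<^esub> \<Phi> (\<Psi> (\<beta> y)) = u \<odot>\<^bsub>M\<^esub> (r \<odot>\<^bsub>M\<^esub> \<beta> y)"
    by (rule eventually_equal_homs[OF mM module_hom_comp[OF module_hom_comp[OF \<beta> \<Psi>] \<Phi>(1)]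
      module_hom_scale[OF \<beta> mM r(2)] 1[OF module_hom_closed[OF \<beta> uR]]])
  then obtain u1 where u1: "u1 \<in> S"
    "\<forall>y\<in>carrier ?A. u1 \<odot>\<^bsub>M\<^esub> \<Phi> (\<Psi> (\<beta> y)) = u1 \<odot>\<^bsub>M\<^esub> (r \<odot>\<^bsub>M\<^esub> \<beta> y)"
    by blast
  have idh: "(\<lambda>y. y) \<in> module_hom R ?B ?B" by (rule module_homI) auto
  have 3: "\<exists>u\<in>S. u \<odot>\<^bsub>?B\<^esub> \<Psi> (\<Phi> y) = u \<odot>\<^bsub>?B\<^esub> (r \<odot>\<^bsub>?B\<^esub> y)" if y: "y \<in> carrier ?B" for y
  proof -
    note c = free_module_coord[OF module_hom_closed[OF \<Psi> module_hom_closed[OF \<Phi>(1) y]]] free_module_coord[OF y]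
    have "\<exists>u\<in>S. \<forall>j\<in>{..<d}. u \<otimes>\<^bsub>R\<^esub> \<Psi> (\<Phi> y) j = u \<otimes>\<^bsub>R\<^esub> (r \<otimes>\<^bsub>R\<^esub> y j)"
      by (rule common_multiplier) (use 2[OF y] c r(2) in \<open>simp_all add: R.m_assoc\<close>)
    then show ?thesis by (auto simp: fun_eq_iff)
  qed
  have "\<exists>u\<in>S. \<forall>y\<in>carrier ?B. u \<odot>\<^bsub>?B\<^esub> \<Psi> (\<Phi> y) = u \<odot>\<^bsub>?B\<^esub> (r \<odot>\<^bsub>?B\<^esub> y)"
    by (rule eventually_equal_homs[OF fR module_hom_comp[OF \<Phi>(1) \<Psi>] module_hom_scale[OF idh fR r(2)] 3[OF uR]])
  then obtain u2 where u2: "u2 \<in> S" "\<forall>y\<in>carrier ?B. u2 \<odot>\<^bsub>?B\<^esub> \<Psi> (\<Phi> y) = u2 \<odot>\<^bsub>?B\<^esub> (r \<odot>\<^bsub>?B\<^esub> y)"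
    by blast
  define u where "u = u1 \<otimes>\<^bsub>R\<^esub> u2"
  have u: "u \<in> S" "u \<in> carrier R" "u1 \<in> carrier R" "u2 \<in> carrier R"
    using u1(1) u2(1) S_mult by (simp_all add: u_def)
  have \<Phi>\<Psi>: "u \<odot>\<^bsub>M\<^esub> \<Phi> (\<Psi> x) = (u \<otimes>\<^bsub>R\<^esub> r) \<odot>\<^bsub>M\<^esub> x" if x: "x \<in> carrier M" for x
  proof -
    have "u1 \<odot>\<^bsub>M\<^esub> \<Phi> (\<Psi> x) = u1 \<odot>\<^bsub>M\<^esub> (r \<odot>\<^bsub>M\<^esub> x)"
      using u1(2)[rule_format, OF module_hom_closed[OF \<alpha> x]] by (simp add: \<beta>\<alpha>[OF x])
    then have "u2 \<odot>\<^bsub>M\<^esub> (u1 \<odot>\<^bsub>M\<^esub> \<Phi> (\<Psi> x)) = u2 \<odot>\<^bsub>M\<^esub> (u1 \<odot>\<^bsub>M\<^esub> (r \<odot>\<^bsub>M\<^esub> x))" by simp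
    then show ?thesis
      using module_hom_closed[OF \<Phi>(1) module_hom_closed[OF \<Psi> x]] x u r(2)
      by (simp add: u_def smult_assoc1[symmetric] R.m_ac)
  qed
  have \<Psi>\<Phi>: "u \<odot>\<^bsub>?B\<^esub> \<Psi> (\<Phi> y) = (u \<otimes>\<^bsub>R\<^esub> r) \<odot>\<^bsub>?B\<^esub> y" if y: "y \<in> carrier ?B" for y
  proof -
    interpret B: module R ?B by (rule fR)
    have "u1 \<odot>\<^bsub>?B\<^esub> (u2 \<odot>\<^bsub>?B\<^esub> \<Psi> (\<Phi> y)) = u1 \<odot>\<^bsub>?B\<^esub> (u2 \<odot>\<^bsub>?B\<^esub> (r \<odot>\<^bsub>?B\<^esub> y))"
      using u2(2) y by simp
    then show ?thesis
      using module_hom_closed[OF \<Psi> module_hom_closed[OF \<Phi>(1) y]] y u r(2)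
      by (simp add: u_def B.smult_assoc1[symmetric] R.m_assoc del: free_module_simps)
  qed
  \<comment> \<open>The factor \<open>u\<close> goes into \<Psi> alone, so that both composites
    become multiplication by u r.\<close>
  have "trivialization R M d (u \<otimes>\<^bsub>R\<^esub> r) \<Phi> (\<lambda>x. u \<odot>\<^bsub>?B\<^esub> \<Psi> x)"
    unfolding trivialization_def
  proof (intro conjI ballI)
    show "(\<lambda>x. u \<odot>\<^bsub>?B\<^esub> \<Psi> x) \<in> module_hom R M ?B"
      by (rule module_hom_scale[OF \<Psi> fR u(2)])
    show "\<Phi> (u \<odot>\<^bsub>?B\<^esub> \<Psi> x) = (u \<otimes>\<^bsub>R\<^esub> r) \<odot>\<^bsub>M\<^esub> x" if x: "x \<in> carrier M" for x
      using \<Phi>\<Psi>[OF x] module_hom_smult[OF \<Phi>(1) u(2) module_hom_closed[OF \<Psi> x]] by simp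
  qed (use u(2) r(2) \<Phi>(1) \<Psi>\<Phi> in auto)
  then show ?thesis using u(1) r(1) S_mult by blast
qed

end

lemma locally_free_if_has_rank:
  assumes "cring R" "fg_projective R P" "has_rank R P d"
  shows "locally_free R P d"
  unfolding locally_free_def
proof (intro allI impI)
  fix Q assume Q: "primeideal Q R"
  have P: "module R P" using assms(2) by (simp add: fg_projective_def)
  interpret localization_data R P "carrier R - Q"
    by (rule localization_data_prime[OF P Q])
  obtain n \<alpha> \<beta> where ab: "\<alpha> \<in> module_hom R P (free_module R n)" "\<beta> \<in> module_hom R (free_module R n) P"
    "\<And>x. x \<in> carrier P \<Longrightarrow> \<beta> (\<alpha> x) = x"
    by (rule fg_projective_retract[OF assms(1,2)]) blast
  have "module_isomorphic (localization_ring R (carrier R - Q))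
      (localization_module R (carrier R - Q) P) (free_module (localization_ring R (carrier R - Q)) d)"
    using assms(3) Q by (simp add: has_rank_def Let_def)
  then have "\<exists>s \<Phi> \<Psi>. s \<in> carrier R - Q \<and> trivialization R P d s \<Phi> \<Psi>"
    by (rule trivialization_from_localization[OF ab(1,2), rotated]) (rule ab(3))
  then obtain s \<Phi> \<Psi> where "s \<in> carrier R - Q" "trivialization R P d s \<Phi> \<Psi>"
    by (elim exE conjE)
  then show "\<exists>s \<Phi> \<Psi>. s \<notin> Q \<and> trivialization R P d s \<Phi> \<Psi>"
    by (intro exI conjI) auto
qed

section \<open>Generic freeness and cancellation of one summand\<close>

text \<open>Only one of the two maps is scaled, so the denominator gains the factor \<open>c\<close>
  just once.\<close>

lemma trivialization_scale:
  assumes "cring R" "module R P" "trivialization R P n s \<Phi> \<Psi>" "c \<in> carrier R"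
  shows "trivialization R P n (c \<otimes>\<^bsub>R\<^esub> s) \<Phi> (\<lambda>x. c \<odot>\<^bsub>free_module R n\<^esub> \<Psi> x)"
proof -
  interpret P: module R P by fact
  interpret F: module R "free_module R n" by (rule module_free_module) fact
  have s: "s \<in> carrier R" and \<Phi>: "\<Phi> \<in> module_hom R (free_module R n) P"
    and \<Psi>: "\<Psi> \<in> module_hom R P (free_module R n)"
    and 1: "\<And>x. x \<in> carrier P \<Longrightarrow> \<Phi> (\<Psi> x) = s \<odot>\<^bsub>P\<^esub> x"
    and 2: "\<And>y. y \<in> carrier (free_module R n) \<Longrightarrow> \<Psi> (\<Phi> y) = s \<odot>\<^bsub>free_module R n\<^esub> y"
    using assms(3) by (auto simp: trivialization_def)
  show ?thesis
    unfolding trivialization_def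
  proof (intro conjI ballI)
    show "(\<lambda>x. c \<odot>\<^bsub>free_module R n\<^esub> \<Psi> x) \<in> module_hom R P (free_module R n)"
      by (rule module_hom_scale[OF \<Psi> F.module_axioms assms(4)])
    show "\<Phi> (c \<odot>\<^bsub>free_module R n\<^esub> \<Psi> x) = (c \<otimes>\<^bsub>R\<^esub> s) \<odot>\<^bsub>P\<^esub> x" if x: "x \<in> carrier P" for x
      using module_hom_smult[OF \<Phi> assms(4) module_hom_closed[OF \<Psi> x]] 1[OF x]
        P.smult_assoc1[OF assms(4) s x] by simp
    show "c \<odot>\<^bsub>free_module R n\<^esub> \<Psi> (\<Phi> y) = (c \<otimes>\<^bsub>R\<^esub> s) \<odot>\<^bsub>free_module R n\<^esub> y"
      if y: "y \<in> carrier (free_module R n)" for y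
      unfolding 2[OF y] by (rule F.smult_assoc1[OF assms(4) s y, symmetric])
  qed (use s assms(4) \<Phi> in auto)
qed

text \<open>This is the shape of a composite of two weighted sums of maps; \<open>y\<close> and
  \<open>z\<close> stand for the cross terms, whose coefficients \<open>s \<otimes> t\<close> and
  \<open>t \<otimes> s\<close> vanish.\<close>

lemma (in module) orthogonal_combination:
  assumes "s \<in> carrier R" "t \<in> carrier R" "s \<otimes> t = \<zero>"
    and "x \<in> carrier M" "y \<in> carrier M" "z \<in> carrier M"
  shows "s \<odot>\<^bsub>M\<^esub> (s \<odot>\<^bsub>M\<^esub> (s \<odot>\<^bsub>M\<^esub> x) \<oplus>\<^bsub>M\<^esub> t \<odot>\<^bsub>M\<^esub> y) \<oplus>\<^bsub>M\<^esub>
      t \<odot>\<^bsub>M\<^esub> (s \<odot>\<^bsub>M\<^esub> z \<oplus>\<^bsub>M\<^esub> t \<odot>\<^bsub>M\<^esub> (t \<odot>\<^bsub>M\<^esub> x)) =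
    (s \<otimes> (s \<otimes> s) \<oplus> t \<otimes> (t \<otimes> t)) \<odot>\<^bsub>M\<^esub> x"
proof -
  have ts: "t \<otimes> s = \<zero>" using assms(1-3) by (simp add: R.m_comm)
  have "s \<odot>\<^bsub>M\<^esub> (s \<odot>\<^bsub>M\<^esub> (s \<odot>\<^bsub>M\<^esub> x) \<oplus>\<^bsub>M\<^esub> t \<odot>\<^bsub>M\<^esub> y) =
      (s \<otimes> (s \<otimes> s)) \<odot>\<^bsub>M\<^esub> x \<oplus>\<^bsub>M\<^esub> (s \<otimes> t) \<odot>\<^bsub>M\<^esub> y"
    using assms(1,2,4-) by (simp add: smult_r_distr smult_assoc1)
  moreover have "t \<odot>\<^bsub>M\<^esub> (s \<odot>\<^bsub>M\<^esub> z \<oplus>\<^bsub>M\<^esub> t \<odot>\<^bsub>M\<^esub> (t \<odot>\<^bsub>M\<^esub> x)) =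
      (t \<otimes> s) \<odot>\<^bsub>M\<^esub> z \<oplus>\<^bsub>M\<^esub> (t \<otimes> (t \<otimes> t)) \<odot>\<^bsub>M\<^esub> x"
    using assms(1,2,4-) by (simp add: smult_r_distr smult_assoc1)
  ultimately show ?thesis
    using assms(1,2,4-) by (simp add: assms(3) ts smult_l_distr)
qed

text \<open>Plain sums would leave cross terms such as \<open>\<Phi> (\<Psi>' x)\<close>. Weighting
  every map by its own denominator attaches \<open>s \<otimes> t\<close> to these, and turns the
  denominators on the diagonal into cubes.\<close>

lemma trivialization_combine:
  assumes "cring R" "module R P" "trivialization R P n s \<Phi> \<Psi>" "trivialization R P n t \<Phi>' \<Psi>'"
    and st: "s \<otimes>\<^bsub>R\<^esub> t = \<zero>\<^bsub>R\<^esub>"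
  shows "trivialization R P n (s \<otimes>\<^bsub>R\<^esub> (s \<otimes>\<^bsub>R\<^esub> s) \<oplus>\<^bsub>R\<^esub> t \<otimes>\<^bsub>R\<^esub> (t \<otimes>\<^bsub>R\<^esub> t))
    (\<lambda>y. s \<odot>\<^bsub>P\<^esub> \<Phi> y \<oplus>\<^bsub>P\<^esub> t \<odot>\<^bsub>P\<^esub> \<Phi>' y)
    (\<lambda>x. s \<odot>\<^bsub>free_module R n\<^esub> \<Psi> x \<oplus>\<^bsub>free_module R n\<^esub> t \<odot>\<^bsub>free_module R n\<^esub> \<Psi>' x)"
proof -
  let ?F = "free_module R n"
  interpret P: module R P by fact
  interpret F: module R ?F by (rule module_free_module) fact
  have s: "s \<in> carrier R" and \<Phi>: "\<Phi> \<in> module_hom R ?F P" and \<Psi>: "\<Psi> \<in> module_hom R P ?F"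
    and 1: "\<And>x. x \<in> carrier P \<Longrightarrow> \<Phi> (\<Psi> x) = s \<odot>\<^bsub>P\<^esub> x"
    and 2: "\<And>y. y \<in> carrier ?F \<Longrightarrow> \<Psi> (\<Phi> y) = s \<odot>\<^bsub>?F\<^esub> y"
    using assms(3) by (simp_all add: trivialization_def)
  have t: "t \<in> carrier R" and \<Phi>': "\<Phi>' \<in> module_hom R ?F P" and \<Psi>': "\<Psi>' \<in> module_hom R P ?F"
    and 3: "\<And>x. x \<in> carrier P \<Longrightarrow> \<Phi>' (\<Psi>' x) = t \<odot>\<^bsub>P\<^esub> x"
    and 4: "\<And>y. y \<in> carrier ?F \<Longrightarrow> \<Psi>' (\<Phi>' y) = t \<odot>\<^bsub>?F\<^esub> y"
    using assms(4) by (simp_all add: trivialization_def)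
  note [simp del] = free_module_simps
  show ?thesis
    unfolding trivialization_def
  proof (intro conjI ballI)
    show "(\<lambda>y. s \<odot>\<^bsub>P\<^esub> \<Phi> y \<oplus>\<^bsub>P\<^esub> t \<odot>\<^bsub>P\<^esub> \<Phi>' y) \<in> module_hom R ?F P"
      by (intro module_hom_plus module_hom_scale \<Phi> \<Phi>' s t P.module_axioms)
    show "(\<lambda>x. s \<odot>\<^bsub>?F\<^esub> \<Psi> x \<oplus>\<^bsub>?F\<^esub> t \<odot>\<^bsub>?F\<^esub> \<Psi>' x) \<in> module_hom R P ?F"
      by (intro module_hom_plus module_hom_scale \<Psi> \<Psi>' s t F.module_axioms)
  next
    fix x assume x: "x \<in> carrier P"
    note c = module_hom_closed[OF \<Psi> x] module_hom_closed[OF \<Psi>' x]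
    note c' = F.smult_closed[OF s c(1)] F.smult_closed[OF t c(2)]
    show "s \<odot>\<^bsub>P\<^esub> \<Phi> (s \<odot>\<^bsub>?F\<^esub> \<Psi> x \<oplus>\<^bsub>?F\<^esub> t \<odot>\<^bsub>?F\<^esub> \<Psi>' x) \<oplus>\<^bsub>P\<^esub> t \<odot>\<^bsub>P\<^esub> \<Phi>' (s \<odot>\<^bsub>?F\<^esub> \<Psi> x \<oplus>\<^bsub>?F\<^esub> t \<odot>\<^bsub>?F\<^esub> \<Psi>' x) =
      (s \<otimes>\<^bsub>R\<^esub> (s \<otimes>\<^bsub>R\<^esub> s) \<oplus>\<^bsub>R\<^esub> t \<otimes>\<^bsub>R\<^esub> (t \<otimes>\<^bsub>R\<^esub> t)) \<odot>\<^bsub>P\<^esub> x"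
      unfolding module_hom_add[OF \<Phi> c'] module_hom_add[OF \<Phi>' c'] module_hom_smult[OF \<Phi> s c(1)]
        module_hom_smult[OF \<Phi> t c(2)] module_hom_smult[OF \<Phi>' s c(1)] module_hom_smult[OF \<Phi>' t c(2)]
        1[OF x] 3[OF x]
      by (rule P.orthogonal_combination[OF s t st x module_hom_closed[OF \<Phi> c(2)] module_hom_closed[OF \<Phi>' c(1)]])
  next
    fix y assume y: "y \<in> carrier ?F"
    note c = module_hom_closed[OF \<Phi> y] module_hom_closed[OF \<Phi>' y]
    note c' = P.smult_closed[OF s c(1)] P.smult_closed[OF t c(2)]
    show "s \<odot>\<^bsub>?F\<^esub> \<Psi> (s \<odot>\<^bsub>P\<^esub> \<Phi> y \<oplus>\<^bsub>P\<^esub> t \<odot>\<^bsub>P\<^esub> \<Phi>' y) \<oplus>\<^bsub>?F\<^esub> t \<odot>\<^bsub>?F\<^esub> \<Psi>' (s \<odot>\<^bsub>P\<^esub> \<Phi> y \<oplus>\<^bsub>P\<^esub> t \<odot>\<^bsub>P\<^esub> \<Phi>' y) =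
      (s \<otimes>\<^bsub>R\<^esub> (s \<otimes>\<^bsub>R\<^esub> s) \<oplus>\<^bsub>R\<^esub> t \<otimes>\<^bsub>R\<^esub> (t \<otimes>\<^bsub>R\<^esub> t)) \<odot>\<^bsub>?F\<^esub> y"
      unfolding module_hom_add[OF \<Psi> c'] module_hom_add[OF \<Psi>' c'] module_hom_smult[OF \<Psi> s c(1)]
        module_hom_smult[OF \<Psi> t c(2)] module_hom_smult[OF \<Psi>' s c(1)] module_hom_smult[OF \<Psi>' t c(2)]
        2[OF y] 4[OF y]
      by (rule F.orthogonal_combination[OF s t st y module_hom_closed[OF \<Psi> c(2)] module_hom_closed[OF \<Psi>' c(1)]])
  qed (use s t in auto)
qed

text \<open>
  Trivializations at different minimal primes can be added once their denominators are scaled so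
  that the products of distinct ones vanish; a power of such a product is zero because it lies in
  every prime.
\<close>

lemma (in noetherian_cring) generic_trivialization:
  assumes P: "module A P" "locally_free A P n"
  shows "\<exists>s \<Phi> \<Psi>. trivialization A P n s \<Phi> \<Psi> \<and>
    (\<forall>Q. primeideal Q A \<longrightarrow> s \<in> Q \<longrightarrow> (\<exists>Q'. primeideal Q' A \<and> Q' \<subset> Q))"
proof -
  interpret P: module A P by fact
  have fm: "module A (free_module A n)" by (rule module_free_module) (rule is_cring)
  obtain M where M: "finite M" "\<And>Q. Q \<in> M \<Longrightarrow> primeideal Q A"
    and cover: "\<And>Q. primeideal Q A \<Longrightarrow> \<exists>Q'\<in>M. Q' \<subseteq> Q"
    and anti: "\<And>Q Q'. Q \<in> M \<Longrightarrow> Q' \<in> M \<Longrightarrow> Q \<subseteq> Q' \<Longrightarrow> Q = Q'"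
    by (rule finite_minimal_primes[of "{}"]) auto
  \<comment> \<open>The denominator is also kept inside the minimal primes not yet treated; then its
    product with the next denominator, scaled by \<open>e\<close>, lies in every minimal
    prime.\<close>
  have *: "\<exists>s \<Phi> \<Psi>. trivialization A P n s \<Phi> \<Psi> \<and> (\<forall>Q\<in>G. s \<notin> Q) \<and> (\<forall>Q\<in>M - G. s \<in> Q)"
    if "finite G" "G \<subseteq> M" for G
    using that
  proof (induction G)
    case empty
    have "\<zero>\<^bsub>free_module A n\<^esub> \<in> carrier (free_module A n)"
      using abelian_monoid.zero_closed[OF abelian_group.axioms(1)[OF module.axioms(2)[OF fm]]] .
    then have "trivialization A P n \<zero> (\<lambda>_. \<zero>\<^bsub>P\<^esub>) (\<lambda>_. \<zero>\<^bsub>free_module A n\<^esub>)"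
      by (auto simp: trivialization_def module_hom_def fun_eq_iff PiE_iff extensional_def)
    moreover have "\<zero> \<in> Q" if "Q \<in> M" for Q
      using M(2)[OF that] by (meson additive_subgroup.zero_closed ideal.axioms(1) primeideal.axioms(1))
    ultimately show ?case by blast
  next
    case (insert Q G)
    then obtain s \<Phi> \<Psi> where s: "trivialization A P n s \<Phi> \<Psi>" "\<And>Q. Q \<in> G \<Longrightarrow> s \<notin> Q"
      "\<And>Q. Q \<in> M - G \<Longrightarrow> s \<in> Q"
      by auto
    have Q: "Q \<in> M" "primeideal Q A" using insert.prems M(2) by auto
    obtain t \<Phi>' \<Psi>' where t: "trivialization A P n t \<Phi>' \<Psi>'" "t \<notin> Q"
      using P(2) Q(2) unfolding locally_free_def by blast
    have sA: "s \<in> carrier A" "t \<in> carrier A" using s t by (simp_all add: trivialization_def)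
    have "ideal Q' A \<and> \<not> Q' \<subseteq> Q" if "Q' \<in> M - {Q}" for Q'
      using that M(2)[of Q'] anti[of Q' Q] Q(1) primeideal.axioms(1)[of Q' A] by auto
    then obtain e where e: "e \<in> carrier A" "e \<notin> Q" "\<forall>Q'\<in>M - {Q}. e \<in> Q'"
      using incomparable_prime_separation[of "M - {Q}" Q] M(1) Q(2) by auto
    have "s \<otimes> (e \<otimes> t) \<in> Q'" if Q': "primeideal Q' A" for Q'
    proof -
      obtain Q'' where Q'': "Q'' \<in> M" "Q'' \<subseteq> Q'" using cover[OF Q'] by blast
      have pQ'': "primeideal Q'' A" using M(2) Q''(1) .
      have "s \<in> Q'' \<or> e \<in> Q''"
      proof (cases "Q'' = Q")
        case True
        then show ?thesis using s(3)[of Q] Q(1) insert.hyps by simp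
      next
        case False
        then show ?thesis using e(3) Q''(1) by simp
      qed
      then have "s \<otimes> (e \<otimes> t) \<in> Q''"
        using primeideal_mult[OF pQ'' sA(1), of "e \<otimes> t"] primeideal_mult[OF pQ'' e(1) sA(2)] e(1) sA(2)
        by auto
      then show ?thesis using Q''(2) by blast
    qed
    then obtain N :: nat where N: "(s \<otimes> (e \<otimes> t)) [^] N \<in> {\<zero>}"
      using nilpotent_if_in_all_primes[OF zeroideal, of "s \<otimes> (e \<otimes> t)"] e(1) sA by auto
    \<comment> \<open>The power makes \<open>a \<otimes> b\<close> vanish. The extra factor keeps
      the exponent positive even for \<open>N\<close> = 0, so that \<open>a\<close> lies in exactly
      the primes containing \<open>s\<close>, and \<open>b\<close> in those containing
      \<open>e\<close> or \<open>t\<close>.\<close>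
    define a where "a = s [^] N \<otimes> s"
    define b where "b = (e \<otimes> t) [^] N \<otimes> e \<otimes> t"
    have ab: "a \<in> carrier A" "b \<in> carrier A" using sA e(1) by (simp_all add: a_def b_def)
    have "(s [^] N \<otimes> s) \<otimes> ((e \<otimes> t) [^] N \<otimes> (e \<otimes> t)) =
        (s [^] N \<otimes> (e \<otimes> t) [^] N) \<otimes> (s \<otimes> (e \<otimes> t))"
      using sA e(1) by (simp add: m_ac)
    also have "s [^] N \<otimes> (e \<otimes> t) [^] N = \<zero>"
      using N sA e(1) by (simp add: pow_mult_distrib m_comm)
    finally have z: "a \<otimes> b = \<zero>" using sA e(1) by (simp add: a_def b_def m_assoc)
    have ta: "trivialization A P n a \<Phi> (\<lambda>x. s [^] N \<odot>\<^bsub>free_module A n\<^esub> \<Psi> x)"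
      unfolding a_def by (rule trivialization_scale[OF is_cring P(1) s(1)]) (use sA in simp)
    have tb: "trivialization A P n b \<Phi>' (\<lambda>x. ((e \<otimes> t) [^] N \<otimes> e) \<odot>\<^bsub>free_module A n\<^esub> \<Psi>' x)"
      unfolding b_def by (rule trivialization_scale[OF is_cring P(1) t(1)]) (use sA e(1) in simp)
    let ?c = "a \<otimes> (a \<otimes> a) \<oplus> b \<otimes> (b \<otimes> b)"
    have pa: "a \<in> I \<longleftrightarrow> s \<in> I" if "primeideal I A" for I
      using primeideal_mult[OF that nat_pow_closed[OF sA(1)] sA(1)] primeideal_pow[OF that sA(1)]
      by (auto simp: a_def)
    have pb: "b \<in> I \<longleftrightarrow> e \<in> I \<or> t \<in> I" if I: "primeideal I A" for I
      using primeideal_mult[OF I m_closed[OF nat_pow_closed[OF m_closed[OF e(1) sA(2)]] e(1)] sA(2)]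
        primeideal_mult[OF I nat_pow_closed[OF m_closed[OF e(1) sA(2)]] e(1)]
        primeideal_mult[OF I e(1) sA(2)] primeideal_pow[OF I m_closed[OF e(1) sA(2)]]
      by (auto simp: b_def)
    have cube: "x \<otimes> (x \<otimes> x) \<in> I \<longleftrightarrow> x \<in> I" if "primeideal I A" "x \<in> carrier A" for I x
      using primeideal_mult[OF that(1,2) m_closed[OF that(2) that(2)]] primeideal_mult[OF that(1,2,2)]
      by auto
    have c1: "?c \<in> I \<longleftrightarrow> b \<in> I" if "primeideal I A" "a \<in> I" for I
      using primeideal_add_cancel(1)[OF that(1), of "a \<otimes> (a \<otimes> a)" "b \<otimes> (b \<otimes> b)"] that ab
        cube[OF that(1)] by simp
    have c2: "?c \<in> I \<longleftrightarrow> a \<in> I" if "primeideal I A" "b \<in> I" for I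
      using primeideal_add_cancel(2)[OF that(1), of "b \<otimes> (b \<otimes> b)" "a \<otimes> (a \<otimes> a)"] that ab
        cube[OF that(1)] by simp
    have "?c \<notin> Q'" if "Q' \<in> insert Q G" for Q'
    proof (cases "Q' = Q")
      case True
      then show ?thesis using c1[OF Q(2)] pa[OF Q(2)] pb[OF Q(2)] s(3)[of Q] Q(1) insert.hyps e(2) t(2)
        by simp
    next
      case False
      then have Q': "Q' \<in> G" "Q' \<in> M" "Q' \<in> M - {Q}" using that insert.prems by auto
      have "b \<in> Q'" using pb[OF M(2)[OF Q'(2)]] e(3) Q'(3) by simp
      then show ?thesis using c2[OF M(2)[OF Q'(2)]] pa[OF M(2)[OF Q'(2)]] s(2)[OF Q'(1)] by simp
    qed
    moreover have "?c \<in> Q'" if "Q' \<in> M - insert Q G" for Q'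
    proof -
      have Q': "Q' \<in> M" "Q' \<in> M - G" "Q' \<in> M - {Q}" using that by auto
      have "a \<in> Q'" "b \<in> Q'"
        using pa[OF M(2)[OF Q'(1)]] pb[OF M(2)[OF Q'(1)]] s(3)[OF Q'(2)] e(3) Q'(3) by auto
      then show ?thesis using c1[OF M(2)[OF Q'(1)]] by simp
    qed
    ultimately show ?case
      using trivialization_combine[OF is_cring P(1) ta tb z] by blast
  qed
  obtain s \<Phi> \<Psi> where s: "trivialization A P n s \<Phi> \<Psi>" "\<And>Q. Q \<in> M \<Longrightarrow> s \<notin> Q"
    using *[OF M(1) subset_refl] by auto
  have "\<exists>Q'. primeideal Q' A \<and> Q' \<subset> Q" if Q: "primeideal Q A" "s \<in> Q" for Q
  proof -
    obtain Q' where "Q' \<in> M" "Q' \<subseteq> Q" using cover[OF Q(1)] by blast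
    then show ?thesis using Q(2) M(2)[of Q'] s(2)[of Q'] by auto
  qed
  then have "\<forall>Q. primeideal Q A \<longrightarrow> s \<in> Q \<longrightarrow> (\<exists>Q'. primeideal Q' A \<and> Q' \<subset> Q)"
    by (intro allI impI)
  with s(1) show ?thesis by (intro exI conjI)
qed

text \<open>Write h(x, 0) = (y, a). Applying \<open>k\<close> gives (x, 0) = k(y, 0) + a (0, 1), so
  k(y, 0) has first component \<open>x\<close>. By symmetry this treats both composites of the maps
  induced between P and Q.\<close>

lemma direct_sum_cancel_retract:
  assumes "module R P" "module R Q"
    and h: "h \<in> module_hom R (direct_sum P (free_module R 1)) (direct_sum Q (free_module R 1))"
    and k: "k \<in> module_hom R (direct_sum Q (free_module R 1)) (direct_sum P (free_module R 1))"
    and kh: "\<And>u. u \<in> carrier (direct_sum P (free_module R 1)) \<Longrightarrow> k (h u) = u"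
    and k1: "k (\<zero>\<^bsub>Q\<^esub>, scalar \<one>\<^bsub>R\<^esub>) = (\<zero>\<^bsub>P\<^esub>, scalar \<one>\<^bsub>R\<^esub>)"
    and x: "x \<in> carrier P"
  shows "fst (k (fst (h (x, scalar \<zero>\<^bsub>R\<^esub>)), scalar \<zero>\<^bsub>R\<^esub>)) = x"
proof -
  interpret P: module R P by fact
  interpret Q: module R Q by fact
  note [simp del] = One_nat_def free_module_simps
  let ?M = "direct_sum P (free_module R 1)" and ?N = "direct_sum Q (free_module R 1)"
  have x0: "(x, scalar \<zero>\<^bsub>R\<^esub>) \<in> carrier ?M" using x by simp
  obtain y a where ya: "y \<in> carrier Q" "a \<in> carrier R" "h (x, scalar \<zero>\<^bsub>R\<^esub>) = (y, scalar a)"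
    using module_hom_closed[OF h x0] by (rule direct_sum_scalar_cases)
  have y0: "(y, scalar \<zero>\<^bsub>R\<^esub>) \<in> carrier ?N" and e: "(\<zero>\<^bsub>Q\<^esub>, scalar \<one>\<^bsub>R\<^esub>) \<in> carrier ?N"
    and ae: "a \<odot>\<^bsub>?N\<^esub> (\<zero>\<^bsub>Q\<^esub>, scalar \<one>\<^bsub>R\<^esub>) \<in> carrier ?N"
    using ya by simp_all
  have "(y, scalar a) = (y, scalar \<zero>\<^bsub>R\<^esub>) \<oplus>\<^bsub>?N\<^esub> a \<odot>\<^bsub>?N\<^esub> (\<zero>\<^bsub>Q\<^esub>, scalar \<one>\<^bsub>R\<^esub>)"
    using ya by simp
  then have eq: "(x, scalar \<zero>\<^bsub>R\<^esub>) = k (y, scalar \<zero>\<^bsub>R\<^esub>) \<oplus>\<^bsub>?M\<^esub> a \<odot>\<^bsub>?M\<^esub> (\<zero>\<^bsub>P\<^esub>, scalar \<one>\<^bsub>R\<^esub>)"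
    using kh[OF x0] module_hom_add[OF k y0 ae] module_hom_smult[OF k ya(2) e] ya(3) k1 by simp
  obtain z b where zb: "z \<in> carrier P" "b \<in> carrier R" "k (y, scalar \<zero>\<^bsub>R\<^esub>) = (z, scalar b)"
    using module_hom_closed[OF k y0] by (rule direct_sum_scalar_cases)
  have "x = z" using eq zb ya(2) by simp
  then show ?thesis using ya(3) zb(3) by simp
qed

text \<open>The vector (0, 1) of the second sum pulls back to a unimodular vector of the first. Once
  an automorphism moves that vector to (0, 1), the isomorphism matches the two free summands, and
  dividing them out leaves P and Q.\<close>

lemma cancel_by_transitivity:
  assumes P: "module R P" and Q: "module R Q"
    and iso: "module_isomorphic R (direct_sum P (free_module R 1)) (direct_sum Q (free_module R 1))"
    and trans: "\<And>u. unimodular R (direct_sum P (free_module R 1)) u \<Longrightarrow>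
      \<exists>\<sigma>\<in>module_iso R (direct_sum P (free_module R 1)) (direct_sum P (free_module R 1)).
        \<sigma> u = (\<zero>\<^bsub>P\<^esub>, scalar \<one>\<^bsub>R\<^esub>)"
  shows "module_isomorphic R P Q"
proof -
  interpret P: module R P by fact
  interpret Q: module R Q by fact
  note [simp del] = One_nat_def free_module_simps
  let ?M = "direct_sum P (free_module R 1)" and ?N = "direct_sum Q (free_module R 1)"
  have cr: "cring R" by (rule P.R.is_cring)
  have M: "module R ?M" and N: "module R ?N"
    using module_direct_sum P Q module_free_module[OF cr] by blast+
  let ?e = "(\<zero>\<^bsub>P\<^esub>, scalar \<one>\<^bsub>R\<^esub>)" and ?e' = "(\<zero>\<^bsub>Q\<^esub>, scalar \<one>\<^bsub>R\<^esub>)"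
  have e: "?e \<in> carrier ?M" "?e' \<in> carrier ?N" by simp_all
  obtain \<theta> where "\<theta> \<in> module_iso R ?M ?N" using iso by (auto simp: module_isomorphic_altdef)
  then obtain \<eta> where \<theta>: "\<theta> \<in> module_hom R ?M ?N" and \<eta>: "\<eta> \<in> module_hom R ?N ?M"
    and \<eta>\<theta>: "\<And>x. x \<in> carrier ?M \<Longrightarrow> \<eta> (\<theta> x) = x" and \<theta>\<eta>: "\<And>y. y \<in> carrier ?N \<Longrightarrow> \<theta> (\<eta> y) = y"
    by (rule module_isoE[OF _ M]) blast
  have uc: "\<eta> ?e' \<in> carrier ?M" by (rule module_hom_closed[OF \<eta> e(2)])
  have sn: "(\<lambda>u. snd u 0) \<in> module_hom R ?N (regular_module R)"
  proof (rule module_homI)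
    fix u assume "u \<in> carrier ?N"
    then obtain p a where u: "p \<in> carrier Q" "a \<in> carrier R" "u = (p, scalar a)"
      by (rule direct_sum_scalar_cases)
    show "snd u 0 \<in> carrier (regular_module R)" using u by simp
    show "snd (c \<odot>\<^bsub>?N\<^esub> u) 0 = c \<odot>\<^bsub>regular_module R\<^esub> snd u 0" if "c \<in> carrier R" for c
      using u by simp
    fix v assume "v \<in> carrier ?N"
    then obtain q b where v: "q \<in> carrier Q" "b \<in> carrier R" "v = (q, scalar b)"
      by (rule direct_sum_scalar_cases)
    show "snd (u \<oplus>\<^bsub>?N\<^esub> v) 0 = snd u 0 \<oplus>\<^bsub>regular_module R\<^esub> snd v 0" using u v by simp
  qed
  have "unimodular R ?M (\<eta> ?e')"
    unfolding unimodular_def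
    using uc by (intro conjI bexI[OF _ module_hom_comp[OF \<theta> sn]]) (simp_all add: \<theta>\<eta>[OF e(2)])
  then obtain \<sigma> where \<sigma>: "\<sigma> \<in> module_iso R ?M ?M" "\<sigma> (\<eta> ?e') = ?e" using trans by blast
  obtain \<sigma>' where s: "\<sigma> \<in> module_hom R ?M ?M" "\<sigma>' \<in> module_hom R ?M ?M"
    "\<And>x. x \<in> carrier ?M \<Longrightarrow> \<sigma>' (\<sigma> x) = x" "\<And>y. y \<in> carrier ?M \<Longrightarrow> \<sigma> (\<sigma>' y) = y"
    by (rule module_isoE[OF \<sigma>(1) M]) blast
  define h where "h u = \<theta> (\<sigma>' u)" for u
  define k where "k u = \<sigma> (\<eta> u)" for u
  have h: "h \<in> module_hom R ?M ?N" unfolding h_def by (rule module_hom_comp[OF s(2) \<theta>])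
  have k: "k \<in> module_hom R ?N ?M" unfolding k_def by (rule module_hom_comp[OF \<eta> s(1)])
  have kh: "k (h u) = u" if "u \<in> carrier ?M" for u
    using that by (simp add: h_def k_def \<eta>\<theta>[OF module_hom_closed[OF s(2) that]] s(4))
  have hk: "h (k u) = u" if "u \<in> carrier ?N" for u
    using that by (simp add: h_def k_def s(3)[OF module_hom_closed[OF \<eta> that]] \<theta>\<eta>)
  have k1: "k ?e' = ?e" by (simp add: k_def \<sigma>(2))
  have h1: "h ?e = ?e'" using hk[OF e(2)] k1 by simp
  have inP: "(\<lambda>x. (x, scalar \<zero>\<^bsub>R\<^esub>)) \<in> module_hom R P ?M"
    by (rule module_homI) simp_all
  have inQ: "(\<lambda>x. (x, scalar \<zero>\<^bsub>R\<^esub>)) \<in> module_hom R Q ?N"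
    by (rule module_homI) simp_all
  have prP: "fst \<in> module_hom R ?M P" by (rule module_homI) auto
  have prQ: "fst \<in> module_hom R ?N Q" by (rule module_homI) auto
  have "(\<lambda>x. fst (h (x, scalar \<zero>\<^bsub>R\<^esub>))) \<in> module_iso R P Q"
    by (rule module_isoI[OF module_hom_comp[OF module_hom_comp[OF inP h] prQ]
      module_hom_comp[OF module_hom_comp[OF inQ k] prP]
      direct_sum_cancel_retract[OF P Q h k kh k1] direct_sum_cancel_retract[OF Q P k h hk h1]])
  then show ?thesis by (auto simp: module_isomorphic_altdef)
qed

section \<open>The extension by a root of a split quadratic\<close>

text \<open>
  The pair \<open>(a, b)\<close> stands for \<open>a + b X\<close> in \<open>A[X]/(X\<^sup>2 - s X)\<close>.
\<close>

definition quad_ext :: "('a, 'k) ring_scheme \<Rightarrow> 'a \<Rightarrow> ('a \<times> 'a) ring"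
  where "quad_ext A s =
    \<lparr>carrier = carrier A \<times> carrier A,
     monoid.mult = (\<lambda>(a, b) (c, d). (a \<otimes>\<^bsub>A\<^esub> c, a \<otimes>\<^bsub>A\<^esub> d \<oplus>\<^bsub>A\<^esub> b \<otimes>\<^bsub>A\<^esub> c \<oplus>\<^bsub>A\<^esub> s \<otimes>\<^bsub>A\<^esub> (b \<otimes>\<^bsub>A\<^esub> d))),
     monoid.one = (\<one>\<^bsub>A\<^esub>, \<zero>\<^bsub>A\<^esub>), ring.zero = (\<zero>\<^bsub>A\<^esub>, \<zero>\<^bsub>A\<^esub>),
     ring.add = (\<lambda>(a, b) (c, d). (a \<oplus>\<^bsub>A\<^esub> c, b \<oplus>\<^bsub>A\<^esub> d))\<rparr>"

lemma quad_ext_simps [simp]: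
  "carrier (quad_ext A s) = carrier A \<times> carrier A"
  "\<one>\<^bsub>quad_ext A s\<^esub> = (\<one>\<^bsub>A\<^esub>, \<zero>\<^bsub>A\<^esub>)"
  "\<zero>\<^bsub>quad_ext A s\<^esub> = (\<zero>\<^bsub>A\<^esub>, \<zero>\<^bsub>A\<^esub>)"
  "(a, b) \<oplus>\<^bsub>quad_ext A s\<^esub> (c, d) = (a \<oplus>\<^bsub>A\<^esub> c, b \<oplus>\<^bsub>A\<^esub> d)"
  "(a, b) \<otimes>\<^bsub>quad_ext A s\<^esub> (c, d) =
    (a \<otimes>\<^bsub>A\<^esub> c, a \<otimes>\<^bsub>A\<^esub> d \<oplus>\<^bsub>A\<^esub> b \<otimes>\<^bsub>A\<^esub> c \<oplus>\<^bsub>A\<^esub> s \<otimes>\<^bsub>A\<^esub> (b \<otimes>\<^bsub>A\<^esub> d))"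
  by (simp_all add: quad_ext_def)

lemma (in cring) cring_quad_ext:
  assumes s: "s \<in> carrier R"
  shows "cring (quad_ext R s)"
proof (rule cringI)
  show "abelian_group (quad_ext R s)"
  proof (rule abelian_groupI)
    fix x assume "x \<in> carrier (quad_ext R s)"
    then obtain a b where "x = (a, b)" "a \<in> carrier R" "b \<in> carrier R" by auto
    then show "\<exists>y\<in>carrier (quad_ext R s). y \<oplus>\<^bsub>quad_ext R s\<^esub> x = \<zero>\<^bsub>quad_ext R s\<^esub>"
      by (intro bexI[of _ "(\<ominus> a, \<ominus> b)"]) (simp_all add: l_neg)
  qed (auto simp: a_ac)
  show "comm_monoid (quad_ext R s)"
    by (rule comm_monoidI) (use s in \<open>auto simp: l_distr r_distr m_ac a_ac\<close>)
qed (use s in \<open>auto simp: l_distr r_distr m_ac a_ac\<close>)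

text \<open>The generators are 1 and X. Sums run over the set of generators, so the two must differ
  for the sum to have two terms; in the zero ring they coincide.\<close>

lemma finite_extension_quad_ext:
  assumes R: "cring R" and s: "s \<in> carrier R" and one: "\<one>\<^bsub>R\<^esub> \<noteq> \<zero>\<^bsub>R\<^esub>"
  shows "finite_extension R (quad_ext R s) (\<lambda>a. (a, \<zero>\<^bsub>R\<^esub>))"
proof -
  interpret R: cring R by fact
  let ?E = "quad_ext R s" and ?\<phi> = "\<lambda>a. (a, \<zero>\<^bsub>R\<^esub>)"
  have E: "cring ?E" by (rule R.cring_quad_ext[OF s])
  have \<phi>: "?\<phi> \<in> ring_hom R ?E" using s by (auto simp: ring_hom_def)
  interpret M: module R "module_via ?\<phi> ?E" by (rule module_module_via[OF R.is_cring E \<phi>])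
  let ?G = "{(\<one>\<^bsub>R\<^esub>, \<zero>\<^bsub>R\<^esub>), (\<zero>\<^bsub>R\<^esub>, \<one>\<^bsub>R\<^esub>)}"
  have sum: "(\<Oplus>\<^bsub>module_via ?\<phi> ?E\<^esub>x\<in>?G. c x \<odot>\<^bsub>module_via ?\<phi> ?E\<^esub> x) = (c (\<one>\<^bsub>R\<^esub>, \<zero>\<^bsub>R\<^esub>), c (\<zero>\<^bsub>R\<^esub>, \<one>\<^bsub>R\<^esub>))"
    if "c \<in> ?G \<rightarrow> carrier R" for c
  proof -
    have c: "c (\<one>\<^bsub>R\<^esub>, \<zero>\<^bsub>R\<^esub>) \<in> carrier R" "c (\<zero>\<^bsub>R\<^esub>, \<one>\<^bsub>R\<^esub>) \<in> carrier R" using that by auto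
    have "(\<Oplus>\<^bsub>module_via ?\<phi> ?E\<^esub>x\<in>?G. c x \<odot>\<^bsub>module_via ?\<phi> ?E\<^esub> x) =
        c (\<one>\<^bsub>R\<^esub>, \<zero>\<^bsub>R\<^esub>) \<odot>\<^bsub>module_via ?\<phi> ?E\<^esub> (\<one>\<^bsub>R\<^esub>, \<zero>\<^bsub>R\<^esub>) \<oplus>\<^bsub>module_via ?\<phi> ?E\<^esub> c (\<zero>\<^bsub>R\<^esub>, \<one>\<^bsub>R\<^esub>) \<odot>\<^bsub>module_via ?\<phi> ?E\<^esub> (\<zero>\<^bsub>R\<^esub>, \<one>\<^bsub>R\<^esub>)"
      using c s one by (simp add: M.M.finsum_insert)
    then show ?thesis using c s by simp
  qed
  have "carrier (module_via ?\<phi> ?E) =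
    {(\<Oplus>\<^bsub>module_via ?\<phi> ?E\<^esub>x\<in>?G. c x \<odot>\<^bsub>module_via ?\<phi> ?E\<^esub> x) | c. c \<in> ?G \<rightarrow> carrier R}" (is "_ = ?S")
  proof
    show "carrier (module_via ?\<phi> ?E) \<subseteq> ?S"
    proof
      fix x assume "x \<in> carrier (module_via ?\<phi> ?E)"
      then obtain a b where x: "x = (a, b)" "a \<in> carrier R" "b \<in> carrier R" by auto
      let ?c = "\<lambda>y. if y = (\<one>\<^bsub>R\<^esub>, \<zero>\<^bsub>R\<^esub>) then a else b"
      have c: "?c \<in> ?G \<rightarrow> carrier R" using x by auto
      show "x \<in> ?S" using sum[OF c] x(1) one c by (intro CollectI exI[of _ ?c]) simp
    qed
    show "?S \<subseteq> carrier (module_via ?\<phi> ?E)" using sum by auto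
  qed
  then have "finitely_generated R (module_via ?\<phi> ?E)"
    unfolding finitely_generated_def by (intro exI[of _ ?G]) auto
  then show ?thesis using E \<phi> by (simp add: finite_extension_def inj_on_def)
qed

section \<open>Cancellation of free modules and completion of unimodular vectors\<close>

lemma module_iso_bijI:
  assumes "f \<in> module_hom R M N" "\<And>y. y \<in> carrier N \<Longrightarrow> g y \<in> carrier M"
    and "\<And>x. x \<in> carrier M \<Longrightarrow> g (f x) = x" "\<And>y. y \<in> carrier N \<Longrightarrow> f (g y) = y"
  shows "f \<in> module_iso R M N"
  using assms(1) bij_betwI[of f "carrier M" "carrier N" g] module_hom_closed[OF assms(1)] assms(2-)
  by (auto simp: module_iso_def)

text \<open>As \<open>G v\<close> is 1, every x splits as (x - G(x) v) + G(x) v, so E is the sum of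
  the kernel of \<open>G\<close> and the free submodule on \<open>v\<close>.\<close>

lemma kernel_complement:
  fixes R :: "('r, 'k) ring_scheme"
  assumes E: "module R E" and G: "G \<in> module_hom R E (regular_module R)"
    and v: "v \<in> carrier E" "G v = \<one>\<^bsub>R\<^esub>"
  defines "K \<equiv> E\<lparr>carrier := {x \<in> carrier E. G x = \<zero>\<^bsub>R\<^esub>}\<rparr>"
  shows "module R K" "module_isomorphic R (direct_sum K (free_module R 1)) E"
    "\<And>x. x \<in> carrier E \<Longrightarrow> x \<ominus>\<^bsub>E\<^esub> G x \<odot>\<^bsub>E\<^esub> v \<in> carrier K"
proof -
  interpret E: module R E by fact
  note [simp del] = One_nat_def free_module_simps
  have mr: "module R (regular_module R)" by (rule module_regular) (rule E.R.is_cring)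
  have Gc: "G x \<in> carrier R" if "x \<in> carrier E" for x using module_hom_closed[OF G that] by simp
  have Ga: "G (x \<oplus>\<^bsub>E\<^esub> y) = G x \<oplus>\<^bsub>R\<^esub> G y" if "x \<in> carrier E" "y \<in> carrier E" for x y
    using module_hom_add[OF G that] by simp
  have Gs: "G (a \<odot>\<^bsub>E\<^esub> x) = a \<otimes>\<^bsub>R\<^esub> G x" if "a \<in> carrier R" "x \<in> carrier E" for a x
    using module_hom_smult[OF G that] by simp
  have G0: "G \<zero>\<^bsub>E\<^esub> = \<zero>\<^bsub>R\<^esub>" using module_hom_zero[OF G E mr] by simp
  have Gm: "G (\<ominus>\<^bsub>E\<^esub> x) = \<ominus>\<^bsub>R\<^esub> G x" if x: "x \<in> carrier E" for x
    using Ga[of "\<ominus>\<^bsub>E\<^esub> x" x] x Gc[OF x] Gc[of "\<ominus>\<^bsub>E\<^esub> x"] G0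
    by (simp add: E.M.l_neg E.R.minus_equality[symmetric])
  have "submodule {x \<in> carrier E. G x = \<zero>\<^bsub>R\<^esub>} R E"
    by (rule E.submoduleI) (auto simp: G0 Gm Ga Gs)
  then show K: "module R K" unfolding K_def by (rule submodule.submodule_is_module) (rule E)
  have Kc: "x \<in> carrier K \<longleftrightarrow> x \<in> carrier E \<and> G x = \<zero>\<^bsub>R\<^esub>" for x by (simp add: K_def)
  have Ko: "x \<oplus>\<^bsub>K\<^esub> y = x \<oplus>\<^bsub>E\<^esub> y" "a \<odot>\<^bsub>K\<^esub> x = a \<odot>\<^bsub>E\<^esub> x" for x y a by (simp_all add: K_def)
  show proj: "x \<ominus>\<^bsub>E\<^esub> G x \<odot>\<^bsub>E\<^esub> v \<in> carrier K" if x: "x \<in> carrier E" for x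
    using x v Gc[OF x] by (simp add: Kc a_minus_def Ga Gs Gm E.R.r_neg)
  let ?f = "\<lambda>(x, z). x \<oplus>\<^bsub>E\<^esub> z (0::nat) \<odot>\<^bsub>E\<^esub> v"
  let ?g = "\<lambda>x. (x \<ominus>\<^bsub>E\<^esub> G x \<odot>\<^bsub>E\<^esub> v, scalar (G x))"
  have "?f \<in> module_iso R (direct_sum K (free_module R 1)) E"
  proof (rule module_iso_bijI)
    show "?f \<in> module_hom R (direct_sum K (free_module R 1)) E"
    proof (rule module_homI)
      fix u assume "u \<in> carrier (direct_sum K (free_module R 1))"
      then obtain x a where u: "x \<in> carrier K" "a \<in> carrier R" "u = (x, scalar a)"
        by (rule direct_sum_scalar_cases)
      show "?f u \<in> carrier E" using u v Kc by simp
      show "?f (c \<odot>\<^bsub>direct_sum K (free_module R 1)\<^esub> u) = c \<odot>\<^bsub>E\<^esub> ?f u" if "c \<in> carrier R" for c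
        using u v Kc that by (simp add: Ko E.smult_r_distr E.smult_assoc1)
      fix w assume "w \<in> carrier (direct_sum K (free_module R 1))"
      then obtain y b where w: "y \<in> carrier K" "b \<in> carrier R" "w = (y, scalar b)"
        by (rule direct_sum_scalar_cases)
      show "?f (u \<oplus>\<^bsub>direct_sum K (free_module R 1)\<^esub> w) = ?f u \<oplus>\<^bsub>E\<^esub> ?f w"
        using u w v Kc by (simp add: Ko E.smult_l_distr E.M.a_ac)
    qed
    show "?g x \<in> carrier (direct_sum K (free_module R 1))" if "x \<in> carrier E" for x
      using proj[OF that] Gc[OF that] by simp
    show "?g (?f u) = u" if mem: "u \<in> carrier (direct_sum K (free_module R 1))" for u
    proof -
      obtain x a where u: "x \<in> carrier K" "a \<in> carrier R" "u = (x, scalar a)"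
        using mem by (rule direct_sum_scalar_cases)
      then show ?thesis
        using v Kc by (simp add: Ga Gs a_minus_def E.M.a_assoc E.M.r_neg)
    qed
    show "?f (?g x) = x" if "x \<in> carrier E" for x
      using that v Gc[OF that] by (simp add: a_minus_def E.M.a_assoc E.M.l_neg)
  qed
  then show "module_isomorphic R (direct_sum K (free_module R 1)) E"
    by (auto simp: module_isomorphic_altdef)
qed

text \<open>In matrix terms: every unimodular vector is the \<open>i\<close>-th column of an
  invertible matrix.\<close>

definition completable :: "('r, 'k) ring_scheme \<Rightarrow> nat \<Rightarrow> nat \<Rightarrow> bool"
  where "completable R n i \<longleftrightarrow> (\<forall>v. unimodular R (free_module R n) v \<longrightarrow>
    (\<exists>\<sigma>\<in>module_iso R (free_module R n) (free_module R n). \<sigma> (unit_vec R n i) = v))"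

text \<open>The kernel K of a functional with value 1 at \<open>v\<close> satisfies K \<oplus> R
  \<cong> R^(d+1), so cancellation makes K free of rank \<open>d\<close>. A basis of K followed by
  \<open>v\<close> is the required completion.\<close>

lemma completable_if_cancellative:
  fixes R :: "('r, 'k) ring_scheme"
  assumes R: "cring R" and canc: "cancellative TYPE('r list set) R (free_module R d)"
  shows "completable R (Suc d) d"
  unfolding completable_def
proof (intro allI impI)
  fix v assume "unimodular R (free_module R (Suc d)) v"
  then obtain G where v: "v \<in> carrier (free_module R (Suc d))"
    and G: "G \<in> module_hom R (free_module R (Suc d)) (regular_module R)" "G v = \<one>\<^bsub>R\<^esub>"
    by (auto simp: unimodular_def)
  let ?E = "free_module R (Suc d)"
  interpret R: cring R by fact
  interpret E: module R ?E by (rule module_free_module[OF R])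
  have Fd: "module R (free_module R d)" by (rule module_free_module[OF R])
  define K where "K = ?E\<lparr>carrier := {x \<in> carrier ?E. G x = \<zero>\<^bsub>R\<^esub>}\<rparr>"
  note kc = kernel_complement[of R ?E G v, OF E.module_axioms G(1) v G(2), folded K_def]
  interpret K: module R K by (rule kc(1))
  \<comment> \<open>Cancellativity is assumed only against modules carried by sets of lists, so K is
    copied there: a vector becomes the singleton of its coordinate list.\<close>
  let ?g = "\<lambda>x. {map x [0..<Suc d]}"
  have inj: "inj_on ?g (carrier K)"
  proof (rule inj_onI)
    fix x y assume xy: "x \<in> carrier K" "y \<in> carrier K" and e: "?g x = ?g y"
    have "x i = y i" if "i < Suc d" for i
      using e that by (simp del: upt_Suc)
    then show "x = y" using xy by (intro free_module_eqI[of x R "Suc d" y]) (simp_all add: K_def)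
  qed
  obtain N :: "('r, 'r list set) module" where N: "module R N" and "?g \<in> module_hom R K N"
    "bij_betw ?g (carrier K) (carrier N)"
    using module_transport[OF kc(1) inj] by blast
  then have KN: "module_isomorphic R K N" by (auto simp: module_isomorphic_def)
  have NE: "module_isomorphic R (direct_sum N (free_module R 1)) ?E"
    by (rule module_isomorphic_trans[OF direct_sum_isomorphic_left[OF module_isomorphic_sym[OF KN kc(1)]] kc(2)])
  then have "fg_projective R N"
    unfolding fg_projective_def using N module_free_module[OF R, of 1] by blast
  moreover have "module_isomorphic R (direct_sum (free_module R d) (free_module R 1)) (direct_sum N (free_module R 1))"
    by (rule module_isomorphic_trans[OF free_module_split[of R d 1, folded Suc_eq_plus1]
      module_isomorphic_sym[OF NE module_direct_sum[OF N module_free_module[OF R]]]])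
  ultimately have "module_isomorphic R (free_module R d) N"
    using canc unfolding cancellative_def by blast
  then have "module_isomorphic R (free_module R d) K"
    by (rule module_isomorphic_trans) (rule module_isomorphic_sym[OF KN kc(1)])
  then obtain k where "k \<in> module_iso R (free_module R d) K" by (auto simp: module_isomorphic_altdef)
  then obtain k' where k: "k \<in> module_hom R (free_module R d) K" "k' \<in> module_hom R K (free_module R d)"
    "\<And>x. x \<in> carrier (free_module R d) \<Longrightarrow> k' (k x) = x" "\<And>y. y \<in> carrier K \<Longrightarrow> k (k' y) = y"
    by (rule module_isoE[OF _ Fd]) blast
  have Kc: "x \<in> carrier K \<longleftrightarrow> x \<in> carrier ?E \<and> G x = \<zero>\<^bsub>R\<^esub>" for x by (simp add: K_def)
  have incl: "(\<lambda>x. x) \<in> module_hom R K ?E"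
    by (rule module_homI) (simp_all add: K_def)
  have restr: "(\<lambda>y. restrict y {..<d}) \<in> module_hom R ?E (free_module R d)"
    by (rule module_homI) (simp_all only: restrict_free_module_carrier[OF _ lessI[THEN less_imp_le]]
      restrict_free_module_add[OF lessI[THEN less_imp_le]] restrict_free_module_smult[OF lessI[THEN less_imp_le]])
  have rc: "restrict y {..<d} \<in> carrier (free_module R d)" if "y \<in> carrier ?E" for y
    using that by (rule restrict_free_module_carrier) simp
  have kc': "k (restrict y {..<d}) \<in> carrier ?E" "G (k (restrict y {..<d})) = \<zero>\<^bsub>R\<^esub>"
    if "y \<in> carrier ?E" for y
    using module_hom_closed[OF k(1) rc[OF that]] Kc by auto
  have yd: "y d \<in> carrier R" if "y \<in> carrier ?E" for y
    using that by (rule free_module_coord) simp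
  have Gc: "G x \<in> carrier R" if "x \<in> carrier ?E" for x using module_hom_closed[OF G(1) that] by simp
  note [simp del] = free_module_simps
  have last: "(\<lambda>y. y d \<odot>\<^bsub>?E\<^esub> v) \<in> module_hom R ?E ?E"
  proof (rule module_homI)
    fix x assume x: "x \<in> carrier ?E"
    show "x d \<odot>\<^bsub>?E\<^esub> v \<in> carrier ?E" using yd[OF x] v by simp
    show "(a \<odot>\<^bsub>?E\<^esub> x) d \<odot>\<^bsub>?E\<^esub> v = a \<odot>\<^bsub>?E\<^esub> (x d \<odot>\<^bsub>?E\<^esub> v)" if "a \<in> carrier R" for a
      using E.smult_assoc1[OF that yd[OF x] v] by (simp add: free_module_simps(4))
    show "(x \<oplus>\<^bsub>?E\<^esub> y) d \<odot>\<^bsub>?E\<^esub> v = x d \<odot>\<^bsub>?E\<^esub> v \<oplus>\<^bsub>?E\<^esub> y d \<odot>\<^bsub>?E\<^esub> v" if "y \<in> carrier ?E" for y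
      using E.smult_l_distr[OF yd[OF x] yd[OF that] v] by (simp add: free_module_simps(3))
  qed
  \<comment> \<open>The columns of \<sigma> are the images under \<open>k\<close> of the basis of
    R^d, followed by \<open>v\<close>. The inverse \<rho> reads the last coordinate with
    \<open>G\<close> and the others with \<open>k'\<close> after projecting to K along
    \<open>v\<close>.\<close>
  define \<sigma> where "\<sigma> y = k (restrict y {..<d}) \<oplus>\<^bsub>?E\<^esub> y d \<odot>\<^bsub>?E\<^esub> v" for y
  define \<rho> where "\<rho> x = (\<lambda>i\<in>{..<Suc d}. if i < d then k' (x \<ominus>\<^bsub>?E\<^esub> G x \<odot>\<^bsub>?E\<^esub> v) i else G x)" for x
  have \<sigma>h: "\<sigma> \<in> module_hom R ?E ?E"
    unfolding \<sigma>_def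
    by (rule module_hom_plus[OF module_hom_comp[OF module_hom_comp[OF restr k(1)] incl] last E.module_axioms])
  have G\<sigma>: "G (\<sigma> y) = y d" if y: "y \<in> carrier ?E" for y
    using module_hom_add[OF G(1) kc'(1)[OF y] E.smult_closed[OF yd[OF y] v]]
      module_hom_smult[OF G(1) yd[OF y] v] kc'(2)[OF y] G(2) yd[OF y]
    by (simp add: \<sigma>_def)
  have \<rho>c: "\<rho> x \<in> carrier ?E" if x: "x \<in> carrier ?E" for x
    unfolding \<rho>_def
    using free_module_coord[OF module_hom_closed[OF k(2) kc(3)[OF x]]] Gc[OF x]
    by (intro restrict_free_module) simp
  have \<rho>\<sigma>: "\<rho> (\<sigma> y) = y" if y: "y \<in> carrier ?E" for y
  proof (rule free_module_eqI[OF \<rho>c[OF module_hom_closed[OF \<sigma>h y]] y])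
    have "\<sigma> y \<ominus>\<^bsub>?E\<^esub> G (\<sigma> y) \<odot>\<^bsub>?E\<^esub> v = k (restrict y {..<d})"
      unfolding G\<sigma>[OF y] unfolding \<sigma>_def a_minus_def
      using kc'(1)[OF y] E.smult_closed[OF yd[OF y] v] by (simp add: E.M.a_assoc E.M.r_neg)
    then have "k' (\<sigma> y \<ominus>\<^bsub>?E\<^esub> G (\<sigma> y) \<odot>\<^bsub>?E\<^esub> v) = restrict y {..<d}"
      using k(3)[OF rc[OF y]] by simp
    then show "\<rho> (\<sigma> y) i = y i" if "i < Suc d" for i
      using that G\<sigma>[OF y] by (auto simp: \<rho>_def less_Suc_eq)
  qed
  have \<sigma>\<rho>: "\<sigma> (\<rho> x) = x" if x: "x \<in> carrier ?E" for x
  proof -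
    note c = kc(3)[OF x]
    have "restrict (\<rho> x) {..<d} = k' (x \<ominus>\<^bsub>?E\<^esub> G x \<odot>\<^bsub>?E\<^esub> v)"
      using module_hom_closed[OF k(2) c]
      by (intro free_module_eqI[OF rc[OF \<rho>c[OF x]]]) (simp_all add: \<rho>_def)
    then have "k (restrict (\<rho> x) {..<d}) = x \<ominus>\<^bsub>?E\<^esub> G x \<odot>\<^bsub>?E\<^esub> v" using k(4)[OF c] by simp
    moreover have "\<rho> x d = G x" by (simp add: \<rho>_def)
    ultimately show ?thesis
      unfolding \<sigma>_def using x E.smult_closed[OF Gc[OF x] v]
      by (simp add: a_minus_def E.M.a_assoc E.M.l_neg)
  qed
  have ud: "unit_vec R (Suc d) d \<in> carrier ?E" using R.unit_vec_carrier by (simp add: free_module_simps)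
  have "restrict (unit_vec R (Suc d) d) {..<d} = \<zero>\<^bsub>free_module R d\<^esub>"
    by (auto simp: unit_vec_def fun_eq_iff free_module_simps)
  then have "k (restrict (unit_vec R (Suc d) d) {..<d}) = \<zero>\<^bsub>?E\<^esub>"
    using module_hom_zero[OF k(1) Fd kc(1)] by (simp add: K_def)
  then have "\<sigma> (unit_vec R (Suc d) d) = v"
    using v by (simp add: \<sigma>_def unit_vec_def)
  moreover have "\<sigma> \<in> module_iso R ?E ?E"
    by (rule module_iso_bijI[OF \<sigma>h, of \<rho>]) (use \<rho>c \<rho>\<sigma> \<sigma>\<rho> in auto)
  ultimately show "\<exists>\<sigma>\<in>module_iso R ?E ?E. \<sigma> (unit_vec R (Suc d) d) = v"
    by (intro bexI[of _ \<sigma>])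
qed

section \<open>Transport along ring isomorphisms\<close>

definition map_vec :: "nat \<Rightarrow> ('r \<Rightarrow> 's) \<Rightarrow> (nat \<Rightarrow> 'r) \<Rightarrow> nat \<Rightarrow> 's"
  where "map_vec n g y = (\<lambda>i\<in>{..<n}. g (y i))"

lemma map_vec_ring_hom:
  assumes "g \<in> ring_hom R S"
  shows map_vec_closed: "y \<in> carrier (free_module R n) \<Longrightarrow> map_vec n g y \<in> carrier (free_module S n)"
    and map_vec_add: "y \<in> carrier (free_module R n) \<Longrightarrow> z \<in> carrier (free_module R n) \<Longrightarrow>
      map_vec n g (y \<oplus>\<^bsub>free_module R n\<^esub> z) = map_vec n g y \<oplus>\<^bsub>free_module S n\<^esub> map_vec n g z"
    and map_vec_smult: "a \<in> carrier R \<Longrightarrow> y \<in> carrier (free_module R n) \<Longrightarrow>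
      map_vec n g (a \<odot>\<^bsub>free_module R n\<^esub> y) = g a \<odot>\<^bsub>free_module S n\<^esub> map_vec n g y"
  using assms free_module_coord[of y R n] free_module_coord[of z R n]
  by (auto simp: map_vec_def fun_eq_iff ring_hom_add ring_hom_mult intro: ring_hom_closed)

lemma map_vec_inverse:
  assumes "y \<in> carrier (free_module R n)" "\<And>a. a \<in> carrier R \<Longrightarrow> h (g a) = a"
  shows "map_vec n h (map_vec n g y) = y"
  using assms free_module_coord[OF assms(1)]
  by (auto simp: map_vec_def fun_eq_iff PiE_iff extensional_def)

text \<open>Functionals and automorphisms are conjugated by the coordinatewise isomorphism. The need
  arises because cancellativity is assumed for extensions on one fixed carrier type, whereas the
  quadratic extension lives on pairs.\<close>

lemma completable_ring_iso:
  fixes R :: "('r, 'k) ring_scheme" and S :: "('s, 'l) ring_scheme"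
  assumes R: "cring R" and S: "cring S" and g: "g \<in> ring_iso R S" and comp: "completable S n i"
  shows "completable R n i"
  unfolding completable_def
proof (intro allI impI)
  fix v assume "unimodular R (free_module R n) v"
  then obtain G where v: "v \<in> carrier (free_module R n)"
    and G: "G \<in> module_hom R (free_module R n) (regular_module R)" "G v = \<one>\<^bsub>R\<^esub>"
    by (auto simp: unimodular_def)
  interpret R: cring R by fact
  interpret S: cring S by fact
  let ?F = "free_module R n" and ?E = "free_module S n"
  define h where "h = inv_into (carrier R) g"
  have gh: "g \<in> ring_hom R S" and h: "h \<in> ring_hom S R"
    using g ring_iso_set_sym[OF R.ring_axioms g] by (simp_all add: ring_iso_def h_def)
  have bij: "bij_betw g (carrier R) (carrier S)" using g by (simp add: ring_iso_def)
  have hg: "h (g a) = a" if "a \<in> carrier R" for a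
    unfolding h_def by (rule bij_betw_inv_into_left[OF bij that])
  have gh': "g (h b) = b" if "b \<in> carrier S" for b
    unfolding h_def by (rule bij_betw_inv_into_right[OF bij that])
  note mg = map_vec_closed[OF gh] and mh = map_vec_closed[OF h]
  have mhg: "map_vec n h (map_vec n g y) = y" if "y \<in> carrier ?F" for y
    by (rule map_vec_inverse[OF that]) (rule hg)
  have mgh: "map_vec n g (map_vec n h y) = y" if "y \<in> carrier ?E" for y
    by (rule map_vec_inverse[OF that]) (rule gh')
  have Gc: "G y \<in> carrier R" if "y \<in> carrier ?F" for y using module_hom_closed[OF G(1) that] by simp
  have G': "(\<lambda>x. g (G (map_vec n h x))) \<in> module_hom S ?E (regular_module S)"
  proof (rule module_homI)
    fix x assume x: "x \<in> carrier ?E"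
    show "g (G (map_vec n h x)) \<in> carrier (regular_module S)"
      using ring_hom_closed[OF gh Gc[OF mh[OF x]]] by simp
    show "g (G (map_vec n h (a \<odot>\<^bsub>?E\<^esub> x))) = a \<odot>\<^bsub>regular_module S\<^esub> g (G (map_vec n h x))"
      if a: "a \<in> carrier S" for a
      using ring_hom_mult[OF gh ring_hom_closed[OF h a] Gc[OF mh[OF x]]] gh'[OF a]
      by (simp add: map_vec_smult[OF h a x] module_hom_smult[OF G(1) ring_hom_closed[OF h a] mh[OF x]]
          del: free_module_simps)
    show "g (G (map_vec n h (x \<oplus>\<^bsub>?E\<^esub> y))) =
      g (G (map_vec n h x)) \<oplus>\<^bsub>regular_module S\<^esub> g (G (map_vec n h y))" if y: "y \<in> carrier ?E" for y
      using ring_hom_add[OF gh Gc[OF mh[OF x]] Gc[OF mh[OF y]]]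
      by (simp add: map_vec_add[OF h x y] module_hom_add[OF G(1) mh[OF x] mh[OF y]] del: free_module_simps)
  qed
  have "g (G (map_vec n h (map_vec n g v))) = \<one>\<^bsub>S\<^esub>"
    using ring_hom_one[OF gh] by (simp add: mhg[OF v] G(2))
  then have "unimodular S ?E (map_vec n g v)"
    unfolding unimodular_def by (intro conjI mg[OF v] bexI[OF _ G'])
  then obtain \<tau> where \<tau>: "\<tau> \<in> module_iso S ?E ?E" "\<tau> (unit_vec S n i) = map_vec n g v"
    using comp by (auto simp: completable_def)
  obtain \<tau>' where t: "\<tau> \<in> module_hom S ?E ?E" "\<tau>' \<in> module_hom S ?E ?E"
    "\<And>x. x \<in> carrier ?E \<Longrightarrow> \<tau>' (\<tau> x) = x" "\<And>y. y \<in> carrier ?E \<Longrightarrow> \<tau> (\<tau>' y) = y"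
    by (rule module_isoE[OF \<tau>(1) module_free_module[OF S]]) blast
  have conj_hom: "(\<lambda>y. map_vec n h (f (map_vec n g y))) \<in> module_hom R ?F ?F"
    if f: "f \<in> module_hom S ?E ?E" for f
  proof (rule module_homI)
    fix x assume x: "x \<in> carrier ?F"
    note fx = module_hom_closed[OF f mg[OF x]]
    show "map_vec n h (f (map_vec n g x)) \<in> carrier ?F" by (rule mh[OF fx])
    show "map_vec n h (f (map_vec n g (a \<odot>\<^bsub>?F\<^esub> x))) = a \<odot>\<^bsub>?F\<^esub> map_vec n h (f (map_vec n g x))"
      if a: "a \<in> carrier R" for a
      unfolding map_vec_smult[OF gh a x] module_hom_smult[OF f ring_hom_closed[OF gh a] mg[OF x]]
        map_vec_smult[OF h ring_hom_closed[OF gh a] fx] hg[OF a] by (rule refl)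
    show "map_vec n h (f (map_vec n g (x \<oplus>\<^bsub>?F\<^esub> y))) =
      map_vec n h (f (map_vec n g x)) \<oplus>\<^bsub>?F\<^esub> map_vec n h (f (map_vec n g y))" if y: "y \<in> carrier ?F" for y
      unfolding map_vec_add[OF gh x y] module_hom_add[OF f mg[OF x] mg[OF y]]
        map_vec_add[OF h fx module_hom_closed[OF f mg[OF y]]] by (rule refl)
  qed
  let ?\<sigma> = "\<lambda>y. map_vec n h (\<tau> (map_vec n g y))"
  have "?\<sigma> \<in> module_iso R ?F ?F"
  proof (rule module_isoI[OF conj_hom[OF t(1)] conj_hom[OF t(2)]])
    fix x assume x: "x \<in> carrier ?F"
    show "map_vec n h (\<tau>' (map_vec n g (map_vec n h (\<tau> (map_vec n g x))))) = x"
      unfolding mgh[OF module_hom_closed[OF t(1) mg[OF x]]] t(3)[OF mg[OF x]] by (rule mhg[OF x])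
    show "map_vec n h (\<tau> (map_vec n g (map_vec n h (\<tau>' (map_vec n g x))))) = x"
      unfolding mgh[OF module_hom_closed[OF t(2) mg[OF x]]] t(4)[OF mg[OF x]] by (rule mhg[OF x])
  qed
  moreover have "map_vec n g (unit_vec R n i) = unit_vec S n i"
    using ring_hom_one[OF gh] ring_hom_zero[OF gh R.ring_axioms S.ring_axioms]
    by (simp add: map_vec_def unit_vec_def fun_eq_iff)
  then have "?\<sigma> (unit_vec R n i) = v" using \<tau>(2) mhg[OF v] by simp
  ultimately show "\<exists>\<sigma>\<in>module_iso R ?F ?F. \<sigma> (unit_vec R n i) = v" by (intro bexI[of _ ?\<sigma>])
qed

text \<open>
  \<open>U + W X\<close> and \<open>U' + W' X\<close> are mutually inverse matrices over \<open>R[X]/(X\<^sup>2 - s X)\<close>; the automorphism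
  is \<open>1 + \<Phi> U W' \<Psi>\<close>, with inverse \<open>1 + \<Phi> W U' \<Psi>\<close>.
\<close>

lemma twisted_automorphism:
  fixes R :: "('r, 'k) ring_scheme" and n :: nat
  defines "F \<equiv> free_module R n"
  assumes R: "cring R" and N: "module R N" and t: "trivialization R N n s \<Phi> \<Psi>"
    and U: "U \<in> module_hom R F F"
    and W: "W \<in> module_hom R F F"
    and U': "U' \<in> module_hom R F F"
    and W': "W' \<in> module_hom R F F"
    and UU': "\<And>y. y \<in> carrier F \<Longrightarrow> U (U' y) = y"
    and U'U: "\<And>y. y \<in> carrier F \<Longrightarrow> U' (U y) = y"
    and rel: "\<And>y. y \<in> carrier F \<Longrightarrow>
      W' (U y) \<oplus>\<^bsub>F\<^esub> (U' (W y) \<oplus>\<^bsub>F\<^esub> s \<odot>\<^bsub>F\<^esub> W' (W y)) = \<zero>\<^bsub>F\<^esub>"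
    and rel': "\<And>y. y \<in> carrier F \<Longrightarrow>
      W (U' y) \<oplus>\<^bsub>F\<^esub> (U (W' y) \<oplus>\<^bsub>F\<^esub> s \<odot>\<^bsub>F\<^esub> W (W' y)) = \<zero>\<^bsub>F\<^esub>"
    and e: "e \<in> carrier F" "U e = e" "W e = \<rho>"
  shows "\<exists>\<tau>\<in>module_iso R N N. \<tau> (\<Phi> (e \<oplus>\<^bsub>F\<^esub> s \<odot>\<^bsub>F\<^esub> \<rho>)) = \<Phi> e"
proof -
  interpret N: module R N by fact
  interpret F: module R F unfolding F_def by (rule module_free_module[OF R])
  have s: "s \<in> carrier R" and \<Phi>: "\<Phi> \<in> module_hom R F N" and \<Psi>: "\<Psi> \<in> module_hom R N F"
    and \<Psi>\<Phi>: "\<And>y. y \<in> carrier F \<Longrightarrow> \<Psi> (\<Phi> y) = s \<odot>\<^bsub>F\<^esub> y"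
    using t by (simp_all add: trivialization_def F_def)
  note c [simp] = module_hom_closed[OF U] module_hom_closed[OF W] module_hom_closed[OF U']
    module_hom_closed[OF W'] module_hom_closed[OF \<Phi>] module_hom_closed[OF \<Psi>] s
  note a = module_hom_add[OF U] module_hom_add[OF W] module_hom_add[OF U'] module_hom_add[OF W']
    module_hom_add[OF \<Phi>] module_hom_add[OF \<Psi>]
  note m = module_hom_smult[OF U] module_hom_smult[OF W] module_hom_smult[OF U'] module_hom_smult[OF W']
    module_hom_smult[OF \<Phi>] module_hom_smult[OF \<Psi>]
  have U0: "U \<zero>\<^bsub>F\<^esub> = \<zero>\<^bsub>F\<^esub>" by (rule module_hom_zero[OF U F.module_axioms F.module_axioms])
  have \<Phi>0: "\<Phi> \<zero>\<^bsub>F\<^esub> = \<zero>\<^bsub>N\<^esub>" by (rule module_hom_zero[OF \<Phi> F.module_axioms N.module_axioms])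
  \<comment> \<open>At X = s the inverse of U + s W is U' + s W', and U (U' + s W') = 1 + s U W';
    this gives \<open>M\<close>. Inversely, (U + s W) U' = 1 + s W U' gives
    \<open>M'\<close>.\<close>
  define M where "M y = U (W' y)" for y
  define M' where "M' y = W (U' y)" for y
  have M: "M \<in> module_hom R F F" unfolding M_def by (rule module_hom_comp[OF W' U])
  have M': "M' \<in> module_hom R F F" unfolding M'_def by (rule module_hom_comp[OF U' W])
  note cM [simp] = module_hom_closed[OF M] module_hom_closed[OF M']
  \<comment> \<open>This is (1 + s M) (U + s W) = U with \<open>s\<close> cancelled. It is
    legitimate because \<open>rel\<close> is the X coefficient of the product of the two inverse
    matrices, to which U is applied.\<close>
  have r1: "M (U y) \<oplus>\<^bsub>F\<^esub> (W y \<oplus>\<^bsub>F\<^esub> s \<odot>\<^bsub>F\<^esub> M (W y)) = \<zero>\<^bsub>F\<^esub>" if y: "y \<in> carrier F" for y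
    using arg_cong[OF rel[OF y], of U] y by (simp add: M_def a m U0 UU')
  have r2: "M' y \<oplus>\<^bsub>F\<^esub> (M y \<oplus>\<^bsub>F\<^esub> s \<odot>\<^bsub>F\<^esub> M (M' y)) = \<zero>\<^bsub>F\<^esub>" if y: "y \<in> carrier F" for y
    using r1[of "U' y"] y by (simp add: M'_def UU' F.M.a_lcomm)
  have r3: "M y \<oplus>\<^bsub>F\<^esub> (M' y \<oplus>\<^bsub>F\<^esub> s \<odot>\<^bsub>F\<^esub> M' (M y)) = \<zero>\<^bsub>F\<^esub>" if y: "y \<in> carrier F" for y
    using rel'[OF y] y by (simp add: M_def M'_def U'U F.M.a_lcomm)
  define \<tau> where "\<tau> u = u \<oplus>\<^bsub>N\<^esub> \<Phi> (M (\<Psi> u))" for u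
  define \<tau>' where "\<tau>' u = u \<oplus>\<^bsub>N\<^esub> \<Phi> (M' (\<Psi> u))" for u
  have idN: "(\<lambda>u. u) \<in> module_hom R N N" by (rule module_homI) auto
  have \<tau>: "\<tau> \<in> module_hom R N N"
    unfolding \<tau>_def
    by (rule module_hom_plus[OF idN module_hom_comp[OF module_hom_comp[OF \<Psi> M] \<Phi>] N.module_axioms])
  have \<tau>': "\<tau>' \<in> module_hom R N N"
    unfolding \<tau>'_def
    by (rule module_hom_plus[OF idN module_hom_comp[OF module_hom_comp[OF \<Psi> M'] \<Phi>] N.module_axioms])
  note aM = module_hom_add[OF M] module_hom_add[OF M']
  note mM = module_hom_smult[OF M] module_hom_smult[OF M']
  \<comment> \<open>Since \<Psi> \<Phi> = s, the product (1 + \<Phi> C \<Psi>) (1 + \<Phi> B \<Psi>)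
    equals 1 + \<Phi> (B + C + s C B) \<Psi>, and the bracket vanishes at \<Psi> u by
    \<open>z\<close>.\<close>
  have comp: "u \<oplus>\<^bsub>N\<^esub> \<Phi> (B (\<Psi> u)) \<oplus>\<^bsub>N\<^esub> \<Phi> (C (\<Psi> (u \<oplus>\<^bsub>N\<^esub> \<Phi> (B (\<Psi> u))))) = u"
    if u: "u \<in> carrier N" and B: "B \<in> module_hom R F F" and C: "C \<in> module_hom R F F"
      and z: "B (\<Psi> u) \<oplus>\<^bsub>F\<^esub> (C (\<Psi> u) \<oplus>\<^bsub>F\<^esub> s \<odot>\<^bsub>F\<^esub> C (B (\<Psi> u))) = \<zero>\<^bsub>F\<^esub>" for u B C
  proof -
    let ?w = "\<Psi> u"
    note [simp] = module_hom_closed[OF B] module_hom_closed[OF C]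
    have w: "?w \<in> carrier F" using u by simp
    have "\<Psi> (u \<oplus>\<^bsub>N\<^esub> \<Phi> (B ?w)) = ?w \<oplus>\<^bsub>F\<^esub> s \<odot>\<^bsub>F\<^esub> B ?w"
      using u w by (simp add: a \<Psi>\<Phi>)
    then have "\<Phi> (C (\<Psi> (u \<oplus>\<^bsub>N\<^esub> \<Phi> (B ?w)))) = \<Phi> (C ?w \<oplus>\<^bsub>F\<^esub> s \<odot>\<^bsub>F\<^esub> C (B ?w))"
      using w by (simp add: module_hom_add[OF C] module_hom_smult[OF C])
    then have "u \<oplus>\<^bsub>N\<^esub> \<Phi> (B ?w) \<oplus>\<^bsub>N\<^esub> \<Phi> (C (\<Psi> (u \<oplus>\<^bsub>N\<^esub> \<Phi> (B ?w)))) =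
        u \<oplus>\<^bsub>N\<^esub> \<Phi> (B ?w \<oplus>\<^bsub>F\<^esub> (C ?w \<oplus>\<^bsub>F\<^esub> s \<odot>\<^bsub>F\<^esub> C (B ?w)))"
      using u w module_hom_add[OF \<Phi>, of "B ?w" "C ?w \<oplus>\<^bsub>F\<^esub> s \<odot>\<^bsub>F\<^esub> C (B ?w)"]
      by (simp add: N.M.a_assoc)
    also have "\<dots> = u" using u by (simp add: z \<Phi>0)
    finally show ?thesis .
  qed
  have "\<tau> \<in> module_iso R N N"
  proof (rule module_isoI[OF \<tau> \<tau>'])
    fix u assume u: "u \<in> carrier N"
    show "\<tau>' (\<tau> u) = u"
      unfolding \<tau>_def \<tau>'_def by (rule comp[OF u M M' r3]) (simp add: u)
    show "\<tau> (\<tau>' u) = u"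
      unfolding \<tau>_def \<tau>'_def by (rule comp[OF u M' M r2]) (simp add: u)
  qed
  moreover have "\<tau> (\<Phi> (e \<oplus>\<^bsub>F\<^esub> s \<odot>\<^bsub>F\<^esub> \<rho>)) = \<Phi> e"
  proof -
    have \<rho>: "\<rho> \<in> carrier F" using e by auto
    let ?x = "e \<oplus>\<^bsub>F\<^esub> s \<odot>\<^bsub>F\<^esub> \<rho>"
    have x: "?x \<in> carrier F" using e(1) \<rho> by simp
    have "\<tau> (\<Phi> ?x) = \<Phi> (?x \<oplus>\<^bsub>F\<^esub> s \<odot>\<^bsub>F\<^esub> M ?x)"
      using x module_hom_add[OF \<Phi> x, of "s \<odot>\<^bsub>F\<^esub> M ?x"] module_hom_smult[OF \<Phi> s, of "M ?x"]
        module_hom_smult[OF M s x]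
      by (simp add: \<tau>_def \<Psi>\<Phi>[OF x])
    \<comment> \<open>Reading e as U e and \<rho> as W e brings the expression into the shape to
      which \<open>r1\<close> applies.\<close>
    also have "?x \<oplus>\<^bsub>F\<^esub> s \<odot>\<^bsub>F\<^esub> M ?x = e \<oplus>\<^bsub>F\<^esub> s \<odot>\<^bsub>F\<^esub> (M (U e) \<oplus>\<^bsub>F\<^esub> (W e \<oplus>\<^bsub>F\<^esub> s \<odot>\<^bsub>F\<^esub> M (W e)))"
      using e \<rho> by (simp add: aM mM F.smult_r_distr F.M.a_ac)
    also have "\<dots> = e" using r1[OF e(1)] e(1) s by simp
    finally show ?thesis .
  qed
  ultimately show ?thesis by (intro bexI[of _ \<tau>])
qed

section \<open>Descent of automorphisms from the quadratic extension\<close>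

text \<open>Represents y + z X, identifying vectors over the quadratic extension with pairs of
  vectors over the base ring.\<close>

definition pair_vec :: "nat \<Rightarrow> (nat \<Rightarrow> 'r) \<Rightarrow> (nat \<Rightarrow> 'r) \<Rightarrow> nat \<Rightarrow> 'r \<times> 'r"
  where "pair_vec n y z = (\<lambda>i\<in>{..<n}. (y i, z i))"

lemma pair_vec_closed:
  assumes "y \<in> carrier (free_module A n)" "z \<in> carrier (free_module A n)"
  shows "pair_vec n y z \<in> carrier (free_module (quad_ext A s) n)"
  unfolding pair_vec_def using free_module_coord[OF assms(1)] free_module_coord[OF assms(2)]
  by (intro restrict_free_module) simp

lemma pair_vec_cases:
  assumes "w \<in> carrier (free_module (quad_ext A s) n)"
  obtains y z where "y \<in> carrier (free_module A n)" "z \<in> carrier (free_module A n)" "w = pair_vec n y z"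
proof
  have w: "w i \<in> carrier A \<times> carrier A" if "i < n" for i using free_module_coord[OF assms that] by simp
  show "map_vec n fst w \<in> carrier (free_module A n)" "map_vec n snd w \<in> carrier (free_module A n)"
    unfolding map_vec_def using w by (intro restrict_free_module; fastforce)+
  show "w = pair_vec n (map_vec n fst w) (map_vec n snd w)"
    using assms by (auto simp: pair_vec_def map_vec_def fun_eq_iff PiE_iff extensional_def)
qed

lemma pair_vec_components:
  assumes "y \<in> carrier (free_module A n)" "z \<in> carrier (free_module A n)"
  shows "map_vec n fst (pair_vec n y z) = y" "map_vec n snd (pair_vec n y z) = z"
  using assms by (auto simp: pair_vec_def map_vec_def fun_eq_iff PiE_iff extensional_def)

lemma pair_vec_add:
  "pair_vec n y z \<oplus>\<^bsub>free_module (quad_ext A s) n\<^esub> pair_vec n y' z' =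
    pair_vec n (y \<oplus>\<^bsub>free_module A n\<^esub> y') (z \<oplus>\<^bsub>free_module A n\<^esub> z')"
  by (simp add: pair_vec_def fun_eq_iff)

lemma pair_vec_smult:
  "(a, b) \<odot>\<^bsub>free_module (quad_ext A s) n\<^esub> pair_vec n y z =
    pair_vec n (a \<odot>\<^bsub>free_module A n\<^esub> y)
      (a \<odot>\<^bsub>free_module A n\<^esub> z \<oplus>\<^bsub>free_module A n\<^esub> b \<odot>\<^bsub>free_module A n\<^esub> y \<oplus>\<^bsub>free_module A n\<^esub>
        s \<odot>\<^bsub>free_module A n\<^esub> (b \<odot>\<^bsub>free_module A n\<^esub> z))"
  by (simp add: pair_vec_def fun_eq_iff)

text \<open>An endomorphism is determined by its values on vectors without X, where it splits as U +
  W X. The general formula follows from X (U z + W z X) = (U z + s W z) X.\<close>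

lemma quad_ext_endomorphism:
  assumes A: "cring A" and s: "s \<in> carrier A"
    and S: "S \<in> module_hom (quad_ext A s) (free_module (quad_ext A s) n)
      (free_module (quad_ext A s) n)"
  obtains U W where "U \<in> module_hom A (free_module A n) (free_module A n)"
    "W \<in> module_hom A (free_module A n) (free_module A n)"
    "\<And>y. y \<in> carrier (free_module A n) \<Longrightarrow>
      S (pair_vec n y \<zero>\<^bsub>free_module A n\<^esub>) = pair_vec n (U y) (W y)"
    "\<And>y z. y \<in> carrier (free_module A n) \<Longrightarrow> z \<in> carrier (free_module A n) \<Longrightarrow>
      S (pair_vec n y z) =
        pair_vec n (U y) (W y \<oplus>\<^bsub>free_module A n\<^esub> (U z \<oplus>\<^bsub>free_module A n\<^esub> s \<odot>\<^bsub>free_module A n\<^esub> W z))"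
proof -
  let ?E = "quad_ext A s" and ?F = "free_module A n"
  let ?EF = "free_module ?E n"
  interpret A: cring A by fact
  interpret F: module A ?F by (rule module_free_module[OF A])
  note [simp del] = free_module_simps
  let ?p = "pair_vec n" and ?z = "\<zero>\<^bsub>?F\<^esub>"
  define U where "U y = map_vec n fst (S (?p y ?z))" for y
  define W where "W y = map_vec n snd (S (?p y ?z))" for y
  have y0: "?p y ?z \<in> carrier ?EF" if "y \<in> carrier ?F" for y
    by (rule pair_vec_closed[OF that F.M.zero_closed])
  have Sy: "S (?p y ?z) = ?p (U y) (W y)" and Uc: "U y \<in> carrier ?F" and Wc: "W y \<in> carrier ?F"
    if y: "y \<in> carrier ?F" for y
  proof -
    obtain a b where ab: "a \<in> carrier ?F" "b \<in> carrier ?F" "S (?p y ?z) = ?p a b"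
      using module_hom_closed[OF S y0[OF y]] by (rule pair_vec_cases)
    then have "U y = a" "W y = b" by (simp_all add: U_def W_def pair_vec_components[OF ab(1,2)])
    then show "S (?p y ?z) = ?p (U y) (W y)" "U y \<in> carrier ?F" "W y \<in> carrier ?F"
      using ab by simp_all
  qed
  have inj: "y = y' \<and> z = z'" if "?p y z = ?p y' z'" "y \<in> carrier ?F" "z \<in> carrier ?F"
    "y' \<in> carrier ?F" "z' \<in> carrier ?F" for y z y' z'
    using pair_vec_components[OF that(2,3)] pair_vec_components[OF that(4,5)] that(1) by simp
  have add: "U (x \<oplus>\<^bsub>?F\<^esub> y) = U x \<oplus>\<^bsub>?F\<^esub> U y \<and> W (x \<oplus>\<^bsub>?F\<^esub> y) = W x \<oplus>\<^bsub>?F\<^esub> W y"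
    if x: "x \<in> carrier ?F" and y: "y \<in> carrier ?F" for x y
  proof (rule inj)
    have "?p (x \<oplus>\<^bsub>?F\<^esub> y) ?z = ?p x ?z \<oplus>\<^bsub>?EF\<^esub> ?p y ?z"
      by (simp add: pair_vec_add)
    then have "S (?p (x \<oplus>\<^bsub>?F\<^esub> y) ?z) = ?p (U x) (W x) \<oplus>\<^bsub>?EF\<^esub> ?p (U y) (W y)"
      using module_hom_add[OF S y0[OF x] y0[OF y]] Sy[OF x] Sy[OF y] by simp
    then show "?p (U (x \<oplus>\<^bsub>?F\<^esub> y)) (W (x \<oplus>\<^bsub>?F\<^esub> y)) = ?p (U x \<oplus>\<^bsub>?F\<^esub> U y) (W x \<oplus>\<^bsub>?F\<^esub> W y)"
      using Sy[OF F.M.a_closed[OF x y]] by (simp add: pair_vec_add)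
  qed (use x y Uc Wc in auto)
  have smult: "U (a \<odot>\<^bsub>?F\<^esub> y) = a \<odot>\<^bsub>?F\<^esub> U y \<and> W (a \<odot>\<^bsub>?F\<^esub> y) = a \<odot>\<^bsub>?F\<^esub> W y"
    if a: "a \<in> carrier A" and y: "y \<in> carrier ?F" for a y
  proof (rule inj)
    have a': "(a, \<zero>\<^bsub>A\<^esub>) \<in> carrier ?E" using a by simp
    have "?p (a \<odot>\<^bsub>?F\<^esub> y) ?z = (a, \<zero>\<^bsub>A\<^esub>) \<odot>\<^bsub>?EF\<^esub> ?p y ?z"
      using a y s by (simp add: pair_vec_smult)
    then have "S (?p (a \<odot>\<^bsub>?F\<^esub> y) ?z) = (a, \<zero>\<^bsub>A\<^esub>) \<odot>\<^bsub>?EF\<^esub> ?p (U y) (W y)"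
      using module_hom_smult[OF S a' y0[OF y]] Sy[OF y] by simp
    also have "\<dots> = ?p (a \<odot>\<^bsub>?F\<^esub> U y) (a \<odot>\<^bsub>?F\<^esub> W y)"
      using a s Uc[OF y] Wc[OF y] by (simp add: pair_vec_smult)
    finally show "?p (U (a \<odot>\<^bsub>?F\<^esub> y)) (W (a \<odot>\<^bsub>?F\<^esub> y)) = ?p (a \<odot>\<^bsub>?F\<^esub> U y) (a \<odot>\<^bsub>?F\<^esub> W y)"
      using Sy[OF F.smult_closed[OF a y]] by simp
  qed (use a y Uc Wc in auto)
  have U: "U \<in> module_hom A ?F ?F" and W: "W \<in> module_hom A ?F ?F"
    using add smult Uc Wc by (auto intro!: module_homI)
  have "S (?p y z) = ?p (U y) (W y \<oplus>\<^bsub>?F\<^esub> (U z \<oplus>\<^bsub>?F\<^esub> s \<odot>\<^bsub>?F\<^esub> W z))"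
    if y: "y \<in> carrier ?F" and z: "z \<in> carrier ?F" for y z
  proof -
    let ?X = "(\<zero>\<^bsub>A\<^esub>, \<one>\<^bsub>A\<^esub>)"
    have X: "?X \<in> carrier ?E" by simp
    have shift: "?X \<odot>\<^bsub>?EF\<^esub> ?p a b = ?p ?z (a \<oplus>\<^bsub>?F\<^esub> s \<odot>\<^bsub>?F\<^esub> b)"
      if "a \<in> carrier ?F" "b \<in> carrier ?F" for a b
      using that s by (simp add: pair_vec_smult)
    have Xz: "?X \<odot>\<^bsub>?EF\<^esub> ?p z ?z = ?p ?z z"
      using shift[OF z F.M.zero_closed] z s by simp
    have Xc: "?X \<odot>\<^bsub>?EF\<^esub> ?p z ?z \<in> carrier ?EF"
      unfolding Xz by (rule pair_vec_closed[OF F.M.zero_closed z])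
    have "?p y z = ?p y ?z \<oplus>\<^bsub>?EF\<^esub> ?X \<odot>\<^bsub>?EF\<^esub> ?p z ?z"
      unfolding Xz using y z by (simp add: pair_vec_add)
    then have "S (?p y z) = ?p (U y) (W y) \<oplus>\<^bsub>?EF\<^esub> ?X \<odot>\<^bsub>?EF\<^esub> ?p (U z) (W z)"
      using module_hom_add[OF S y0[OF y] Xc] module_hom_smult[OF S X y0[OF z]] Sy[OF y] Sy[OF z] by simp
    also have "\<dots> = ?p (U y) (W y \<oplus>\<^bsub>?F\<^esub> (U z \<oplus>\<^bsub>?F\<^esub> s \<odot>\<^bsub>?F\<^esub> W z))"
      using Uc[OF y] Wc[OF y] Uc[OF z] Wc[OF z] by (simp add: shift pair_vec_add)
    finally show ?thesis .
  qed
  then show thesis using that[OF U W Sy] by simp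
qed

text \<open>As X (s - X) = 0, every prime of the extension contains X or s - X, and there e + \<rho>
  X becomes e or e + s \<rho>. Both are unimodular, the first by its coordinate \<open>i\<close>,
  the second by the functional on N pulled back along \<Phi>; an explicit formula glues the two
  functionals. The resulting automorphism over the extension then descends by
  \<open>twisted_automorphism\<close>.\<close>

lemma quad_ext_move:
  assumes A: "cring A" and N: "module A N" and t: "trivialization A N n s \<Phi> \<Psi>" and i: "i < n"
    and comp: "completable (quad_ext A s) n i"
    and \<rho>: "\<rho> \<in> carrier (free_module A n)"
    and uni: "unimodular A N (\<Phi> (unit_vec A n i \<oplus>\<^bsub>free_module A n\<^esub> s \<odot>\<^bsub>free_module A n\<^esub> \<rho>))"
  shows "\<exists>\<tau>\<in>module_iso A N N.
    \<tau> (\<Phi> (unit_vec A n i \<oplus>\<^bsub>free_module A n\<^esub> s \<odot>\<^bsub>free_module A n\<^esub> \<rho>)) = \<Phi> (unit_vec A n i)"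
proof -
  let ?E = "quad_ext A s" and ?F = "free_module A n"
  let ?EF = "free_module ?E n"
  interpret A: cring A by fact
  interpret F: module A ?F by (rule module_free_module[OF A])
  have s: "s \<in> carrier A" and \<Phi>: "\<Phi> \<in> module_hom A ?F N" using t by (simp_all add: trivialization_def)
  have E: "cring ?E" by (rule A.cring_quad_ext[OF s])
  have mE: "module ?E (regular_module ?E)" by (rule module_regular[OF E])
  let ?e = "unit_vec A n i"
  have e: "?e \<in> carrier ?F" using A.unit_vec_carrier by simp
  have ei: "?e i = \<one>\<^bsub>A\<^esub>" using i by (simp add: unit_vec_def)
  have \<rho>i: "\<rho> i \<in> carrier A" by (rule free_module_coord[OF \<rho> i])
  have unitE: "unit_vec ?E n i = pair_vec n ?e \<zero>\<^bsub>?F\<^esub>"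
    by (auto simp: unit_vec_def pair_vec_def fun_eq_iff)
  note [simp del] = free_module_simps
  obtain f where f: "f \<in> module_hom A N (regular_module A)" "f (\<Phi> (?e \<oplus>\<^bsub>?F\<^esub> s \<odot>\<^bsub>?F\<^esub> \<rho>)) = \<one>\<^bsub>A\<^esub>"
    using uni by (auto simp: unimodular_def)
  define H where "H y = f (\<Phi> y)" for y
  have H: "H \<in> module_hom A ?F (regular_module A)" unfolding H_def by (rule module_hom_comp[OF \<Phi> f(1)])
  have Hc: "H y \<in> carrier A" if "y \<in> carrier ?F" for y using module_hom_closed[OF H that] by simp
  have Ha: "H (y \<oplus>\<^bsub>?F\<^esub> z) = H y \<oplus>\<^bsub>A\<^esub> H z" if "y \<in> carrier ?F" "z \<in> carrier ?F" for y z
    using module_hom_add[OF H that] by simp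
  have Hm: "H (a \<odot>\<^bsub>?F\<^esub> y) = a \<otimes>\<^bsub>A\<^esub> H y" if "a \<in> carrier A" "y \<in> carrier ?F" for a y
    using module_hom_smult[OF H that] by simp
  define \<kappa> where "\<kappa> = H \<rho>"
  have \<kappa>: "\<kappa> \<in> carrier A" using Hc[OF \<rho>] by (simp add: \<kappa>_def)
  have He: "H ?e \<oplus>\<^bsub>A\<^esub> s \<otimes>\<^bsub>A\<^esub> \<kappa> = \<one>\<^bsub>A\<^esub>"
    using f(2) e \<rho> s by (simp add: H_def[symmetric] Ha Hm \<kappa>_def)
  let ?G1 = "\<lambda>w. (H (map_vec n fst w), H (map_vec n snd w))"
  have G1: "?G1 \<in> module_hom ?E ?EF (regular_module ?E)"
  proof (rule module_homI)
    fix w assume "w \<in> carrier ?EF"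
    then obtain y z where w: "y \<in> carrier ?F" "z \<in> carrier ?F" "w = pair_vec n y z"
      by (rule pair_vec_cases)
    show "?G1 w \<in> carrier (regular_module ?E)"
      using w Hc by (simp add: pair_vec_components[OF w(1,2)])
    show "?G1 (c \<odot>\<^bsub>?EF\<^esub> w) = c \<odot>\<^bsub>regular_module ?E\<^esub> ?G1 w" if c: "c \<in> carrier ?E" for c
    proof -
      obtain a b where ab: "c = (a, b)" "a \<in> carrier A" "b \<in> carrier A" using c by auto
      have "a \<odot>\<^bsub>?F\<^esub> y \<in> carrier ?F"
        "a \<odot>\<^bsub>?F\<^esub> z \<oplus>\<^bsub>?F\<^esub> b \<odot>\<^bsub>?F\<^esub> y \<oplus>\<^bsub>?F\<^esub> s \<odot>\<^bsub>?F\<^esub> (b \<odot>\<^bsub>?F\<^esub> z) \<in> carrier ?F"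
        using w ab s by simp_all
      then show ?thesis
        using w ab s by (simp add: pair_vec_smult pair_vec_components[where A = A] Ha Hm)
    qed
    fix w' assume "w' \<in> carrier ?EF"
    then obtain y' z' where w': "y' \<in> carrier ?F" "z' \<in> carrier ?F" "w' = pair_vec n y' z'"
      by (rule pair_vec_cases)
    show "?G1 (w \<oplus>\<^bsub>?EF\<^esub> w') = ?G1 w \<oplus>\<^bsub>regular_module ?E\<^esub> ?G1 w'"
      using w w' by (simp add: pair_vec_add pair_vec_components[where A = A] Ha)
  qed
  \<comment> \<open>The extension of \<open>H\<close> takes \<open>e + \<rho> X\<close> to \<open>1 - \<kappa> (s - X)\<close>. Adding \<open>\<kappa> (s - X)\<close> times the
    \<open>i\<close>-th coordinate \<open>1 + \<rho>\<^sub>i X\<close> corrects this to \<open>1\<close>, since \<open>X (s - X) = 0\<close>.\<close>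
  let ?c = "(s \<otimes>\<^bsub>A\<^esub> \<kappa>, \<ominus>\<^bsub>A\<^esub> \<kappa>)"
  have c: "?c \<in> carrier ?E" using s \<kappa> by simp
  let ?G = "\<lambda>w. ?G1 w \<oplus>\<^bsub>regular_module ?E\<^esub> ?c \<odot>\<^bsub>regular_module ?E\<^esub> w i"
  have G: "?G \<in> module_hom ?E ?EF (regular_module ?E)"
    by (rule module_hom_plus[OF G1 module_hom_scale[OF coordinate_hom[OF i] mE c] mE])
  let ?v = "pair_vec n ?e \<rho>"
  have v: "?v \<in> carrier ?EF" by (rule pair_vec_closed[OF e \<rho>])
  have vi: "?v i = (\<one>\<^bsub>A\<^esub>, \<rho> i)" using i ei by (simp add: pair_vec_def)
  have "?G ?v = (H ?e \<oplus>\<^bsub>A\<^esub> s \<otimes>\<^bsub>A\<^esub> \<kappa>,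
      \<kappa> \<oplus>\<^bsub>A\<^esub> (s \<otimes>\<^bsub>A\<^esub> \<kappa> \<otimes>\<^bsub>A\<^esub> \<rho> i \<oplus>\<^bsub>A\<^esub> \<ominus>\<^bsub>A\<^esub> \<kappa> \<oplus>\<^bsub>A\<^esub> s \<otimes>\<^bsub>A\<^esub> (\<ominus>\<^bsub>A\<^esub> \<kappa> \<otimes>\<^bsub>A\<^esub> \<rho> i)))"
    using s \<kappa> by (simp add: vi pair_vec_components[OF e \<rho>] \<kappa>_def[symmetric])
  also have "\<kappa> \<oplus>\<^bsub>A\<^esub> (s \<otimes>\<^bsub>A\<^esub> \<kappa> \<otimes>\<^bsub>A\<^esub> \<rho> i \<oplus>\<^bsub>A\<^esub> \<ominus>\<^bsub>A\<^esub> \<kappa> \<oplus>\<^bsub>A\<^esub> s \<otimes>\<^bsub>A\<^esub> (\<ominus>\<^bsub>A\<^esub> \<kappa> \<otimes>\<^bsub>A\<^esub> \<rho> i)) = \<zero>\<^bsub>A\<^esub>"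
    using s \<kappa> \<rho>i by algebra
  finally have "?G ?v = \<one>\<^bsub>?E\<^esub>" by (simp add: He)
  then have "unimodular ?E ?EF ?v"
    unfolding unimodular_def by (intro conjI v bexI[OF _ G])
  then obtain \<sigma> where \<sigma>: "\<sigma> \<in> module_iso ?E ?EF ?EF" "\<sigma> (unit_vec ?E n i) = ?v"
    using comp by (auto simp: completable_def)
  obtain \<sigma>' where h: "\<sigma> \<in> module_hom ?E ?EF ?EF" "\<sigma>' \<in> module_hom ?E ?EF ?EF"
    and inv: "\<And>x. x \<in> carrier ?EF \<Longrightarrow> \<sigma>' (\<sigma> x) = x" "\<And>y. y \<in> carrier ?EF \<Longrightarrow> \<sigma> (\<sigma>' y) = y"
    by (rule module_isoE[OF \<sigma>(1) module_free_module[OF E]]) blast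
  obtain U W where U: "U \<in> module_hom A ?F ?F" and W: "W \<in> module_hom A ?F ?F"
    and \<sigma>0: "\<And>y. y \<in> carrier ?F \<Longrightarrow> \<sigma> (pair_vec n y \<zero>\<^bsub>?F\<^esub>) = pair_vec n (U y) (W y)"
    and \<sigma>1: "\<And>y z. y \<in> carrier ?F \<Longrightarrow> z \<in> carrier ?F \<Longrightarrow>
      \<sigma> (pair_vec n y z) = pair_vec n (U y) (W y \<oplus>\<^bsub>?F\<^esub> (U z \<oplus>\<^bsub>?F\<^esub> s \<odot>\<^bsub>?F\<^esub> W z))"
    by (rule quad_ext_endomorphism[OF A s h(1)]) blast
  obtain U' W' where U': "U' \<in> module_hom A ?F ?F" and W': "W' \<in> module_hom A ?F ?F"
    and \<sigma>'0: "\<And>y. y \<in> carrier ?F \<Longrightarrow> \<sigma>' (pair_vec n y \<zero>\<^bsub>?F\<^esub>) = pair_vec n (U' y) (W' y)"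
    and \<sigma>'1: "\<And>y z. y \<in> carrier ?F \<Longrightarrow> z \<in> carrier ?F \<Longrightarrow>
      \<sigma>' (pair_vec n y z) = pair_vec n (U' y) (W' y \<oplus>\<^bsub>?F\<^esub> (U' z \<oplus>\<^bsub>?F\<^esub> s \<odot>\<^bsub>?F\<^esub> W' z))"
    by (rule quad_ext_endomorphism[OF A s h(2)]) blast
  have inj: "y = y' \<and> z = z'" if "pair_vec n y z = pair_vec n y' z'" "y \<in> carrier ?F" "z \<in> carrier ?F"
    "y' \<in> carrier ?F" "z' \<in> carrier ?F" for y z y' z'
    using pair_vec_components[OF that(2,3)] pair_vec_components[OF that(4,5)] that(1) by simp
  note [simp] = module_hom_closed[OF U] module_hom_closed[OF W] module_hom_closed[OF U']
    module_hom_closed[OF W'] s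
  have y0: "pair_vec n y \<zero>\<^bsub>?F\<^esub> \<in> carrier ?EF" if "y \<in> carrier ?F" for y
    by (rule pair_vec_closed[OF that F.M.zero_closed])
  have r1: "U' (U y) = y \<and> W' (U y) \<oplus>\<^bsub>?F\<^esub> (U' (W y) \<oplus>\<^bsub>?F\<^esub> s \<odot>\<^bsub>?F\<^esub> W' (W y)) = \<zero>\<^bsub>?F\<^esub>"
    if y: "y \<in> carrier ?F" for y
    by (rule inj) (use inv(1)[OF y0[OF y]] y in \<open>simp_all add: \<sigma>0 \<sigma>'1\<close>)
  have r2: "U (U' y) = y \<and> W (U' y) \<oplus>\<^bsub>?F\<^esub> (U (W' y) \<oplus>\<^bsub>?F\<^esub> s \<odot>\<^bsub>?F\<^esub> W (W' y)) = \<zero>\<^bsub>?F\<^esub>"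
    if y: "y \<in> carrier ?F" for y
    by (rule inj) (use inv(2)[OF y0[OF y]] y in \<open>simp_all add: \<sigma>'0 \<sigma>1\<close>)
  have Ue: "U ?e = ?e \<and> W ?e = \<rho>"
    by (rule inj) (use \<sigma>(2) \<sigma>0[OF e] e \<rho> in \<open>simp_all add: unitE\<close>)
  show ?thesis
    by (rule twisted_automorphism[OF A N t U W U' W' _ _ _ _ e]) (use r1 r2 Ue in auto)
qed

section \<open>Transitivity on unimodular vectors and cancellation\<close>

lemma unimodular_iso_image:
  assumes "module R M" "unimodular R M u" "\<sigma> \<in> module_iso R M N"
  shows "unimodular R N (\<sigma> u)"
proof -
  obtain F where u: "u \<in> carrier M" and F: "F \<in> module_hom R M (regular_module R)" "F u = \<one>\<^bsub>R\<^esub>"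
    using assms(2) by (auto simp: unimodular_def)
  obtain \<sigma>' where s: "\<sigma> \<in> module_hom R M N" "\<sigma>' \<in> module_hom R N M"
    "\<And>x. x \<in> carrier M \<Longrightarrow> \<sigma>' (\<sigma> x) = x" "\<And>y. y \<in> carrier N \<Longrightarrow> \<sigma> (\<sigma>' y) = y"
    by (rule module_isoE[OF assms(3,1)]) blast
  show ?thesis
    unfolding unimodular_def
    using module_hom_closed[OF s(1) u] s(3)[OF u] F(2)
    by (intro conjI bexI[OF _ module_hom_comp[OF s(2) F(1)]]) simp_all
qed

lemma (in noetherian_cring) transitive_if_extensions_cancellative:
  assumes P: "module A P" "locally_free A P d"
    and dim: "\<And>c k. prime_chain {} c k \<Longrightarrow> k \<le> d"
    and comp: "\<And>s. s \<in> carrier A \<Longrightarrow> completable (quad_ext A s) (d + 1) d"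
    and u: "unimodular A (direct_sum P (free_module A 1)) u"
  shows "\<exists>\<sigma>\<in>module_iso A (direct_sum P (free_module A 1)) (direct_sum P (free_module A 1)).
    \<sigma> u = (\<zero>\<^bsub>P\<^esub>, scalar \<one>)"
proof -
  interpret P: module A P by fact
  let ?N = "direct_sum P (free_module A 1)"
  have N: "module A ?N" by (rule module_direct_sum[OF P(1) module_free_module[OF is_cring]])
  obtain s \<Phi> \<Psi> where t: "trivialization A P d s \<Phi> \<Psi>"
    and gen: "\<forall>Q. primeideal Q A \<longrightarrow> s \<in> Q \<longrightarrow> (\<exists>Q'. primeideal Q' A \<and> Q' \<subset> Q)"
    using generic_trivialization[OF P] by blast
  have s: "s \<in> carrier A" and \<Phi>: "\<Phi> \<in> module_hom A (free_module A d) P"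
    and \<Psi>: "\<Psi> \<in> module_hom A P (free_module A d)"
    and \<Phi>\<Psi>: "\<And>x. x \<in> carrier P \<Longrightarrow> \<Phi> (\<Psi> x) = s \<odot>\<^bsub>P\<^esub> x"
    using t by (simp_all add: trivialization_def)
  have "k < d" if c: "prime_chain {s \<otimes> s} c k" for c k
  proof -
    have "primeideal (c 0) A" "s \<otimes> s \<in> c 0" using c by (auto simp: prime_chain_def)
    \<comment> \<open>No minimal prime contains \<open>s\<close>, so a chain of primes over
      \<open>s \<otimes> s\<close> can be prolonged downwards; hence it is shorter than
      \<open>d\<close>.\<close>
    then obtain Q' where Q': "primeideal Q' A" "Q' \<subset> c 0"
      using gen primeideal_mult[of "c 0" s s] s by blast
    have "prime_chain {} (case_nat Q' c) (Suc k)"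
      using c Q' unfolding prime_chain_def by (auto split: nat.split)
    from dim[OF this] show ?thesis by simp
  qed
  then obtain \<sigma> p b where \<sigma>: "\<sigma> \<in> module_iso A ?N ?N" and p: "p \<in> carrier P" and b: "b \<in> carrier A"
    and \<sigma>u: "\<sigma> u = ((s \<otimes> s) \<odot>\<^bsub>P\<^esub> p, scalar (\<one> \<oplus> s \<otimes> s \<otimes> b))"
    using unimodular_reduction[OF P m_closed[OF s s] _ u] by blast
  define \<Phi>1 where "\<Phi>1 y = (\<Phi> (\<lambda>i\<in>{..<d}. y i), \<lambda>i\<in>{..<1::nat}. y (d + i))" for y
  note tN = trivialization_direct_sum[OF P(1) t, of 1, folded \<Phi>1_def]
  let ?F = "free_module A (d + 1)"
  let ?e = "unit_vec A (d + 1) d"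
  \<comment> \<open>Of the two factors \<open>s\<close>, one is spent in P on \<Phi> (\<Psi> p) = s
    p and the other stays in front of \<rho>. The last coordinate passes through
    \<open>\<Phi>1\<close> unchanged, so there the first factor has to remain inside \<rho>.\<close>
  define \<rho> where "\<rho> = (\<lambda>i\<in>{..<d + 1}. if i < d then \<Psi> p i else s \<otimes> b)"
  have \<Psi>p: "\<Psi> p \<in> carrier (free_module A d)" by (rule module_hom_closed[OF \<Psi> p])
  have \<rho>: "\<rho> \<in> carrier ?F"
    unfolding \<rho>_def using free_module_coord[OF \<Psi>p] s b by (intro restrict_free_module) simp
  have "restrict (?e \<oplus>\<^bsub>?F\<^esub> s \<odot>\<^bsub>?F\<^esub> \<rho>) {..<d} = s \<odot>\<^bsub>free_module A d\<^esub> \<Psi> p"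
    using free_module_coord[OF \<Psi>p] s by (auto simp: unit_vec_def \<rho>_def fun_eq_iff)
  then have "\<Phi> (restrict (?e \<oplus>\<^bsub>?F\<^esub> s \<odot>\<^bsub>?F\<^esub> \<rho>) {..<d}) = (s \<otimes> s) \<odot>\<^bsub>P\<^esub> p"
    using module_hom_smult[OF \<Phi> s \<Psi>p] \<Phi>\<Psi>[OF p] P.smult_assoc1[OF s s p] by simp
  moreover have "(\<lambda>i\<in>{..<1::nat}. (?e \<oplus>\<^bsub>?F\<^esub> s \<odot>\<^bsub>?F\<^esub> \<rho>) (d + i)) = scalar (\<one> \<oplus> s \<otimes> s \<otimes> b)"
    using s b by (auto simp: unit_vec_def \<rho>_def scalar_def fun_eq_iff m_assoc)
  ultimately have \<Phi>1: "\<Phi>1 (?e \<oplus>\<^bsub>?F\<^esub> s \<odot>\<^bsub>?F\<^esub> \<rho>) = \<sigma> u"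
    unfolding \<Phi>1_def \<sigma>u by (simp only:)
  have "restrict ?e {..<d} = \<zero>\<^bsub>free_module A d\<^esub>"
    by (auto simp: unit_vec_def fun_eq_iff)
  moreover have "(\<lambda>i\<in>{..<1::nat}. ?e (d + i)) = scalar \<one>"
    by (auto simp: unit_vec_def scalar_def fun_eq_iff)
  ultimately have \<Phi>1e: "\<Phi>1 ?e = (\<zero>\<^bsub>P\<^esub>, scalar \<one>)"
    using module_hom_zero[OF \<Phi> module_free_module[OF is_cring] P(1)] unfolding \<Phi>1_def by (simp only:)
  have uni: "unimodular A ?N (\<Phi>1 (?e \<oplus>\<^bsub>?F\<^esub> s \<odot>\<^bsub>?F\<^esub> \<rho>))"
    unfolding \<Phi>1 by (rule unimodular_iso_image[OF N u \<sigma>])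
  have "\<exists>\<tau>\<in>module_iso A ?N ?N. \<tau> (\<Phi>1 (?e \<oplus>\<^bsub>?F\<^esub> s \<odot>\<^bsub>?F\<^esub> \<rho>)) = \<Phi>1 ?e"
    by (rule quad_ext_move[OF is_cring N tN less_add_one comp[OF s] \<rho> uni])
  then obtain \<tau> where \<tau>: "\<tau> \<in> module_iso A ?N ?N" "\<tau> (\<sigma> u) = (\<zero>\<^bsub>P\<^esub>, scalar \<one>)"
    unfolding \<Phi>1 \<Phi>1e by blast
  then show ?thesis by (intro bexI[OF _ module_iso_comp[OF \<sigma> \<tau>(1)]]) simp
qed

text \<open>Reduction modulo \<open>t\<close> = 0: the chain bound holds for the whole ring, and a
  congruence to (0, 1) modulo 0 is an equality.\<close>

lemma (in noetherian_cring) transitive_large_rank: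
  assumes P: "module A P" "locally_free A P n"
    and dim: "\<And>c k. prime_chain {} c k \<Longrightarrow> k < n"
    and u: "unimodular A (direct_sum P (free_module A 1)) u"
  shows "\<exists>\<sigma>\<in>module_iso A (direct_sum P (free_module A 1)) (direct_sum P (free_module A 1)).
    \<sigma> u = (\<zero>\<^bsub>P\<^esub>, scalar \<one>)"
proof -
  interpret P: module A P by fact
  have "k < n" if "prime_chain {\<zero>} c k" for c k
    using dim[of c k] that by (simp add: prime_chain_def)
  then obtain \<sigma> p b where \<sigma>: "\<sigma> \<in> module_iso A (direct_sum P (free_module A 1)) (direct_sum P (free_module A 1))"
    and "p \<in> carrier P" "b \<in> carrier A" "\<sigma> u = (\<zero> \<odot>\<^bsub>P\<^esub> p, scalar (\<one> \<oplus> \<zero> \<otimes> b))"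
    using unimodular_reduction[OF P zero_closed _ u] by blast
  then show ?thesis by (intro bexI[OF _ \<sigma>]) simp
qed

text \<open>Summands come off one at a time. As long as P \<oplus> A^m with m > 0 is left, its rank
  d + m exceeds the dimension and transvections suffice; only the last step, in rank
  \<open>d\<close>, calls on the extensions.\<close>

lemma (in noetherian_cring) cancel_free_summand:
  assumes P: "module A P" "locally_free A P d"
    and dim: "\<And>c k. prime_chain {} c k \<Longrightarrow> k \<le> d"
    and comp: "\<And>s. s \<in> carrier A \<Longrightarrow> completable (quad_ext A s) (d + 1) d"
    and Q: "module A Q"
    and "module_isomorphic A (direct_sum P (free_module A m)) (direct_sum Q (free_module A m))"
  shows "module_isomorphic A P Q"
  using assms(6)
proof (induction m)
  case 0
  have "module_isomorphic A P (direct_sum P (free_module A 0))"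
    by (rule module_isomorphic_sym[OF direct_sum_zero_isomorphic[OF P(1)]
      module_direct_sum[OF P(1) module_free_module[OF is_cring]]])
  from module_isomorphic_trans[OF module_isomorphic_trans[OF this 0] direct_sum_zero_isomorphic[OF Q]]
  show ?case .
next
  case (Suc m)
  have fm: "module A (free_module A k)" for k by (rule module_free_module[OF is_cring])
  let ?P = "direct_sum P (free_module A m)" and ?Q = "direct_sum Q (free_module A m)"
  have mP: "module A ?P" and mQ: "module A ?Q" by (rule module_direct_sum[OF P(1) fm] module_direct_sum[OF Q fm])+
  have lP: "locally_free A ?P (d + m)" by (rule locally_free_direct_sum[OF P])
  have iso: "module_isomorphic A (direct_sum ?P (free_module A 1)) (direct_sum ?Q (free_module A 1))"
    by (rule module_isomorphic_trans[OF module_isomorphic_trans[OF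
      module_isomorphic_sym[OF direct_sum_free_assoc[OF P(1)] module_direct_sum[OF P(1) fm]] Suc.prems]
      direct_sum_free_assoc[OF Q]])
  have "module_isomorphic A ?P ?Q"
  proof (cases "m = 0")
    case True
    then have lP': "locally_free A ?P d" using lP by simp
    show ?thesis
    proof (rule cancel_by_transitivity[OF mP mQ iso])
      fix u assume u: "unimodular A (direct_sum ?P (free_module A 1)) u"
      show "\<exists>\<sigma>\<in>module_iso A (direct_sum ?P (free_module A 1)) (direct_sum ?P (free_module A 1)).
        \<sigma> u = (\<zero>\<^bsub>?P\<^esub>, scalar \<one>)"
        by (rule transitive_if_extensions_cancellative[OF mP lP' _ _ u]) (fact dim comp)+
    qed
  next
    case False
    then have "k < d + m" if "prime_chain {} c k" for c k using dim[OF that] by simp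
    then show ?thesis
      by (intro cancel_by_transitivity[OF mP mQ iso] transitive_large_rank[OF mP lP])
  qed
  then show ?case by (rule Suc.IH)
qed

theorem theorem1p3:
  fixes A :: "('a, 'k) ring_scheme"
    and P :: "('a, 'p) module"
    and d :: nat
  assumes "cring A"
    and "noetherian_ring A"
    and "krull_dim A = ereal (real d)"
    and "\<And>(R :: 'a list set ring) \<phi>. finite_extension A R \<phi> \<Longrightarrow>
           cancellative TYPE('a list set list set) R (free_module R d)"
    and "fg_projective A P"
    and "has_rank A P d"
  shows "cancellative TYPE('q) A P"
proof -
  interpret noetherian_cring A
    using assms(1,2) by (simp add: noetherian_cring_def)
  have P: "module A P" using assms(5) by (simp add: fg_projective_def)
  have lf: "locally_free A P d" by (rule locally_free_if_has_rank[OF assms(1,5,6)])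
  have dim: "k \<le> d" if "prime_chain {} c k" for c k
  proof -
    have "k \<in> {n. \<exists>p :: nat \<Rightarrow> 'a set. (\<forall>i\<le>n. primeideal (p i) A) \<and> (\<forall>i<n. p i \<subset> p (Suc i))}"
      using that by (auto simp: prime_chain_def)
    then have "ereal (real k) \<le> krull_dim A" unfolding krull_dim_def by (rule SUP_upper)
    then show ?thesis using assms(3) by simp
  qed
  \<comment> \<open>A ring with 1 = 0 has no primes, hence dimension -\<infinity>, while
    \<open>d\<close> is finite. This keeps the two generators of the quadratic extension
    apart.\<close>
  have one: "\<one>\<^bsub>A\<^esub> \<noteq> \<zero>\<^bsub>A\<^esub>"
  proof
    assume "\<one>\<^bsub>A\<^esub> = \<zero>\<^bsub>A\<^esub>"
    then have "\<not> primeideal Q A" for Q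
      using primeideal_one_notin[of Q] additive_subgroup.zero_closed[of Q A]
        ideal.axioms(1)[of Q A] primeideal.axioms(1)[of Q A] by auto
    then have "{n. \<exists>p :: nat \<Rightarrow> 'a set. (\<forall>i\<le>n. primeideal (p i) A) \<and> (\<forall>i<n. p i \<subset> p (Suc i))} = {}"
      by blast
    then have "krull_dim A = - \<infinity>" unfolding krull_dim_def by (simp only:) (simp add: bot_ereal_def)
    then show False using assms(3) by simp
  qed
  have comp: "completable (quad_ext A s) (d + 1) d" if s: "s \<in> carrier A" for s
  proof -
    let ?E = "quad_ext A s"
    have E: "cring ?E" by (rule cring_quad_ext[OF s])
    \<comment> \<open>The quadratic extension is replaced by an isomorphic copy on the carrier type
      for which cancellativity is assumed.\<close>
    obtain R :: "'a list set ring" and g where g: "g \<in> ring_iso ?E R"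
      and R: "Defs.finite_extension A R (g \<circ> (\<lambda>a. (a, \<zero>\<^bsub>A\<^esub>)))"
      using finite_extension_universe[OF assms(1) finite_extension_quad_ext[OF assms(1) s one]]
      by blast
    have cR: "cring R" using R by (simp add: Defs.finite_extension_def)
    show ?thesis
      unfolding Suc_eq_plus1[symmetric]
      by (rule completable_ring_iso[OF E cR g completable_if_cancellative[OF cR assms(4)[OF R]]])
  qed
  show ?thesis
    unfolding cancellative_def
  proof (intro allI impI)
    fix Q :: "('a, 'q) module" and m
    assume "fg_projective A Q"
      and iso: "module_isomorphic A (direct_sum P (free_module A m)) (direct_sum Q (free_module A m))"
    then have Q: "module A Q" by (simp add: fg_projective_def)
    show "module_isomorphic A P Q"
      by (rule cancel_free_summand[OF P lf _ _ Q iso]) (fact dim comp)+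
  qed
qed

end
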